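(* Let $\Omega=[0,1]^d$ be the $d$-dimensional torus and let $U_0,U_1\in C^\infty(\Omega,\mathbb{R})$ with $\int_\Omega e^{-U_0(x)}\,dx=1$. Put $\rho_0=e^{-U_0}$ and $\rho_1=e^{-U_1}/\int_\Omega e^{-U_1(x)}\,dx$. Suppose that $V\in C^\infty(\Omega)$ is a Morse function solving $$\Delta V=\rho_1-\rho_0\ \text{ on }\Omega,\qquad \int_\Omega V(x)\,dx=0,$$ and let $b=\nabla V$, with flow $X_t$ and Jacobian $J_t$. Then there exists a continuously differentiable real-valued function $\varkappa$, defined almost everywhere on $\Omega$ (that is, on an open subset of $\Omega$ of full Lebesgue measure), such that $$\int_{-\infty}^{0}\rho_0(X_s(x))\,J_s(x)\,ds=\int_{-\infty}^{\varkappa(x)}\rho_1(X_s(x))\,J_s(x)\,ds .$$ Furthermore, the map $T(x):=X_{\varkappa(x)}(x)$ is a transport map from $\rho_0$ to $\rho_1$, i.e. $T\#\rho_0=\rho_1$.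
   Context: The flow map $X_t:\Omega\to\Omega$ ($t\in\mathbb{R}$) of a smooth velocity field $b$ on the torus is defined by $\frac{d}{dt}X_t(x)=b(X_t(x))$, $X_0(x)=x$, and $J_t(x)=|\det(\nabla_xX_t(x))|=\exp\big(\int_0^t(\nabla\cdot b)(X_s(x))\,ds\big)$. A Morse function is a smooth function all of whose critical points have non-degenerate Hessian. $T\#\rho_0$ denotes the pushforward of the probability distribution with density $\rho_0$ by the map $T$. *)

theory Defs
  imports "HOL-Analysis.Analysis"
begin

text \<open>
  The torus of dimension \<open>d = CARD('n)\<close> is the quotient of \<open>real ^ 'n\<close> by the integer lattice.
  Functions, vector fields and flows on it are represented by their lifts to \<open>real ^ 'n\<close>;
  measures on it live on the half-open unit cube, which is a fundamental domain.
\<close>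

definition int_lattice :: "(real ^ 'n) set" where
  "int_lattice = {k. \<forall>i. k $ i \<in> \<int>}"

definition periodic :: "(real ^ 'n \<Rightarrow> 'b) \<Rightarrow> bool" where
  "periodic f \<longleftrightarrow> (\<forall>x. \<forall>k\<in>int_lattice. f (x + k) = f x)"

definition unit_cell :: "(real ^ 'n) set" where
  "unit_cell = {x. \<forall>i. 0 \<le> x $ i \<and> x $ i < 1}"

definition torus_proj :: "real ^ 'n \<Rightarrow> real ^ 'n" where
  "torus_proj x = (\<chi> i. frac (x $ i))"

definition torus_measure :: "(real ^ 'n) measure" where
  "torus_measure = restrict_space lborel unit_cell"

text \<open>Meant for open \<open>S\<close>: \<open>f\<close> is of class \<open>C\<close>\<open>\<^sup>k\<close> on \<open>S\<close>, by recursion on directional derivatives.\<close>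

fun C_k_on :: "nat \<Rightarrow> ('a::real_normed_vector \<Rightarrow> 'b::real_normed_vector) \<Rightarrow> 'a set \<Rightarrow> bool" where
  "C_k_on 0 f S \<longleftrightarrow> continuous_on S f"
| "C_k_on (Suc k) f S \<longleftrightarrow> (\<forall>x\<in>S. f differentiable (at x)) \<and>
     (\<forall>v. C_k_on k (\<lambda>x. frechet_derivative f (at x) v) S)"

definition torus_smooth :: "(real ^ 'n \<Rightarrow> real) \<Rightarrow> bool" where
  "torus_smooth f \<longleftrightarrow> periodic f \<and> (\<forall>k. C_k_on k f UNIV)"

definition partial_deriv :: "'n \<Rightarrow> (real ^ 'n \<Rightarrow> real) \<Rightarrow> real ^ 'n \<Rightarrow> real" where
  "partial_deriv i f x = frechet_derivative f (at x) (axis i 1)"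

definition grad :: "(real ^ 'n \<Rightarrow> real) \<Rightarrow> real ^ 'n \<Rightarrow> real ^ 'n" where
  "grad f x = (\<chi> i. partial_deriv i f x)"

definition hessian :: "(real ^ 'n \<Rightarrow> real) \<Rightarrow> real ^ 'n \<Rightarrow> real ^ 'n ^ 'n" where
  "hessian f x = (\<chi> i j. partial_deriv i (partial_deriv j f) x)"

definition laplacian :: "(real ^ 'n \<Rightarrow> real) \<Rightarrow> real ^ 'n \<Rightarrow> real" where
  "laplacian f x = (\<Sum>i\<in>UNIV. partial_deriv i (partial_deriv i f) x)"

definition torus_morse :: "(real ^ 'n \<Rightarrow> real) \<Rightarrow> bool" where
  "torus_morse f \<longleftrightarrow> torus_smooth f \<and> (\<forall>x. grad f x = 0 \<longrightarrow> det (hessian f x) \<noteq> 0)"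

definition is_flow :: "(real ^ 'n \<Rightarrow> real ^ 'n) \<Rightarrow> (real \<Rightarrow> real ^ 'n \<Rightarrow> real ^ 'n) \<Rightarrow> bool" where
  "is_flow b X \<longleftrightarrow> (\<forall>x. X 0 x = x \<and>
     (\<forall>t. ((\<lambda>s. X s x) has_vector_derivative b (X t x)) (at t)))"

definition flow_jacobian :: "(real \<Rightarrow> real ^ 'n \<Rightarrow> real ^ 'n) \<Rightarrow> real \<Rightarrow> real ^ 'n \<Rightarrow> real" where
  "flow_jacobian X t x = \<bar>det (matrix (frechet_derivative (X t) (at x)))\<bar>"

text \<open>
  \<open>T\<close> is the lift of a map defined on the subset \<open>D\<close> of the torus, where \<open>D\<close> has full measure.
  Measurability is required explicitly, since \<open>distr\<close> is meaningless without it.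
\<close>

definition is_transport_map ::
  "(real ^ 'n) set \<Rightarrow> (real ^ 'n \<Rightarrow> real ^ 'n) \<Rightarrow> (real ^ 'n \<Rightarrow> real) \<Rightarrow> (real ^ 'n \<Rightarrow> real) \<Rightarrow> bool" where
  "is_transport_map D T \<rho> \<sigma> \<longleftrightarrow>
     (torus_proj \<circ> T) \<in> measurable (restrict_space torus_measure D) torus_measure \<and>
     distr (density (restrict_space torus_measure D) (\<lambda>x. ennreal (\<rho> x))) torus_measure (torus_proj \<circ> T)
       = density torus_measure (\<lambda>x. ennreal (\<sigma> x))"

end

theory Submission
  imports Defs
begin

text \<open>
  Write \<open>F\<^sub>i t x = \<rho>\<^sub>i (X t x) J t x\<close>. Since \<open>div b = \<Delta>V = \<rho>1 - \<rho>0\<close>, Liouville's formula reads \<open>d/dt J = F\<^sub>1 - F\<^sub>0\<close>.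
  Suppose that \<open>J t x\<close> tends to \<open>0\<close> exponentially as \<open>t \<rightarrow> -\<infinity>\<close>. Then \<open>F\<^sub>0\<close> and \<open>F\<^sub>1\<close> are integrable at \<open>-\<infinity>\<close>, and
  the integral of \<open>F\<^sub>1 - F\<^sub>0\<close> over \<open>(-\<infinity>, 0]\<close> is \<open>J 0 x = 1\<close>. The equation for \<open>\<kappa>\<close> therefore says that the
  integral of \<open>F\<^sub>1\<close> over the bounded interval \<open>[\<kappa> x, 0]\<close> is \<open>1\<close>. It has a unique solution, as the integral of
  \<open>F\<^sub>1\<close> over \<open>(-\<infinity>, 0]\<close> is \<open>1\<close> plus that of \<open>F\<^sub>0 > 0\<close>, and the solution is of class C1 by implicit
  differentiation (\<open>ex_level\<close>, \<open>\<kappa>_has_derivative\<close>, \<open>integral_equation\<close>).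

  The Jacobian decays in this way when the backward orbit of \<open>x\<close> ends at a nondegenerate minimum of
  \<open>V\<close>, because \<open>\<Delta>V\<close> is positive there (\<open>jac_decays_backwards\<close>). These points form an open set, the basin. Its
  complement is a null set (\<open>negligible_Compl_basin\<close>): every backward orbit ends up near one critical point, and
  if this is not a minimum, then the Hessian is negative in some direction, and the difference of two
  orbits that starts in this direction grows exponentially backwards in time. So the set of points whose
  backward orbits stay near the critical point has disjoint translates in a fixed direction, which forces
  it to have measure zero.

  For the transport property, let \<open>A t x\<close> be the integral of \<open>F\<^sub>1\<close> from \<open>0\<close> to \<open>t\<close>. The cocycle identities of
  flow and Jacobian give \<open>A (t + \<kappa> (X t x)) x = A t x - J t x\<close>, whose right-hand side has derivative \<open>F\<^sub>0 > 0\<close>. Hence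
  \<open>T x = X (\<kappa> x) x\<close> is injective on the basin, and differentiation at \<open>t = 0\<close> yields
  \<open>F\<^sub>1 (\<kappa> x) x (1 + b \<bullet> \<nabla>\<kappa>) = \<rho>0 x\<close>. The left-hand side is \<open>\<rho>1 (T x) |det DT|\<close>, since \<open>DT\<close> is the derivative of the
  flow after a rank one perturbation of the identity (\<open>T_jacobian\<close>). By change of variables the image of \<open>\<rho>0\<close> is
  at most \<open>\<rho>1\<close> (\<open>pushforward_le\<close>), and both have total mass \<open>1\<close>, so they are equal.

  The flow is given only as a solution of the differential equation; that it is of class C1 with Jacobian
  satisfying Liouville's formula is derived from Gronwall estimates and the variational equation.
\<close>

section \<open>Growth bounds and linear differential equations\<close>

text \<open>
  The quantity \<open>(|z|\<^sup>2 + e\<^sup>2) exp (- (2 K + 1) t)\<close> does not increase. Squares are used because the norm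
  is not differentiable where \<open>z\<close> vanishes; the price is the rate \<open>K + 1\<close> in place of \<open>K\<close>.
\<close>

lemma norm_growth_forward:
  fixes z w :: "real \<Rightarrow> 'a::real_inner"
  assumes K: "0 \<le> K" and e: "0 \<le> e" and t: "0 \<le> t"
    and der: "\<And>s. 0 \<le> s \<Longrightarrow> s \<le> t \<Longrightarrow> (z has_vector_derivative w s) (at s)"
    and bd: "\<And>s. 0 \<le> s \<Longrightarrow> s \<le> t \<Longrightarrow> norm (w s) \<le> K * norm (z s) + e"
  shows "norm (z t) \<le> (norm (z 0) + e) * exp ((K + 1) * t)"
proof -
  define L where "L = 2 * K + 1"
  define h where "h s = (z s \<bullet> z s + e^2) * exp (- L * s)" for s
  have dh: "\<exists>y. DERIV h s :> y \<and> y \<le> 0" if s: "0 \<le> s" "s \<le> t" for s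
  proof -
    have "((\<lambda>s. z s \<bullet> z s) has_real_derivative 2 * (z s \<bullet> w s)) (at s)"
      using bounded_bilinear.has_vector_derivative[OF bounded_bilinear_inner der[OF s] der[OF s]]
      by (simp add: has_real_derivative_iff_has_vector_derivative inner_commute)
    then have D: "DERIV h s :> (2 * (z s \<bullet> w s)) * exp (- L * s) + (z s \<bullet> z s + e^2) * (- L * exp (- L * s))"
      unfolding h_def by (auto intro!: derivative_eq_intros)
    have "z s \<bullet> w s \<le> norm (z s) * norm (w s)" by (rule norm_cauchy_schwarz)
    also have "\<dots> \<le> norm (z s) * (K * norm (z s) + e)"
      using bd[OF s] by (intro mult_left_mono) auto
    also have "\<dots> = K * (z s \<bullet> z s) + norm (z s) * e"
      by (simp add: algebra_simps power2_norm_eq_inner[symmetric] power2_eq_square)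
    finally have "2 * (z s \<bullet> w s) \<le> 2 * K * (z s \<bullet> z s) + 2 * norm (z s) * e" by simp
    also have "2 * norm (z s) * e \<le> z s \<bullet> z s + e^2"
      using sum_squares_bound[of "norm (z s)" e] by (simp add: power2_norm_eq_inner)
    finally have "2 * (z s \<bullet> w s) \<le> L * (z s \<bullet> z s) + e^2" by (simp add: L_def algebra_simps)
    also have "e^2 \<le> L * e^2" using K by (simp add: L_def mult_le_cancel_right1)
    finally have "2 * (z s \<bullet> w s) - (z s \<bullet> z s + e^2) * L \<le> 0" by (simp add: algebra_simps)
    then have "(2 * (z s \<bullet> w s) - (z s \<bullet> z s + e^2) * L) * exp (- L * s) \<le> 0"
      by (simp add: mult_nonpos_nonneg)
    then show ?thesis using D by (force simp: algebra_simps)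
  qed
  have "h t \<le> h 0" using DERIV_nonpos_imp_nonincreasing[OF t] dh by blast
  then have "(z t \<bullet> z t + e^2) * exp (- L * t) * exp (L * t) \<le> (z 0 \<bullet> z 0 + e^2) * exp (L * t)"
    by (simp add: h_def mult_right_mono)
  then have "z t \<bullet> z t + e^2 \<le> (z 0 \<bullet> z 0 + e^2) * exp (L * t)"
    by (simp add: mult.assoc flip: exp_add)
  then have "(norm (z t))^2 \<le> ((norm (z 0))^2 + e^2) * exp (L * t)"
    using zero_le_power2[of e] unfolding power2_norm_eq_inner by linarith
  also have "\<dots> \<le> (norm (z 0) + e)^2 * exp (2 * ((K + 1) * t))"
  proof (intro mult_mono)
    show "(norm (z 0))\<^sup>2 + e\<^sup>2 \<le> (norm (z 0) + e)\<^sup>2"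
      using e by (simp add: power2_sum)
    show "exp (L * t) \<le> exp (2 * ((K + 1) * t))"
      using t K by (simp add: L_def mult_right_mono flip: mult.assoc)
  qed auto
  also have "\<dots> = ((norm (z 0) + e) * exp ((K + 1) * t))^2"
    by (simp add: power_mult_distrib exp_double)
  finally show ?thesis using e by (meson mult_nonneg_nonneg add_nonneg_nonneg norm_ge_zero exp_ge_zero power2_le_imp_le)
qed

lemma norm_growth:
  fixes z w :: "real \<Rightarrow> 'a::real_inner"
  assumes K: "0 \<le> K" and e: "0 \<le> e"
    and der: "\<And>s. \<bar>s\<bar> \<le> \<bar>t\<bar> \<Longrightarrow> (z has_vector_derivative w s) (at s)"
    and bd: "\<And>s. \<bar>s\<bar> \<le> \<bar>t\<bar> \<Longrightarrow> norm (w s) \<le> K * norm (z s) + e"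
  shows "norm (z t) \<le> (norm (z 0) + e) * exp ((K + 1) * \<bar>t\<bar>)"
proof (cases "0 \<le> t")
  case True
  then show ?thesis using norm_growth_forward[OF K e True, of z w] der bd by auto
next
  case False
  have "norm ((\<lambda>s. z (- s)) (- t)) \<le> (norm ((\<lambda>s. z (- s)) 0) + e) * exp ((K + 1) * (- t))"
  proof (rule norm_growth_forward[OF K e])
    fix s assume s: "0 \<le> s" "s \<le> - t"
    have "(z has_vector_derivative w (- s)) (at (- s))" using s False by (intro der) auto
    then show "((\<lambda>s. z (- s)) has_vector_derivative - w (- s)) (at s)"
      using vector_diff_chain_at[of uminus "-1" s z "w (- s)"]
      by (simp add: o_def has_vector_derivative_minus[OF has_vector_derivative_id, simplified])
    show "norm (- w (- s)) \<le> K * norm (z (- s)) + e" using s False bd[of "- s"] by auto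
  qed (use False in auto)
  then show ?thesis using False by simp
qed

text \<open>
  The integral of \<open>f\<close> from \<open>0\<close> to \<open>t\<close> for either sign of \<open>t\<close>, rescaled to the fixed interval \<open>[0,1]\<close>
  so that results on parameter-dependent integrals apply jointly in \<open>t\<close> and the parameter.
\<close>

definition primitive :: "(real \<Rightarrow> 'a::real_normed_vector) \<Rightarrow> real \<Rightarrow> 'a" where
  "primitive f t = t *\<^sub>R integral {0..1} (\<lambda>s. f (t * s))"

lemma primitive_0 [simp]: "primitive f 0 = 0"
  by (simp add: primitive_def)

lemma primitive_eq:
  fixes f F :: "real \<Rightarrow> 'a::banach"
  assumes "\<And>s. (F has_vector_derivative f s) (at s)"
  shows "primitive f t = F t - F 0"
proof -
  have "((\<lambda>s. t *\<^sub>R f (t * s)) has_integral F (t * 1) - F (t * 0)) {0..1}"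
  proof (rule fundamental_theorem_of_calculus)
    fix s :: real
    have "((F \<circ> (\<lambda>s. t * s)) has_vector_derivative t *\<^sub>R f (t * s)) (at s)"
      by (rule vector_diff_chain_at[OF _ assms])
        (auto intro!: derivative_eq_intros simp flip: has_real_derivative_iff_has_vector_derivative)
    then show "((\<lambda>s. F (t * s)) has_vector_derivative t *\<^sub>R f (t * s)) (at s within {0..1})"
      by (simp add: o_def has_vector_derivative_at_within)
  qed simp
  then show ?thesis by (simp add: primitive_def integral_unique flip: integral_cmul)
qed

lemma primitive_has_derivative:
  fixes f :: "real \<Rightarrow> 'a::euclidean_space"
  assumes "continuous_on UNIV f"
  shows "(primitive f has_vector_derivative f t) (at t)"
proof -
  have "isCont f s" for s using assms by (simp add: continuous_on_eq_continuous_at)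
  then obtain F where F: "\<And>s. (F has_vector_derivative f s) (at s)"
    using einterval_antiderivative[of "-\<infinity>" "\<infinity>" f] by auto
  have "((\<lambda>t. F t - F 0) has_vector_derivative f t) (at t)"
    using F by (auto intro!: derivative_eq_intros)
  then show ?thesis by (simp add: primitive_eq[OF F, abs_def])
qed

lemma primitive_continuous:
  fixes f :: "real \<Rightarrow> 'x::topological_space \<Rightarrow> 'a::banach"
  assumes "continuous_on UNIV (\<lambda>(t, x). f t x)"
  shows "continuous_on UNIV (\<lambda>(t, x). primitive (\<lambda>s. f s x) t)"
proof -
  have "continuous_on (UNIV \<times> cbox 0 1) (\<lambda>((t, x), s). f (t * s) x)"
    unfolding case_prod_beta
    by (rule continuous_on_compose2[OF assms[unfolded case_prod_beta], where f="\<lambda>p. (fst (fst p) * snd p, snd (fst p))", simplified])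
      (intro continuous_intros)
  then have "continuous_on UNIV (\<lambda>p. integral (cbox 0 1) (\<lambda>s. case p of (t, x) \<Rightarrow> f (t * s) x))"
    by (intro integral_continuous_on_param) (simp add: case_prod_beta)
  then show ?thesis
    unfolding primitive_def case_prod_beta by (auto intro!: continuous_intros)
qed

text \<open>
  The regularity class of the flow, of its Jacobian and of integrals along orbits: it is closed
  under composition, multiplication and integration in time.
\<close>

definition C1_family ::
  "(real \<Rightarrow> 'a::real_normed_vector \<Rightarrow> 'b::real_normed_vector) \<Rightarrow> (real \<Rightarrow> 'a \<Rightarrow> 'a \<Rightarrow>\<^sub>L 'b) \<Rightarrow> bool" where
  "C1_family f f' \<longleftrightarrow> continuous_on UNIV (\<lambda>(t, x). f t x) \<and> continuous_on UNIV (\<lambda>(t, x). f' t x) \<and>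
     (\<forall>t x. (f t has_derivative f' t x) (at x))"

lemma continuous_swap:
  "continuous_on UNIV (\<lambda>(t, x). f t x) \<Longrightarrow> continuous_on UNIV g \<Longrightarrow> continuous_on UNIV h \<Longrightarrow>
    continuous_on UNIV (\<lambda>p. f (g p) (h p))"
  using continuous_on_compose2[of UNIV "\<lambda>(t, x). f t x" UNIV "\<lambda>p. (g p, h p)"]
  by (auto intro!: continuous_intros)

lemma C1_family_primitive:
  fixes f :: "real \<Rightarrow> 'a::banach \<Rightarrow> 'b::banach"
  assumes "C1_family f f'"
  shows "C1_family (\<lambda>t x. primitive (\<lambda>s. f s x) t) (\<lambda>t x. primitive (\<lambda>s. f' s x) t)"
proof -
  have c: "continuous_on UNIV (\<lambda>(t, x). f t x)" and c': "continuous_on UNIV (\<lambda>(t, x). f' t x)"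
    and d: "\<And>t x. (f t has_derivative f' t x) (at x)"
    using assms by (auto simp: C1_family_def)
  have "((\<lambda>x. primitive (\<lambda>s. f s x) t) has_derivative primitive (\<lambda>s. f' s x) t) (at x)" for t x
  proof -
    have "continuous_on (UNIV \<times> cbox 0 1) (\<lambda>p. f' (t * snd p) (fst p))"
      by (rule continuous_on_subset[OF continuous_swap[OF c']]) (auto intro!: continuous_intros)
    then have c2: "continuous_on (UNIV \<times> cbox 0 1) (\<lambda>(x, s). f' (t * s) x)" by (simp add: case_prod_beta)
    have "((\<lambda>x. integral (cbox 0 1) ((\<lambda>x s. f (t * s) x) x)) has_derivative integral (cbox 0 1) ((\<lambda>x s. f' (t * s) x) x)) (at x)"
    proof (rule leibniz_rule[where U=UNIV])
      show "(\<lambda>s. f (t * s) y) integrable_on cbox 0 1" for y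
        by (rule integrable_continuous, rule continuous_on_subset[OF continuous_swap[OF c]]) (auto intro!: continuous_intros)
    qed (use d c2 in auto)
    then show ?thesis
      unfolding primitive_def
      by (auto intro!: derivative_eq_intros simp: blinfun.scaleR_left)
  qed
  then show ?thesis
    unfolding C1_family_def using primitive_continuous[OF c] primitive_continuous[OF c'] by blast
qed

text \<open>
  Picard iteration on the whole line at once: for \<open>g t = exp (- L |t|) y t\<close> in the supremum norm, the
  integral operator contracts by \<open>K / L \<le> 1/2\<close> when \<open>L = 2 K + 1\<close>.
\<close>

lemma linear_ode_solution:
  fixes A :: "real \<Rightarrow> 'a::euclidean_space \<Rightarrow>\<^sub>L 'a"
  assumes A: "continuous_on UNIV A" and K: "\<And>t. norm (A t) \<le> K"
  shows "\<exists>y. y 0 = y0 \<and> (\<forall>t. (y has_vector_derivative A t (y t)) (at t))"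
proof -
  have K0: "0 \<le> K" using K[of 0] norm_ge_zero order_trans by blast
  define L where "L = 2 * K + 1"
  have L: "0 < L" "K / L \<le> 1 / 2" using K0 by (auto simp: L_def field_simps)
  define G where "G g = primitive (\<lambda>s. A s (exp (L * \<bar>s\<bar>) *\<^sub>R g s))" for g :: "real \<Rightarrow> 'a"
  have cG: "continuous_on UNIV (\<lambda>s. A s (exp (L * \<bar>s\<bar>) *\<^sub>R g s))" if "continuous_on UNIV g" for g :: "real \<Rightarrow> 'a"
    using that A by (intro continuous_intros)
  have dG: "(G g has_vector_derivative A t (exp (L * \<bar>t\<bar>) *\<^sub>R g t)) (at t)" if "continuous_on UNIV g" for g :: "real \<Rightarrow> 'a" and t
    unfolding G_def by (rule primitive_has_derivative[OF cG[OF that]])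
  have bG: "norm (exp (- L * \<bar>t\<bar>) *\<^sub>R G g t) \<le> B / 2" if g: "continuous_on UNIV g" and B: "\<And>s. norm (g s) \<le> B"
    for g :: "real \<Rightarrow> 'a" and B t
  proof -
    have B0: "0 \<le> B" using B[of 0] norm_ge_zero order_trans by blast
    have "norm (integral {0..1} (\<lambda>s. A (t * s) (exp (L * \<bar>t * s\<bar>) *\<^sub>R g (t * s))))
      \<le> integral {0..1} (\<lambda>s. K * B * exp (L * \<bar>t\<bar> * s))"
    proof (rule integral_norm_bound_integral)
      show "(\<lambda>s. A (t * s) (exp (L * \<bar>t * s\<bar>) *\<^sub>R g (t * s))) integrable_on {0..1}"
        by (rule integrable_continuous_real, rule continuous_on_compose2[OF cG[OF g], of _ "\<lambda>s. t * s"])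
           (auto intro!: continuous_intros)
      show "(\<lambda>s. K * B * exp (L * \<bar>t\<bar> * s)) integrable_on {0..1}"
        by (intro integrable_continuous_real continuous_intros)
      fix s :: real assume "s \<in> {0..1}"
      then have eq: "L * \<bar>t * s\<bar> = L * \<bar>t\<bar> * s" by (simp add: abs_mult)
      have "norm (A (t * s) (exp (L * \<bar>t * s\<bar>) *\<^sub>R g (t * s))) \<le> K * (exp (L * \<bar>t * s\<bar>) * B)"
        using K0 by (intro order_trans[OF norm_blinfun] mult_mono K) (auto simp: B)
      then show "norm (A (t * s) (exp (L * \<bar>t * s\<bar>) *\<^sub>R g (t * s))) \<le> K * B * exp (L * \<bar>t\<bar> * s)"
        unfolding eq by (simp add: mult_ac)
    qed
    then have "norm (G g t) \<le> \<bar>t\<bar> * integral {0..1} (\<lambda>s. K * B * exp (L * \<bar>t\<bar> * s))"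
      unfolding G_def primitive_def by (simp add: mult_left_mono)
    also have "\<dots> = primitive (\<lambda>s. K * B * exp (L * s)) \<bar>t\<bar>" by (simp add: primitive_def mult_ac)
    also have "\<dots> = K * B * exp (L * \<bar>t\<bar>) / L - K * B * exp (L * 0) / L"
      by (rule primitive_eq) (use L in \<open>auto intro!: derivative_eq_intros simp flip: has_real_derivative_iff_has_vector_derivative\<close>)
    also have "\<dots> \<le> (K / L) * B * exp (L * \<bar>t\<bar>)" using K0 B0 L by simp
    also have "\<dots> \<le> (1 / 2) * B * exp (L * \<bar>t\<bar>)" using L B0 by (intro mult_right_mono) auto
    finally have "exp (- L * \<bar>t\<bar>) * norm (G g t) \<le> exp (- L * \<bar>t\<bar>) * (B / 2 * exp (L * \<bar>t\<bar>))"
      by (intro mult_left_mono) auto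
    also have "\<dots> = B / 2" by (simp add: exp_minus)
    finally show ?thesis by simp
  qed
  define P where "P g t = exp (- L * \<bar>t\<bar>) *\<^sub>R (y0 + G g t)" for g t
  have PB: "P g \<in> bcontfun" if g: "g \<in> bcontfun" for g
  proof -
    have c: "continuous_on UNIV g" using g by (auto simp: bcontfun_def)
    obtain B where B: "\<And>s. norm (g s) \<le> B" using g unfolding bcontfun_def bounded_iff by auto
    have cc: "continuous_on UNIV (G g)"
      using dG[OF c] by (meson continuous_at_imp_continuous_on has_vector_derivative_continuous)
    show ?thesis
    proof (rule bcontfun_normI)
      show "continuous_on UNIV (P g)" unfolding P_def using cc by (intro continuous_intros)
      fix t
      have "norm (P g t) \<le> exp (- L * \<bar>t\<bar>) * norm y0 + norm (exp (- L * \<bar>t\<bar>) *\<^sub>R G g t)"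
        unfolding P_def scaleR_right_distrib by (rule order_trans[OF norm_triangle_ineq]) simp
      also have "exp (- L * \<bar>t\<bar>) * norm y0 \<le> 1 * norm y0" using L by (intro mult_right_mono) auto
      also have "norm (exp (- L * \<bar>t\<bar>) *\<^sub>R G g t) \<le> B / 2" by (rule bG[OF c B])
      finally show "norm (P g t) \<le> norm y0 + B / 2" by simp
    qed
  qed
  define F where "F g = Bcontfun (P (apply_bcontfun g))" for g :: "real \<Rightarrow>\<^sub>C 'a"
  have F: "apply_bcontfun (F g) = P (apply_bcontfun g)" for g
    unfolding F_def by (rule Bcontfun_inverse[OF PB[OF apply_bcontfun]])
  have "\<exists>!g. F g = g"
  proof (rule banach_fix_type[of "1/2"])
    show "\<forall>g h. dist (F g) (F h) \<le> 1 / 2 * dist g h"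
    proof (intro allI dist_bound)
      fix g h :: "real \<Rightarrow>\<^sub>C 'a" and t :: real
      let ?g = "apply_bcontfun g" and ?h = "apply_bcontfun h"
      have lin: "G ?g t - G ?h t = G (\<lambda>s. ?g s - ?h s) t"
      proof -
        have 1: "((\<lambda>t. G ?g t - G ?h t) has_vector_derivative A t (exp (L * \<bar>t\<bar>) *\<^sub>R (?g t - ?h t))) (at t)" for t
          using dG[of ?g t] dG[of ?h t]
          by (auto intro!: derivative_eq_intros simp: blinfun.diff_right scaleR_diff_right)
        show ?thesis using primitive_eq[OF 1, of t] by (simp add: G_def)
      qed
      have "dist (F g t) (F h t) = norm (exp (- L * \<bar>t\<bar>) *\<^sub>R G (\<lambda>s. ?g s - ?h s) t)"
        unfolding F P_def dist_norm lin[symmetric] scaleR_diff_right[symmetric] by simp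
      also have "\<dots> \<le> dist g h / 2"
        using dist_bounded[of g _ h] by (intro bG continuous_intros) (auto simp: dist_norm)
      finally show "dist (F g t) (F h t) \<le> 1 / 2 * dist g h" by simp
    qed
  qed auto
  then obtain g where g: "F g = g" by blast
  define y where "y t = exp (L * \<bar>t\<bar>) *\<^sub>R apply_bcontfun g t" for t
  have y: "y = (\<lambda>t. y0 + G g t)"
  proof
    fix t show "y t = y0 + G g t"
      unfolding y_def by (subst g[symmetric], subst F) (simp add: P_def exp_minus)
  qed
  have "(y has_vector_derivative A t (y t)) (at t)" for t
  proof -
    have "((\<lambda>t. y0 + G g t) has_vector_derivative A t (y t)) (at t)"
      using dG[of g t] by (auto intro!: derivative_eq_intros simp: y_def)
    then show ?thesis unfolding y[symmetric] .
  qed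
  moreover have "y 0 = y0" by (simp add: y G_def)
  ultimately show ?thesis by blast
qed


text \<open>
  The form in which Gronwall estimates give continuous dependence: continuity in the initial point
  that is uniform on bounded time intervals.
\<close>

lemma jointly_continuousI:
  fixes f :: "real \<Rightarrow> 'a::real_normed_vector \<Rightarrow> 'b::real_normed_vector"
  assumes ct: "\<And>x. continuous_on UNIV (\<lambda>t. f t x)"
    and cx: "\<And>x T e. e > 0 \<Longrightarrow> \<exists>d>0. \<forall>y t. norm (y - x) < d \<longrightarrow> \<bar>t\<bar> \<le> T \<longrightarrow> norm (f t y - f t x) < e"
  shows "continuous_on UNIV (\<lambda>(t, x). f t x)"
  unfolding continuous_on_iff
proof (intro ballI allI impI)
  fix p :: "real \<times> 'a" and e :: real assume e: "0 < e"
  obtain t0 x0 where p: "p = (t0, x0)" by (cases p)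
  obtain d1 where d1: "d1 > 0" "\<And>y t. norm (y - x0) < d1 \<Longrightarrow> \<bar>t\<bar> \<le> \<bar>t0\<bar> + 1 \<Longrightarrow> norm (f t y - f t x0) < e / 2"
    using cx[of "e/2" x0 "\<bar>t0\<bar> + 1"] e by auto
  obtain d2 where d2: "d2 > 0" "\<And>t. dist t t0 < d2 \<Longrightarrow> dist (f t x0) (f t0 x0) < e / 2"
    using ct[of x0] e unfolding continuous_on_iff by (meson UNIV_I half_gt_zero)
  show "\<exists>d>0. \<forall>q\<in>UNIV. dist q p < d \<longrightarrow> dist (case q of (t, x) \<Rightarrow> f t x) (case p of (t, x) \<Rightarrow> f t x) < e"
  proof (intro exI[of _ "min 1 (min d1 d2)"] conjI ballI impI)
    fix q :: "real \<times> 'a" assume q: "dist q p < min 1 (min d1 d2)"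
    obtain t x where qq: "q = (t, x)" by (cases q)
    have "dist t t0 < min 1 (min d1 d2)" "dist x x0 < min 1 (min d1 d2)"
      using q dist_fst_le[of q p] dist_snd_le[of q p] by (auto simp: p qq)
    then have "norm (f t x - f t x0) < e / 2" "dist (f t x0) (f t0 x0) < e / 2"
      using d1(2)[of x t] d2(2)[of t] by (auto simp: dist_norm)
    then show "dist (case q of (t, x) \<Rightarrow> f t x) (case p of (t, x) \<Rightarrow> f t x) < e"
      using dist_triangle[of "f t x" "f t0 x0" "f t x0"] by (simp add: p qq dist_norm)
  qed (use d1 d2 in auto)
qed

section \<open>The flow of a vector field of class C1\<close>

text \<open>
  The uniformity assumptions on \<open>Db\<close> are what periodicity provides on the torus.
\<close>

locale C1_flow =
  fixes b :: "'a::euclidean_space \<Rightarrow> 'a" and Db :: "'a \<Rightarrow> 'a \<Rightarrow>\<^sub>L 'a" and K :: real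
    and X :: "real \<Rightarrow> 'a \<Rightarrow> 'a"
  assumes b_deriv: "\<And>x. (b has_derivative Db x) (at x)"
    and Db_ucont: "uniformly_continuous_on UNIV Db"
    and Db_bound: "\<And>x. norm (Db x) \<le> K"
    and X_0 [simp]: "\<And>x. X 0 x = x"
    and X_deriv: "\<And>x t. ((\<lambda>s. X s x) has_vector_derivative b (X t x)) (at t)"
begin

lemma K_nonneg: "0 \<le> K"
  using Db_bound[of 0] norm_ge_zero order_trans by blast

lemma b_lipschitz: "norm (b y - b x) \<le> K * norm (y - x)"
  by (rule differentiable_bound[of UNIV b "\<lambda>x. blinfun_apply (Db x)"])
    (auto simp: b_deriv Db_bound norm_blinfun.rep_eq[symmetric])

lemma b_cont: "continuous_on UNIV b"
  by (auto intro!: continuous_at_imp_continuous_on has_derivative_continuous[OF b_deriv])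

lemma Db_close:
  assumes "e > 0"
  shows "\<exists>d>0. \<forall>x y. norm (x - y) < d \<longrightarrow> norm (Db x - Db y) < e"
proof -
  from Db_ucont[unfolded uniformly_continuous_on_def, rule_format, OF assms]
  show ?thesis by (auto simp: dist_norm)
qed

lemma b_linear_approx:
  assumes "e > 0"
  obtains d where "d > 0" "\<And>x y. norm (y - x) < d \<Longrightarrow> norm (b y - b x - Db x (y - x)) \<le> e * norm (y - x)"
proof -
  obtain d where d: "d > 0" "\<forall>x y. norm (x - y) < d \<longrightarrow> norm (Db x - Db y) < e"
    using Db_close[OF assms] by blast
  have "norm (b y - b x - Db x (y - x)) \<le> e * norm (y - x)" if "norm (y - x) < d" for x y
  proof -
    have "norm ((\<lambda>z. b z - Db x z) y - (\<lambda>z. b z - Db x z) x) \<le> e * norm (y - x)"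
    proof (rule differentiable_bound[of "ball x d" _ "\<lambda>z. blinfun_apply (Db z - Db x)"])
      fix z assume "z \<in> ball x d"
      then have "norm (Db z - Db x) \<le> e" using d(2)[rule_format, of z x] by (auto simp: dist_norm norm_minus_commute)
      then show "onorm (blinfun_apply (Db z - Db x)) \<le> e" by (simp add: norm_blinfun.rep_eq)
      show "((\<lambda>z. b z - Db x z) has_derivative blinfun_apply (Db z - Db x)) (at z within ball x d)"
        using has_derivative_diff[OF has_derivative_at_withinI[OF b_deriv]
            bounded_linear_imp_has_derivative[OF blinfun.bounded_linear_right]]
        by (simp add: minus_blinfun.rep_eq)
    qed (use that d in \<open>auto simp: dist_norm norm_minus_commute\<close>)
    then show ?thesis by (simp add: blinfun.diff_right algebra_simps)
  qed
  then show thesis by (rule that[OF d(1)])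
qed

lemma solutions_close:
  assumes "\<And>t. (y has_vector_derivative b (y t)) (at t)" "\<And>t. (z has_vector_derivative b (z t)) (at t)"
  shows "norm (y t - z t) \<le> norm (y 0 - z 0) * exp ((K + 1) * \<bar>t\<bar>)"
  using norm_growth[OF K_nonneg order_refl, of t "\<lambda>t. y t - z t" "\<lambda>t. b (y t) - b (z t)"] b_lipschitz
  by (auto intro!: has_vector_derivative_diff assms)

lemma X_close: "norm (X t y - X t x) \<le> norm (y - x) * exp ((K + 1) * \<bar>t\<bar>)"
  using solutions_close[OF X_deriv X_deriv, where t=t] by simp

lemma solution_eq_flow:
  assumes "\<And>t. (y has_vector_derivative b (y t)) (at t)"
  shows "y t = X t (y 0)"
  using solutions_close[OF assms X_deriv, of t "y 0"] by simp

lemma X_add: "X (s + t) x = X s (X t x)"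
proof -
  have "((\<lambda>s. X (s + t) x) has_vector_derivative b (X (s + t) x)) (at s)" for s
    using vector_diff_chain_at[OF has_vector_derivative_add[OF has_vector_derivative_id has_vector_derivative_const] X_deriv[of x "s + t"]]
    by (simp add: o_def)
  from solution_eq_flow[OF this] show ?thesis by simp
qed

lemma X_minus [simp]: "X (- t) (X t x) = x" "X t (X (- t) x) = x"
  using X_add[of "- t" t x] X_add[of t "- t" x] by simp_all

lemma X_cont_time: "continuous_on UNIV (\<lambda>t. X t x)"
  by (auto intro!: continuous_at_imp_continuous_on has_vector_derivative_continuous[OF X_deriv])

lemma small_on_bounded_times:
  fixes C :: real
  assumes "e > 0"
  shows "\<exists>d>0. \<forall>v::'a. norm v < d \<longrightarrow> norm v * exp ((K + 1) * T) < e"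
  using assms by (intro exI[of _ "e / exp ((K + 1) * T)"]) (auto simp: field_simps)

lemma exp_bounded_times: "\<bar>t\<bar> \<le> T \<Longrightarrow> exp ((K + 1) * \<bar>t\<bar>) \<le> exp ((K + 1) * T)"
  using K_nonneg by (simp add: mult_left_mono)

lemma X_close_bounded_times: "\<bar>t\<bar> \<le> T \<Longrightarrow> norm (X t y - X t x) \<le> norm (y - x) * exp ((K + 1) * T)"
  by (rule order_trans[OF X_close mult_left_mono[OF exp_bounded_times]]) auto

lemma X_cont: "continuous_on UNIV (\<lambda>(t, x). X t x)"
proof (rule jointly_continuousI[OF X_cont_time])
  fix x T and e :: real assume "e > 0"
  then obtain d where "d > 0" "\<And>v::'a. norm v < d \<Longrightarrow> norm v * exp ((K + 1) * T) < e"
    using small_on_bounded_times by blast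
  then show "\<exists>d>0. \<forall>y t. norm (y - x) < d \<longrightarrow> \<bar>t\<bar> \<le> T \<longrightarrow> norm (X t y - X t x) < e"
    by (blast intro: order_le_less_trans[OF X_close_bounded_times])
qed

lemma Db_cont: "continuous_on UNIV Db"
  using Db_ucont by (rule uniformly_continuous_imp_continuous)

text \<open>
  The candidate for the derivative of the flow at \<open>x\<close> in direction \<open>v\<close>.
\<close>

definition Y :: "real \<Rightarrow> 'a \<Rightarrow> 'a \<Rightarrow> 'a" where
  "Y t x v = (SOME y. y 0 = v \<and> (\<forall>t. (y has_vector_derivative Db (X t x) (y t)) (at t))) t"

lemma Y_0 [simp]: "Y 0 x v = v"
  and Y_deriv: "((\<lambda>t. Y t x v) has_vector_derivative Db (X t x) (Y t x v)) (at t)"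
proof -
  have c: "continuous_on UNIV (\<lambda>t. Db (X t x))"
    by (rule continuous_on_compose2[OF Db_cont X_cont_time]) auto
  have "\<exists>y. y 0 = v \<and> (\<forall>t. (y has_vector_derivative Db (X t x) (y t)) (at t))"
    using linear_ode_solution[OF c] Db_bound by blast
  from someI_ex[OF this] show "Y 0 x v = v"
    "((\<lambda>t. Y t x v) has_vector_derivative Db (X t x) (Y t x v)) (at t)"
    unfolding Y_def by auto
qed

text \<open>
  Gronwall for the variational equation with a perturbation \<open>r\<close>. It yields uniqueness, the
  differentiability of the flow and the continuity of the derivative, according to what \<open>r\<close> measures.
\<close>

lemma variational_bound:
  assumes "0 \<le> e"
    and der: "\<And>s. \<bar>s\<bar> \<le> \<bar>t\<bar> \<Longrightarrow> (z has_vector_derivative Db (X s x) (z s) + r s) (at s)"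
    and r: "\<And>s. \<bar>s\<bar> \<le> \<bar>t\<bar> \<Longrightarrow> norm (r s) \<le> e"
  shows "norm (z t) \<le> (norm (z 0) + e) * exp ((K + 1) * \<bar>t\<bar>)"
proof (rule norm_growth[OF K_nonneg assms(1) der])
  fix s assume "\<bar>s\<bar> \<le> \<bar>t\<bar>"
  moreover have "norm (Db (X s x) (z s)) \<le> K * norm (z s)"
    by (rule order_trans[OF norm_blinfun mult_right_mono[OF Db_bound]]) simp
  ultimately show "norm (Db (X s x) (z s) + r s) \<le> K * norm (z s) + e"
    using r[of s] norm_triangle_ineq[of "Db (X s x) (z s)" "r s"] by simp
qed

lemma variational_unique:
  assumes "\<And>s. (z has_vector_derivative Db (X s x) (z s)) (at s)"
  shows "z t = Y t x (z 0)"
proof -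
  have "((\<lambda>s. z s - Y s x (z 0)) has_vector_derivative Db (X s x) (z s - Y s x (z 0)) + 0) (at s)" for s
    using has_vector_derivative_diff[OF assms Y_deriv] by (simp add: blinfun.diff_right)
  from variational_bound[OF order_refl this, of t] show ?thesis by simp
qed

lemma Y_bound: "norm (Y t x v) \<le> norm v * exp ((K + 1) * \<bar>t\<bar>)"
  using variational_bound[of 0 t "\<lambda>s. Y s x v" x "\<lambda>_. 0"] Y_deriv by simp

lemma Y_bounded_linear: "bounded_linear (Y t x)"
proof (rule bounded_linear_intro)
  show "Y t x (u + v) = Y t x u + Y t x v" for u v
  proof -
    have "((\<lambda>s. Y s x u + Y s x v) has_vector_derivative Db (X s x) (Y s x u + Y s x v)) (at s)" for s
      using has_vector_derivative_add[OF Y_deriv Y_deriv] by (simp add: blinfun.add_right)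
    from variational_unique[OF this, of t] show ?thesis by simp
  qed
  show "Y t x (c *\<^sub>R v) = c *\<^sub>R Y t x v" for c v
  proof -
    have "((\<lambda>s. c *\<^sub>R Y s x v) has_vector_derivative Db (X s x) (c *\<^sub>R Y s x v)) (at s)" for s
      using bounded_linear.has_vector_derivative[OF bounded_linear_scaleR_right Y_deriv] by (simp add: blinfun.scaleR_right)
    from variational_unique[OF this, of t] show ?thesis by simp
  qed
qed (rule Y_bound)

definition DX :: "real \<Rightarrow> 'a \<Rightarrow> 'a \<Rightarrow>\<^sub>L 'a" where
  "DX t x = Blinfun (Y t x)"

lemma DX_apply: "DX t x v = Y t x v"
  by (simp add: DX_def bounded_linear_Blinfun_apply Y_bounded_linear)

lemma DX_0 [simp]: "DX 0 x v = v"
  by (simp add: DX_apply)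

lemma DX_deriv: "((\<lambda>t. DX t x v) has_vector_derivative Db (X t x) (DX t x v)) (at t)"
  by (simp add: DX_apply Y_deriv)

text \<open>
  The difference of two orbits solves the variational equation up to the linearization error of
  \<open>b\<close>, which is \<open>o(|y - x|)\<close> uniformly on bounded times.
\<close>

lemma X_has_derivative: "(X t has_derivative DX t x) (at x)"
  unfolding has_derivative_at_alt
proof (intro conjI allI impI)
  show "bounded_linear (DX t x)" by (rule blinfun.bounded_linear_right)
  fix e :: real assume e: "0 < e"
  \<comment> \<open>Gronwall is used twice, for the distance of the orbits and for the remainder; hence \<open>E * E\<close>.\<close>
  define E where "E = exp ((K + 1) * \<bar>t\<bar>)"
  have E: "E > 0" by (simp add: E_def)
  obtain d1 where d1: "d1 > 0"
    "\<And>x y. norm (y - x) < d1 \<Longrightarrow> norm (b y - b x - Db x (y - x)) \<le> e / (E * E) * norm (y - x)"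
    using b_linear_approx[of "e / (E * E)"] e E by auto
  obtain d where d: "d > 0" "\<And>v::'a. norm v < d \<Longrightarrow> norm v * E < d1"
    using small_on_bounded_times[OF d1(1)] unfolding E_def by blast
  have "norm (X t y - X t x - DX t x (y - x)) \<le> e * norm (y - x)" if y: "norm (y - x) < d" for y
  proof -
    define q where "q s = X s y - X s x" for s
    have "norm ((\<lambda>s. q s - DX s x (y - x)) t)
        \<le> (norm ((\<lambda>s. q s - DX s x (y - x)) 0) + e / (E * E) * (norm (y - x) * E)) * E"
      unfolding E_def
    proof (rule variational_bound[where r="\<lambda>s. b (X s y) - b (X s x) - Db (X s x) (q s)" and x=x], fold E_def)
      show "0 \<le> e / (E * E) * (norm (y - x) * E)" using e E by simp
      fix s assume s: "\<bar>s\<bar> \<le> \<bar>t\<bar>"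
      show "((\<lambda>s. q s - DX s x (y - x)) has_vector_derivative
          Db (X s x) (q s - DX s x (y - x)) + (b (X s y) - b (X s x) - Db (X s x) (q s))) (at s)"
        unfolding q_def
        by (auto intro!: derivative_eq_intros X_deriv DX_deriv simp: blinfun.diff_right)
      have q: "norm (q s) \<le> norm (y - x) * E"
        unfolding q_def E_def by (rule X_close_bounded_times[OF s])
      also have "\<dots> < d1" using d y by blast
      finally have "norm (b (X s y) - b (X s x) - Db (X s x) (q s)) \<le> e / (E * E) * norm (q s)"
        using d1(2)[of "X s y" "X s x"] by (simp add: q_def)
      also have "\<dots> \<le> e / (E * E) * (norm (y - x) * E)" using e E by (intro mult_left_mono q) auto
      finally show "norm (b (X s y) - b (X s x) - Db (X s x) (q s)) \<le> e / (E * E) * (norm (y - x) * E)" .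
    qed
    then show ?thesis using E by (simp add: q_def)
  qed
  then show "\<exists>d>0. \<forall>y. norm (y - x) < d \<longrightarrow> norm (X t y - X t x - DX t x (y - x)) \<le> e * norm (y - x)"
    using d(1) by blast
qed

text \<open>
  Two solutions of variational equations along nearby orbits differ by a solution whose
  perturbation is the difference of the coefficients \<open>Db\<close> along the orbits.
\<close>

lemma DX_cont: "continuous_on UNIV (\<lambda>(t, x). DX t x)"
  unfolding case_prod_beta
proof (rule continuous_on_blinfun_componentwise)
  fix v :: 'a
  have "continuous_on UNIV (\<lambda>(t, x). DX t x v)"
  proof (rule jointly_continuousI)
    show "continuous_on UNIV (\<lambda>t. DX t x v)" for x
      by (auto intro!: continuous_at_imp_continuous_on has_vector_derivative_continuous[OF DX_deriv])
    fix x :: 'a and T e :: real assume e: "e > 0"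
    define E where "E = exp ((K + 1) * T)"
    have E: "E > 0" by (simp add: E_def)
    define c where "c = e / (2 * (norm v + 1) * (E * E))"
    have c: "c > 0" using e E by (simp add: c_def add_nonneg_pos)
    obtain d1 where d1: "d1 > 0" "\<forall>x y. norm (x - y) < d1 \<longrightarrow> norm (Db x - Db y) < c"
      using Db_close[OF c] by blast
    obtain d where d: "d > 0" "\<And>v::'a. norm v < d \<Longrightarrow> norm v * E < d1"
      using small_on_bounded_times[OF d1(1)] unfolding E_def by blast
    have "norm (DX t y v - DX t x v) < e" if y: "norm (y - x) < d" and t: "\<bar>t\<bar> \<le> T" for y t
    proof -
      have "norm ((\<lambda>s. DX s y v - DX s x v) t)
          \<le> (norm ((\<lambda>s. DX s y v - DX s x v) 0) + c * (norm v * E)) * exp ((K + 1) * \<bar>t\<bar>)"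
      proof (rule variational_bound[where r="\<lambda>s. (Db (X s y) - Db (X s x)) (DX s x v)" and x=y])
        show "0 \<le> c * (norm v * E)" using c E by simp
        fix s assume s: "\<bar>s\<bar> \<le> \<bar>t\<bar>"
        show "((\<lambda>s. DX s y v - DX s x v) has_vector_derivative
            Db (X s y) (DX s y v - DX s x v) + (Db (X s y) - Db (X s x)) (DX s x v)) (at s)"
          by (auto intro!: derivative_eq_intros DX_deriv simp: blinfun.diff_right blinfun.diff_left)
        have "norm (X s y - X s x) \<le> norm (y - x) * E"
          unfolding E_def using s t by (intro X_close_bounded_times) auto
        also have "\<dots> < d1" using d y by blast
        finally have 1: "norm (Db (X s y) - Db (X s x)) \<le> c"
          using d1(2)[rule_format, of "X s y" "X s x"] by simp
        have "norm (DX s x v) \<le> norm v * exp ((K + 1) * \<bar>s\<bar>)"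
          unfolding DX_apply by (rule Y_bound)
        also have "\<dots> \<le> norm v * E"
          unfolding E_def using s t by (intro mult_left_mono exp_bounded_times) auto
        finally show "norm ((Db (X s y) - Db (X s x)) (DX s x v)) \<le> c * (norm v * E)"
          by (rule order_trans[OF norm_blinfun mult_mono[OF 1]]) (use c in auto)
      qed
      also have "\<dots> \<le> (c * (norm v * E)) * E"
        unfolding E_def using c t by (auto intro!: mult_mono exp_bounded_times[unfolded E_def])
      also have "\<dots> = e / 2 * (norm v / (norm v + 1))"
      proof -
        have "e / (2 * N * (E * E)) * (m * E) * E = e / 2 * (m / N)" if "N > 0" for N m :: real
          using E that by (simp add: field_simps)
        from this[of "norm v + 1" "norm v"] show ?thesis by (simp only: c_def add_nonneg_pos norm_ge_zero zero_less_one)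
      qed
      also have "\<dots> \<le> e / 2 * 1"
        using e by (intro mult_left_mono) (auto simp: divide_le_eq_1 add_nonneg_pos)
      finally show ?thesis using e by simp
    qed
    then show "\<exists>d>0. \<forall>y t. norm (y - x) < d \<longrightarrow> \<bar>t\<bar> \<le> T \<longrightarrow> norm (DX t y v - DX t x v) < e"
      using d(1) by blast
  qed
  then show "continuous_on UNIV (\<lambda>p. DX (fst p) (snd p) v)" by (simp add: case_prod_beta)
qed

lemma C1_family_X: "C1_family X DX"
  by (simp add: C1_family_def X_cont DX_cont X_has_derivative)

lemma DX_add: "DX (s + t) x v = DX s (X t x) (DX t x v)"
proof -
  have "(X (s + t) has_derivative DX (s + t) x) (at x)" by (rule X_has_derivative)
  moreover have "(X (s + t) has_derivative (\<lambda>v. DX s (X t x) (DX t x v))) (at x)"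
    using diff_chain_at[OF X_has_derivative[of t x] X_has_derivative[of s "X t x"]]
    by (simp add: X_add[abs_def] o_def)
  ultimately show ?thesis using has_derivative_unique by metis
qed

text \<open>
  The velocity along an orbit solves the variational equation, since the field is autonomous.
\<close>

lemma DX_b: "DX t x (b x) = b (X t x)"
proof -
  have "((\<lambda>t. b (X t x)) has_vector_derivative Db (X s x) (b (X s x))) (at s)" for s
    using vector_derivative_diff_chain_within[OF X_deriv has_derivative_at_withinI[OF b_deriv]]
    by (simp add: o_def)
  from variational_unique[OF this] show ?thesis by (simp add: DX_apply)
qed

end

section \<open>Determinants and change of variables\<close>

text \<open>
  A permutation other than the identity moves at least two indices, so its term in the Leibniz
  expansion vanishes to second order at the identity matrix.
\<close>

lemma det_has_derivative_at_identity:
  fixes M :: "real \<Rightarrow> real^'n^'n"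
  assumes der: "\<And>i j. ((\<lambda>h. M h $ i $ j) has_real_derivative A $ i $ j) (at t)" and id: "M t = mat 1"
  shows "((\<lambda>h. det (M h)) has_real_derivative trace A) (at t)"
proof -
  let ?D = "\<lambda>p. of_int (sign p) * (\<Sum>i\<in>UNIV. A $ i $ p i * (\<Prod>j\<in>UNIV - {i}. M t $ j $ p j))"
  have "((\<lambda>h. det (M h)) has_real_derivative (\<Sum>p | p permutes UNIV. ?D p)) (at t)"
    unfolding det_def by (intro DERIV_sum DERIV_cmult has_field_derivative_prod der)
  also have "(\<Sum>p | p permutes UNIV. ?D p) = ?D id"
  proof (rule sum.remove[OF _ _, THEN trans])
    show "id \<in> {p. p permutes UNIV}" by (simp add: permutes_id)
    have "?D p = 0" if "p permutes UNIV" "p \<noteq> id" for p :: "'n \<Rightarrow> 'n"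
    proof -
      have "(\<Prod>j\<in>UNIV - {i}. M t $ j $ p j) = 0" for i
      proof -
        have "\<exists>j. j \<noteq> i \<and> p j \<noteq> j"
        proof (rule ccontr)
          assume "\<not> ?thesis"
          then have fixed: "\<And>j. j \<noteq> i \<Longrightarrow> p j = j" by auto
          moreover have "p i = i"
            using fixed permutes_inj[OF that(1)] by (metis injD)
          ultimately have "p j = j" for j by (cases "j = i") auto
          then show False using that(2) by (auto simp: fun_eq_iff)
        qed
        then obtain j where j: "j \<noteq> i" "p j \<noteq> j" by blast
        then have "M t $ j $ p j = 0" by (simp add: id mat_def)
        with j show ?thesis by (intro prod_zero) auto
      qed
      then show ?thesis by (simp only: mult_zero_right sum.neutral_const)
    qed
    then show "?D id + sum ?D ({p. p permutes UNIV} - {id}) = ?D id" by (simp add: sum.neutral)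
  qed simp
  also have "?D id = trace A" by (simp add: trace_def id mat_def sign_id)
  finally show ?thesis .
qed

text \<open>
  Put \<open>P s = 1 + s u w\<^sup>T\<close> and \<open>c = w \<bullet> u\<close>. Then \<open>P s P r = P (s + r (1 + s c))\<close>, so \<open>f s = det (P s)\<close> satisfies
  \<open>f' s (1 + s c) = c f s\<close>, and \<open>f s / (1 + s c)\<close> is constant as long as \<open>1 + s c\<close> stays positive.
\<close>

lemma det_rank_one_update:
  fixes u w :: "real^'n"
  assumes pos: "1 + w \<bullet> u > 0"
  shows "det (mat 1 + (\<chi> i j. u $ i * w $ j)) = 1 + w \<bullet> u"
proof -
  define c where "c = w \<bullet> u"
  define P where "P s = mat 1 + (\<chi> i j. s * (u $ i * w $ j))" for s
  have mult: "P s ** P r = P (s + r * (1 + s * c))" for s r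
  proof -
    have "(P s ** P r) $ i $ j = P (s + r * (1 + s * c)) $ i $ j" for i j
    proof -
      have "(P s ** P r) $ i $ j = (\<Sum>k\<in>UNIV. ((if i = k then 1 else 0) + s * (u $ i * w $ k)) * ((if k = j then 1 else 0) + r * (u $ k * w $ j)))"
        by (simp add: P_def matrix_matrix_mult_def mat_def)
      also have "\<dots> = (\<Sum>k\<in>UNIV. (if i = k then (if k = j then 1 else 0) + r * (u $ k * w $ j) else 0)
           + (if k = j then s * (u $ i * w $ k) else 0) + s * r * (u $ i * w $ j) * (w $ k * u $ k))"
        by (intro sum.cong refl) (auto simp: algebra_simps)
      also have "\<dots> = ((if i = j then 1 else 0) + r * (u $ i * w $ j)) + s * (u $ i * w $ j) + s * r * (u $ i * w $ j) * c"
        by (simp add: sum.distrib sum_distrib_left[symmetric] c_def inner_vec_def)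
      finally show ?thesis by (simp add: P_def mat_def algebra_simps)
    qed
    then show ?thesis by (simp add: vec_eq_iff)
  qed
  define f where "f s = det (P s)" for s
  have f_mult: "f (s + r * (1 + s * c)) = f s * f r" for s r
    by (simp add: f_def mult[symmetric] det_mul)
  have "(f has_real_derivative trace (\<chi> i j. u $ i * w $ j)) (at 0)"
    unfolding f_def
  proof (rule det_has_derivative_at_identity)
    show "((\<lambda>s. P s $ i $ j) has_real_derivative (\<chi> i j. u $ i * w $ j) $ i $ j) (at 0)" for i j
      unfolding P_def by (auto intro!: derivative_eq_intros)
    show "P 0 = mat 1" by (simp add: P_def vec_eq_iff)
  qed
  then have f0: "(f has_real_derivative c) (at 0)"
    by (simp add: trace_def c_def inner_vec_def mult.commute)
  have f00: "f 0 = 1"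
  proof -
    have "P 0 = mat 1" by (simp add: P_def vec_eq_iff)
    then show ?thesis by (simp add: f_def)
  qed
  have sc: "1 + s * c > 0" if "0 \<le> s" "s \<le> 1" for s
  proof (cases "c \<ge> 0")
    case False
    then have "s * c \<ge> 1 * c" using that by (intro mult_right_mono_neg) auto
    then show ?thesis using pos by (simp add: c_def)
  qed (use that in \<open>simp add: add_pos_nonneg\<close>)
  have df: "(f has_real_derivative f s * c / (1 + s * c)) (at s)" if s: "0 \<le> s" "s \<le> 1" for s
  proof -
    have eq: "f = (\<lambda>r. f s * f ((r - s) / (1 + s * c)))"
      using sc[OF s] by (auto simp: f_mult[symmetric])
    have "((\<lambda>r. (r - s) / (1 + s * c)) has_real_derivative 1 / (1 + s * c)) (at s)"
      by (rule DERIV_cdivide) (auto intro!: derivative_eq_intros)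
    then have "((\<lambda>r. f ((r - s) / (1 + s * c))) has_real_derivative c * (1 / (1 + s * c))) (at s)"
      by (intro DERIV_chain2[where f=f]) (use f0 in simp_all)
    from DERIV_cmult[OF this, of "f s"] show ?thesis by (subst eq) simp
  qed
  have dk: "((\<lambda>s. f s / (1 + s * c)) has_real_derivative 0) (at s)" if s: "0 \<le> s" "s \<le> 1" for s
  proof -
    have "((\<lambda>s. 1 + s * c) has_real_derivative c) (at s)" by (auto intro!: derivative_eq_intros)
    moreover have "1 + s * c \<noteq> 0" using sc[OF s] by simp
    ultimately show ?thesis by (intro DERIV_cong[OF DERIV_divide[OF df[OF s]]]) auto
  qed
  have "f 1 / (1 + 1 * c) = f 0 / (1 + 0 * c)"
    by (rule DERIV_isconst_end[of 0 1 "\<lambda>s. f s / (1 + s * c)"])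
      (auto intro!: continuous_at_imp_continuous_on DERIV_isCont dk)
  then have "f 1 = 1 + c" using pos by (simp add: f00 c_def)
  then show ?thesis by (simp add: f_def P_def c_def)
qed

text \<open>
  A bijection of index types induces an isometry of the coordinate spaces, which preserves Lebesgue
  measure and determinants. It carries the change of variables formula from well-ordered index
  types to all finite ones.
\<close>

definition relabel :: "('m \<Rightarrow> 'n) \<Rightarrow> real^'n \<Rightarrow> real^'m" where
  "relabel h x = (\<chi> i. x $ h i)"

lemma relabel_nth [simp]: "relabel h x $ i = x $ h i"
  by (simp add: relabel_def)

lemma bounded_linear_relabel: "bounded_linear (relabel h)"
  unfolding linear_conv_bounded_linear[symmetric] by (simp add: linear_iff vec_eq_iff)

lemma prod_Basis_vec: "(\<Prod>b\<in>(Basis :: (real^'n) set). f b) = (\<Prod>i\<in>UNIV. f (axis i 1))"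
proof -
  have "(Basis :: (real^'n) set) = range (\<lambda>i. axis i 1)" by (auto simp: Basis_vec_def)
  moreover have "inj (\<lambda>i. axis i (1::real) :: real^'n)" by (auto simp: inj_def axis_eq_axis)
  ultimately show ?thesis by (metis (no_types, lifting) prod.reindex_cong)
qed

lemma
  fixes h :: "'m::finite \<Rightarrow> 'n::finite"
  assumes h: "bij h"
  shows measurable_relabel: "relabel h \<in> lebesgue \<rightarrow>\<^sub>M lebesgue"
    and distr_relabel: "distr lebesgue lebesgue (relabel h) = lebesgue"
proof -
  have m: "relabel h \<in> borel_measurable borel"
    by (intro borel_measurable_continuous_onI linear_continuous_on bounded_linear_relabel)
  have eq: "lborel = distr lborel borel (relabel h)"
  proof (rule lborel_eqI)
    fix l u :: "real^'m" assume le: "\<And>b. b \<in> Basis \<Longrightarrow> l \<bullet> b \<le> u \<bullet> b"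
    have le': "l $ i \<le> u $ i" for i using le[of "axis i 1"] by (simp add: inner_axis axis_in_Basis_iff)
    have hi: "h (inv h i) = i" "inv h (h j) = j" for i j
      using h by (simp_all add: bij_is_surj surj_f_inv_f bij_is_inj)
    have box: "relabel h -` box l u = box (relabel (inv h) l) (relabel (inv h) u)"
      by (auto simp: mem_box_cart) (metis hi)+
    have "emeasure lborel (box (relabel (inv h) l) (relabel (inv h) u))
        = ennreal (\<Prod>b\<in>Basis. (relabel (inv h) u - relabel (inv h) l) \<bullet> b)"
      by (rule emeasure_lborel_box) (use le' in \<open>auto simp: Basis_vec_def inner_axis\<close>)
    also have "(\<Prod>b\<in>Basis. (relabel (inv h) u - relabel (inv h) l) \<bullet> b) = (\<Prod>i\<in>UNIV. (u - l) $ inv h i)"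
      by (simp add: prod_Basis_vec inner_axis)
    also have "\<dots> = (\<Prod>i\<in>UNIV. (u - l) $ i)"
      by (rule prod.reindex_bij_betw[OF bij_imp_bij_inv[OF h]])
    also have "\<dots> = (\<Prod>b\<in>Basis. (u - l) \<bullet> b)"
      by (simp add: prod_Basis_vec inner_axis)
    finally show "emeasure (distr lborel borel (relabel h)) (box l u) = ennreal (\<Prod>b\<in>Basis. (u - l) \<bullet> b)"
      using m by (simp add: emeasure_distr box)
  qed simp
  have m': "relabel h \<in> lebesgue \<rightarrow>\<^sub>M lborel" using m by (simp add: measurable_completion)
  have eq': "distr lebesgue lborel (relabel h) = lborel"
    using m by (subst distr_completion) (auto simp: eq[symmetric] cong: distr_cong)
  show "relabel h \<in> lebesgue \<rightarrow>\<^sub>M lebesgue"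
    by (rule completion.measurable_completion2[OF m']) (simp add: eq')
  show "distr lebesgue lebesgue (relabel h) = lebesgue"
    using completion.completion_distr_eq[OF m'] by (simp add: eq')
qed

lemma det_relabel:
  fixes h :: "'m::finite \<Rightarrow> 'n::finite" and A :: "real^'n^'n"
  assumes h: "bij h"
  shows "det (\<chi> i j. A $ h i $ h j) = det A"
proof -
  have k: "bij (inv h)" and kh: "inv h (h i) = i" and hk: "h (inv h j) = j" for i j
    using h by (simp_all add: bij_imp_bij_inv bij_is_surj surj_f_inv_f bij_is_inj)
  let ?m = "map_permutation UNIV (inv h)"
  have bb: "bij_betw ?m {p. p permutes UNIV} {p. p permutes UNIV}"
    by (rule bij_betw_byWitness[where f'="map_permutation UNIV h"])
      (auto simp: map_permutation_compose_inv[OF h _ kh] map_permutation_compose_inv[OF k _ hk]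
        intro: map_permutation_permutes[OF h] map_permutation_permutes[OF k])
  have ap: "h (?m p i) = p (h i)" for p i
    using map_permutation_apply[OF bij_is_inj[OF k] UNIV_I, of p "h i"] by (simp add: kh hk)
  have "det (\<chi> i j. A $ h i $ h j) = (\<Sum>p | p permutes UNIV. of_int (sign p) * (\<Prod>i\<in>UNIV. A $ h i $ h (p i)))"
    by (simp add: det_def)
  also have "\<dots> = (\<Sum>p | p permutes UNIV. of_int (sign (?m p)) * (\<Prod>i\<in>UNIV. A $ h i $ h (?m p i)))"
    by (rule sum.reindex_bij_betw[OF bb, symmetric])
  also have "\<dots> = (\<Sum>p | p permutes UNIV. of_int (sign p) * (\<Prod>i\<in>UNIV. A $ i $ p i))"
  proof (intro sum.cong refl, clarify)
    fix p :: "'n \<Rightarrow> 'n" assume p: "p permutes UNIV"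
    have "sign (?m p) = sign p"
      using p by (intro sign_map_permutation bij_is_inj[OF k]) auto
    moreover have "(\<Prod>i\<in>UNIV. A $ h i $ h (?m p i)) = (\<Prod>i\<in>UNIV. A $ i $ p i)"
      using prod.reindex_bij_betw[OF h, of "\<lambda>i. A $ i $ p i"] by (simp add: ap)
    ultimately show "of_int (sign (?m p)) * (\<Prod>i\<in>UNIV. A $ h i $ h (?m p i)) = of_int (sign p) * (\<Prod>i\<in>UNIV. A $ i $ p i)"
      by simp
  qed
  finally show ?thesis by (simp add: det_def)
qed

lemma matrix_relabel:
  fixes h :: "'m::finite \<Rightarrow> 'n::finite"
  assumes "bij h"
  shows "matrix (\<lambda>x. relabel h (f (relabel (inv h) x))) = (\<chi> i j. matrix f $ h i $ h j)"
proof -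
  have "relabel (inv h) (axis j 1) = axis (h j) 1" for j
  proof -
    have "inv h i = j \<longleftrightarrow> i = h j" for i using bij_inv_eq_iff[OF assms, of j i] by auto
    then show ?thesis by (simp add: vec_eq_iff axis_def)
  qed
  then show ?thesis by (simp add: matrix_def)
qed

lemma change_of_variables_wellorder:
  fixes T :: "real^'m::{finite,wellorder} \<Rightarrow> real^'m::_" and f g :: "real^'m::_ \<Rightarrow> real"
  assumes S: "S \<in> sets lebesgue" and der: "\<And>x. x \<in> S \<Longrightarrow> (T has_derivative T' x) (at x within S)"
    and inj: "inj_on T S"
    and jac: "\<And>x. x \<in> S \<Longrightarrow> \<bar>det (matrix (T' x))\<bar> * f (T x) = g x"
    and int: "g absolutely_integrable_on S"
  shows "f absolutely_integrable_on T ` S" and "integral (T ` S) f = integral S g"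
proof -
  have blv: "bounded_linear (vec :: real \<Rightarrow> real^1)"
    unfolding linear_conv_bounded_linear[symmetric] by (simp add: linear_iff vec_eq_iff)
  have blc: "bounded_linear (\<lambda>v::real^1. v $ 1)" by (rule bounded_linear_vec_nth)
  have 1: "(\<lambda>x. vec (g x) :: real^1) absolutely_integrable_on S"
    using absolutely_integrable_linear[OF int blv] by (simp add: o_def)
  have 2: "(\<lambda>x. \<bar>det (matrix (T' x))\<bar> *\<^sub>R (vec (f (T x)) :: real^1)) absolutely_integrable_on S"
    by (rule absolutely_integrable_spike[OF 1 negligible_empty]) (auto simp: vec_eq_iff jac)
  have 3: "integral S (\<lambda>x. \<bar>det (matrix (T' x))\<bar> *\<^sub>R (vec (f (T x)) :: real^1)) = integral S (\<lambda>x. vec (g x))"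
    by (rule integral_cong) (auto simp: vec_eq_iff jac)
  have 4: "integral S (\<lambda>x. vec (g x) :: real^1) = vec (integral S g)"
    using integral_linear[OF set_lebesgue_integral_eq_integral(1)[OF int] blv] by (simp add: o_def)
  have 5: "(\<lambda>x. vec (f x) :: real^1) absolutely_integrable_on (T ` S) \<and> integral (T ` S) (\<lambda>x. vec (f x) :: real^1) = vec (integral S g)"
    using has_absolute_integral_change_of_variables[OF S der inj, of "\<lambda>x. vec (f x) :: real^1" "vec (integral S g)"] 2 3 4 by simp
  show "f absolutely_integrable_on T ` S"
    using absolutely_integrable_linear[OF conjunct1[OF 5] blc] by (simp add: o_def)
  show "integral (T ` S) f = integral S g"
    using integral_linear[OF set_lebesgue_integral_eq_integral(1)[OF conjunct1[OF 5]] blc] 5 by (simp add: o_def)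
qed

text \<open>
  Positivity of \<open>f\<close> makes \<open>T ` S\<close> measurable: it is where \<open>f\<close> times its indicator does not vanish.
\<close>

lemma emeasure_density_image_wellorder:
  fixes T :: "real^'m::{finite,wellorder} \<Rightarrow> real^'m::_" and f g :: "real^'m::_ \<Rightarrow> real"
  assumes S: "S \<in> sets lebesgue" and der: "\<And>x. x \<in> S \<Longrightarrow> (T has_derivative T' x) (at x within S)"
    and inj: "inj_on T S"
    and jac: "\<And>x. x \<in> S \<Longrightarrow> \<bar>det (matrix (T' x))\<bar> * f (T x) = g x"
    and int: "g absolutely_integrable_on S" and f: "\<And>y. f y > 0" and g: "\<And>y. g y > 0"
    and meas: "f \<in> borel_measurable lebesgue" "g \<in> borel_measurable lebesgue"
  shows "T ` S \<in> sets lebesgue"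
    and "emeasure (density lebesgue (\<lambda>y. ennreal (f y))) (T ` S) = emeasure (density lebesgue (\<lambda>x. ennreal (g x))) S"
proof -
  have emeas: "emeasure (density lebesgue (\<lambda>y. ennreal (k y))) A = ennreal (integral A k)"
    if "k absolutely_integrable_on A" "A \<in> sets lebesgue" "\<And>y. k y > 0" "k \<in> borel_measurable lebesgue"
    for k :: "real^'m::_ \<Rightarrow> real" and A
  proof -
    have "emeasure (density lebesgue (\<lambda>y. ennreal (k y))) A = (\<integral>\<^sup>+y. ennreal (indicator A y *\<^sub>R k y) \<partial>lebesgue)"
      using that by (subst emeasure_density) (auto intro!: nn_integral_cong simp: indicator_def)
    also have "\<dots> = ennreal (LINT y:A|lebesgue. k y)"
      unfolding set_lebesgue_integral_def
      using that(1,3) by (intro nn_integral_eq_integral) (auto simp: set_integrable_def indicator_def less_imp_le)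
    also have "(LINT y:A|lebesgue. k y) = integral A k"
      by (rule set_lebesgue_integral_eq_integral(2)[OF that(1)])
    finally show ?thesis .
  qed
  note cov = change_of_variables_wellorder[OF S der inj jac int]
  have "{y \<in> space lebesgue. indicator (T ` S) y *\<^sub>R f y \<noteq> 0} \<in> sets lebesgue"
    using cov(1) by (intro borel_measurable_neq) (auto simp: set_integrable_def borel_measurable_integrable)
  also have "{y \<in> space lebesgue. indicator (T ` S) y *\<^sub>R f y \<noteq> 0} = T ` S"
    using f by (auto simp: indicator_def less_imp_neq[THEN not_sym])
  finally show TS: "T ` S \<in> sets lebesgue" .
  show "emeasure (density lebesgue (\<lambda>y. ennreal (f y))) (T ` S) = emeasure (density lebesgue (\<lambda>x. ennreal (g x))) S"
    by (simp add: emeas[OF cov(1) TS f meas(1)] emeas[OF int S g meas(2)] cov(2))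
qed

text \<open>
  A copy of a finite type, well-ordered by an arbitrary injection into the natural numbers.
\<close>

typedef 'a wo = "UNIV :: 'a set" morphisms of_wo to_wo by simp

lemma bij_of_wo: "bij of_wo"
  by (rule bij_betw_byWitness[where f'=to_wo]) (auto simp: of_wo_inverse to_wo_inverse)

definition wo_rank :: "'a::finite wo \<Rightarrow> nat" where
  "wo_rank x = (SOME f::'a \<Rightarrow> nat. inj f) (of_wo x)"

lemma inj_wo_rank: "inj (wo_rank :: 'a::finite wo \<Rightarrow> nat)"
proof -
  have "\<exists>f::'a \<Rightarrow> nat. inj f" using finite_imp_inj_to_nat_seg[of "UNIV::'a set"] by auto
  then have "inj (SOME f::'a \<Rightarrow> nat. inj f)" by (rule someI_ex)
  then have "inj ((SOME f::'a \<Rightarrow> nat. inj f) \<circ> of_wo)" by (rule inj_compose[OF _ bij_is_inj[OF bij_of_wo]])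
  then show ?thesis by (simp add: wo_rank_def[abs_def] o_def)
qed

instantiation wo :: (finite) "{finite, wellorder}"
begin
definition less_eq_wo :: "'a wo \<Rightarrow> 'a wo \<Rightarrow> bool" where "less_eq_wo x y \<longleftrightarrow> wo_rank x \<le> wo_rank y"
definition less_wo :: "'a wo \<Rightarrow> 'a wo \<Rightarrow> bool" where "less_wo x y \<longleftrightarrow> wo_rank x < wo_rank y"
instance
proof
  show "finite (UNIV :: 'a wo set)"
    using finite_vimageI[OF finite_class.finite_UNIV bij_is_inj[OF bij_of_wo]] by simp
  fix P and a :: "'a wo"
  assume "\<And>x::'a wo. (\<And>y. y < x \<Longrightarrow> P y) \<Longrightarrow> P x"
  then show "P a"
    unfolding less_wo_def by (rule measure_induct_rule)
qed (auto simp: less_eq_wo_def less_wo_def inj_eq[OF inj_wo_rank])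
end

text \<open>
  Conjugate \<open>T\<close> with the relabelling of coordinates by the well-ordered copy of the index type; the
  determinant and both sides of the equation are invariant.
\<close>

lemma emeasure_density_image:
  fixes T :: "real^'n \<Rightarrow> real^'n" and f g :: "real^'n \<Rightarrow> real"
  assumes S: "S \<in> sets lebesgue" and der: "\<And>x. x \<in> S \<Longrightarrow> (T has_derivative T' x) (at x within S)"
    and inj: "inj_on T S"
    and jac: "\<And>x. x \<in> S \<Longrightarrow> \<bar>det (matrix (T' x))\<bar> * f (T x) = g x"
    and int: "g absolutely_integrable_on S" and f: "\<And>y. f y > 0" and g: "\<And>y. g y > 0"
    and meas: "f \<in> borel_measurable lebesgue" "g \<in> borel_measurable lebesgue"
  shows "T ` S \<in> sets lebesgue"
    and "emeasure (density lebesgue (\<lambda>y. ennreal (f y))) (T ` S) = emeasure (density lebesgue (\<lambda>x. ennreal (g x))) S"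
proof -
  define p where "p = (relabel of_wo :: real^'n \<Rightarrow> real^('n wo))"
  define q where "q = (relabel (inv of_wo) :: real^('n wo) \<Rightarrow> real^'n)"
  have b: "bij (of_wo :: 'n wo \<Rightarrow> 'n)" "bij (inv (of_wo :: 'n wo \<Rightarrow> 'n))"
    using bij_of_wo bij_imp_bij_inv by auto
  have pq [simp]: "p (q y) = y" "q (p x) = x" for x y
    using b by (simp_all add: p_def q_def vec_eq_iff bij_is_surj surj_f_inv_f bij_is_inj)
  have vim: "q -` A = p ` A" "p -` C = q ` C" for A C by (force simp: image_iff)+
  have mp: "p \<in> lebesgue \<rightarrow>\<^sub>M lebesgue" and mq: "q \<in> lebesgue \<rightarrow>\<^sub>M lebesgue"
    and dq: "distr lebesgue lebesgue q = lebesgue"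
    using measurable_relabel[OF b(1)] measurable_relabel[OF b(2)] distr_relabel[OF b(2)] by (simp_all add: p_def q_def)
  have blp: "bounded_linear p" and blq: "bounded_linear q"
    by (simp_all add: p_def q_def bounded_linear_relabel)
  have Sq: "q -` S \<in> sets lebesgue" using measurable_sets[OF mq S] by simp
  define T2 where "T2 = (\<lambda>y. p (T (q y)))"
  define T2' where "T2' = (\<lambda>y v. p (T' (q y) (q v)))"
  have im: "T2 ` (q -` S) = q -` (T ` S)" by (force simp: T2_def vim)
  have dens: "emeasure (density lebesgue (\<lambda>y. ennreal (k y))) A = emeasure (density lebesgue (\<lambda>y. ennreal (k (q y)))) (q -` A)"
    if k: "k \<in> borel_measurable lebesgue" and A: "A \<in> sets lebesgue" for k A
  proof -
    have kq: "(\<lambda>y. k (q y)) \<in> borel_measurable lebesgue" using measurable_compose[OF mq k] .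
    have "emeasure (density lebesgue (\<lambda>y. ennreal (k y))) A = (\<integral>\<^sup>+y. ennreal (k y) * indicator A y \<partial>distr lebesgue lebesgue q)"
      using k A by (simp add: dq emeasure_density)
    also have "\<dots> = (\<integral>\<^sup>+y. ennreal (k (q y)) * indicator A (q y) \<partial>lebesgue)"
      using k A by (intro nn_integral_distr mq) auto
    also have "\<dots> = emeasure (density lebesgue (\<lambda>y. ennreal (k (q y)))) (q -` A)"
      using kq measurable_sets[OF mq A] by (subst emeasure_density) (auto intro!: nn_integral_cong simp: indicator_def)
    finally show ?thesis .
  qed
  have der2: "(T2 has_derivative T2' y) (at y within q -` S)" if y: "y \<in> q -` S" for y
  proof -
    have p: "(p has_derivative p) (at (T (q y)))" and q: "(q has_derivative q) (at y within q -` S)"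
      using blp blq by (auto intro: bounded_linear_imp_has_derivative)
    have "(T has_derivative T' (q y)) (at (q y) within q ` (q -` S))"
      using der[of "q y"] y by (auto intro: has_derivative_subset)
    then have "((\<lambda>y. T (q y)) has_derivative (\<lambda>v. T' (q y) (q v))) (at y within q -` S)"
      by (rule has_derivative_in_compose[OF q])
    then show ?thesis
      unfolding T2_def T2'_def by (rule has_derivative_compose[where f="\<lambda>y. T (q y)" and g=p, OF _ p])
  qed
  have jac2: "\<bar>det (matrix (T2' y))\<bar> * f (q (T2 y)) = g (q y)" if y: "y \<in> q -` S" for y
  proof -
    have "det (matrix (T2' y)) = det (matrix (T' (q y)))"
      unfolding T2'_def p_def q_def by (simp add: matrix_relabel[OF b(1)] det_relabel[OF b(1)])
    then show ?thesis using jac[of "q y"] y by (simp add: T2_def)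
  qed
  have inj2: "inj_on T2 (q -` S)"
    using inj by (auto simp: inj_on_def T2_def) (metis pq)
  have int2: "(\<lambda>y. g (q y)) absolutely_integrable_on q -` S"
  proof -
    have "integrable lebesgue (\<lambda>y. indicator S (q y) *\<^sub>R g (q y))"
      using int S meas(2) unfolding set_integrable_def
      by (subst integrable_distr_eq[OF mq, symmetric]) (auto simp: dq)
    then show ?thesis by (simp add: set_integrable_def indicator_def)
  qed
  note wo = emeasure_density_image_wellorder[OF Sq der2 inj2 jac2 int2 f g
      measurable_compose[OF mq meas(1)] measurable_compose[OF mq meas(2)]]
  show TS: "T ` S \<in> sets lebesgue"
    using measurable_sets[OF mp wo(1)] unfolding im vim by (simp add: image_image T2_def)
  show "emeasure (density lebesgue (\<lambda>y. ennreal (f y))) (T ` S) = emeasure (density lebesgue (\<lambda>x. ennreal (g x))) S"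
    using wo(2) by (simp add: dens[OF meas(1) TS] dens[OF meas(2) S] im)
qed

section \<open>Families of class C1 and second derivatives\<close>

lemma C1_family_compose:
  assumes f: "C1_family f f'" and g: "\<And>y. (g has_derivative blinfun_apply (Dg y)) (at y)" and Dg: "continuous_on UNIV Dg"
  shows "C1_family (\<lambda>t x. g (f t x)) (\<lambda>t x. Dg (f t x) o\<^sub>L f' t x)"
proof -
  have c: "continuous_on UNIV (\<lambda>p. f (fst p) (snd p))" and c': "continuous_on UNIV (\<lambda>p. f' (fst p) (snd p))"
    and d: "\<And>t x. (f t has_derivative f' t x) (at x)"
    using f by (auto simp: C1_family_def case_prod_beta)
  have g_cont: "continuous_on UNIV g"
    by (auto intro!: continuous_at_imp_continuous_on has_derivative_continuous[OF g])
  have "continuous_on UNIV (\<lambda>p. g (f (fst p) (snd p)))"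
    by (rule continuous_on_compose2[OF g_cont c]) auto
  moreover have "continuous_on UNIV (\<lambda>p. Dg (f (fst p) (snd p)) o\<^sub>L f' (fst p) (snd p))"
    by (intro bounded_bilinear.continuous_on[OF bounded_bilinear_blinfun_compose] c'
        continuous_on_compose2[OF Dg c]) auto
  moreover have "((\<lambda>x. g (f t x)) has_derivative (Dg (f t x) o\<^sub>L f' t x)) (at x)" for t x
    using has_derivative_compose[OF d[of t x] g] by (simp add: blinfun_compose.rep_eq o_def)
  ultimately show ?thesis by (simp add: C1_family_def case_prod_beta)
qed

lemma C1_family_mult:
  fixes f g :: "real \<Rightarrow> 'a::real_normed_vector \<Rightarrow> real"
  assumes "C1_family f f'" "C1_family g g'"
  shows "C1_family (\<lambda>t x. f t x * g t x) (\<lambda>t x. f t x *\<^sub>R g' t x + g t x *\<^sub>R f' t x)"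
proof -
  have c: "continuous_on UNIV (\<lambda>p. f (fst p) (snd p))" "continuous_on UNIV (\<lambda>p. f' (fst p) (snd p))"
    "continuous_on UNIV (\<lambda>p. g (fst p) (snd p))" "continuous_on UNIV (\<lambda>p. g' (fst p) (snd p))"
    and d: "\<And>t x. (f t has_derivative f' t x) (at x)" "\<And>t x. (g t has_derivative g' t x) (at x)"
    using assms by (auto simp: C1_family_def case_prod_beta)
  have "((\<lambda>x. f t x * g t x) has_derivative (f t x *\<^sub>R g' t x + g t x *\<^sub>R f' t x)) (at x)" for t x
    using has_derivative_mult[OF d(1)[of t x] d(2)[of t x]]
    by (simp add: plus_blinfun.rep_eq scaleR_blinfun.rep_eq mult.commute)
  then show ?thesis
    by (auto simp: C1_family_def case_prod_beta intro!: continuous_intros c)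
qed

lemma C1_family_exp:
  fixes f :: "real \<Rightarrow> 'a::real_normed_vector \<Rightarrow> real"
  assumes "C1_family f f'"
  shows "C1_family (\<lambda>t x. exp (f t x)) (\<lambda>t x. (exp (f t x) *\<^sub>R id_blinfun) o\<^sub>L f' t x)"
proof (rule C1_family_compose[OF assms])
  show "(exp has_derivative blinfun_apply (exp y *\<^sub>R id_blinfun)) (at y)" for y :: real
    using DERIV_exp[of y] by (simp add: has_field_derivative_def scaleR_blinfun.rep_eq)
qed (intro continuous_intros)

lemma primitive_blinfun_apply:
  fixes g :: "real \<Rightarrow> 'a::real_normed_vector \<Rightarrow>\<^sub>L 'b::banach"
  assumes "continuous_on UNIV g"
  shows "primitive g t v = primitive (\<lambda>s. g s v) t"
proof -
  have "(\<lambda>s. g (t * s)) integrable_on {0..1}"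
    by (intro integrable_continuous_real continuous_on_compose2[OF assms]) (auto intro!: continuous_intros)
  then show ?thesis
    by (simp add: primitive_def blinfun.scaleR_left blinfun_apply_integral)
qed

text \<open>
  The increment \<open>f (x + t u) - f x\<close> is the integral of the derivative in direction \<open>u\<close>. Differentiating
  in direction \<open>v\<close> under the integral sign, and then in \<open>t\<close> at \<open>0\<close>, interchanges the two derivatives.
\<close>

lemma second_derivative_symmetric:
  fixes f :: "'a::euclidean_space \<Rightarrow> real" and Df :: "'a \<Rightarrow> 'a \<Rightarrow>\<^sub>L real" and D2 :: "'a \<Rightarrow> 'a \<Rightarrow> 'a \<Rightarrow>\<^sub>L real"
  assumes f: "\<And>x. (f has_derivative Df x) (at x)"
    and Df: "\<And>v x. ((\<lambda>x. Df x v) has_derivative D2 v x) (at x)"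
    and D2: "\<And>v. continuous_on UNIV (D2 v)"
  shows "D2 v y u = D2 u y v"
proof -
  have Df_cont: "continuous_on UNIV (\<lambda>x. Df x v)" for v
    by (auto intro!: continuous_at_imp_continuous_on has_derivative_continuous[OF Df])
  have shift: "((\<lambda>s. x + s *\<^sub>R u) has_vector_derivative u) (at s)" "((\<lambda>x. x + s *\<^sub>R u) has_derivative (\<lambda>h. h)) (at x)" for x and s :: real
    by (auto intro!: derivative_eq_intros)
  have C1: "C1_family (\<lambda>s x. Df (x + s *\<^sub>R u) u) (\<lambda>s x. D2 u (x + s *\<^sub>R u))"
    unfolding C1_family_def case_prod_beta
  proof (intro conjI allI)
    show "continuous_on UNIV (\<lambda>p. Df (snd p + fst p *\<^sub>R u) u)"
      by (rule continuous_on_compose2[OF Df_cont]) (auto intro!: continuous_intros)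
    show "continuous_on UNIV (\<lambda>p. D2 u (snd p + fst p *\<^sub>R u))"
      by (rule continuous_on_compose2[OF D2]) (auto intro!: continuous_intros)
    show "((\<lambda>x. Df (x + s *\<^sub>R u) u) has_derivative D2 u (x + s *\<^sub>R u)) (at x)" for s x
      using has_derivative_compose[OF shift(2) Df] .
  qed
  have prim: "primitive (\<lambda>s. Df (x + s *\<^sub>R u) u) t = f (x + t *\<^sub>R u) - f x" for t x
  proof -
    have "((\<lambda>s. f (x + s *\<^sub>R u)) has_vector_derivative Df (x + s *\<^sub>R u) u) (at s)" for s
      using vector_derivative_diff_chain_within[OF shift(1) has_derivative_at_withinI[OF f]] by (simp add: o_def)
    from primitive_eq[OF this] show ?thesis by simp
  qed
  have eq: "Df (y + t *\<^sub>R u) v - Df y v = primitive (\<lambda>s. D2 u (y + s *\<^sub>R u) v) t" for t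
  proof -
    have "((\<lambda>x. f (x + t *\<^sub>R u) - f x) has_derivative primitive (\<lambda>s. D2 u (y + s *\<^sub>R u)) t) (at y)"
      using C1_family_primitive[OF C1] by (simp add: C1_family_def prim)
    moreover have "((\<lambda>x. f (x + t *\<^sub>R u) - f x) has_derivative (\<lambda>v. Df (y + t *\<^sub>R u) v - Df y v)) (at y)"
      using has_derivative_diff[OF has_derivative_compose[OF shift(2) f] f] .
    ultimately have "blinfun_apply (primitive (\<lambda>s. D2 u (y + s *\<^sub>R u)) t) = (\<lambda>v. Df (y + t *\<^sub>R u) v - Df y v)"
      by (rule has_derivative_unique)
    moreover have "continuous_on UNIV (\<lambda>s. D2 u (y + s *\<^sub>R u))"
      by (rule continuous_on_compose2[OF D2]) (auto intro!: continuous_intros)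
    ultimately show ?thesis by (simp add: fun_eq_iff flip: primitive_blinfun_apply)
  qed
  have c: "continuous_on UNIV (\<lambda>s. D2 u (y + s *\<^sub>R u) v)"
    by (intro blinfun.continuous_on continuous_on_compose2[OF D2]) (auto intro!: continuous_intros)
  have "((\<lambda>t. Df (y + t *\<^sub>R u) v - Df y v) has_vector_derivative D2 u (y + 0 *\<^sub>R u) v) (at 0)"
    unfolding eq by (rule primitive_has_derivative[OF c])
  moreover have "((\<lambda>t. Df (y + t *\<^sub>R u) v - Df y v) has_vector_derivative D2 v (y + 0 *\<^sub>R u) u - 0) (at 0)"
  proof (rule has_vector_derivative_diff[OF _ has_vector_derivative_const])
    show "((\<lambda>t. Df (y + t *\<^sub>R u) v) has_vector_derivative D2 v (y + 0 *\<^sub>R u) u) (at 0)"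
      using vector_derivative_diff_chain_within[OF shift(1)[of y 0] has_derivative_at_withinI[OF Df]] by (simp add: o_def)
  qed
  ultimately show ?thesis using vector_derivative_unique_at by fastforce
qed

section \<open>Periodic functions\<close>

lemma lattice_translate_to_cube:
  fixes x :: "real^'n"
  obtains k where "k \<in> int_lattice" "x - k \<in> cbox 0 1"
proof (rule that)
  show "(\<chi> i. of_int \<lfloor>x $ i\<rfloor>) \<in> int_lattice" by (simp add: int_lattice_def)
  have "real_of_int \<lfloor>x $ i\<rfloor> \<le> x $ i \<and> x $ i \<le> 1 + real_of_int \<lfloor>x $ i\<rfloor>" for i by linarith
  then show "x - (\<chi> i. of_int \<lfloor>x $ i\<rfloor>) \<in> cbox 0 1"
    by (auto simp: mem_box_cart diff_le_eq)
qed

lemma int_lattice_uminus: "k \<in> int_lattice \<Longrightarrow> - k \<in> int_lattice"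
  and int_lattice_diff: "k \<in> int_lattice \<Longrightarrow> l \<in> int_lattice \<Longrightarrow> k - l \<in> int_lattice"
  by (auto simp: int_lattice_def)

lemma periodic_diff: "periodic f \<Longrightarrow> k \<in> int_lattice \<Longrightarrow> f (x - k) = f x"
  using int_lattice_uminus[of k] unfolding periodic_def by (metis add_uminus_conv_diff)

lemma periodic_bounded:
  fixes f :: "real^'n \<Rightarrow> 'b::real_normed_vector"
  assumes "periodic f" "continuous_on UNIV f"
  shows "\<exists>B. \<forall>x. norm (f x) \<le> B"
proof -
  have "bounded (f ` cbox 0 1)"
    by (intro compact_imp_bounded compact_continuous_image[OF continuous_on_subset[OF assms(2)]]) auto
  then obtain B where B: "\<forall>y\<in>f ` cbox 0 1. norm y \<le> B"
    unfolding bounded_iff ..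
  have "norm (f x) \<le> B" for x
  proof -
    obtain k where "k \<in> int_lattice" "x - k \<in> cbox 0 1" by (rule lattice_translate_to_cube)
    then show ?thesis using B periodic_diff[OF assms(1), of k x] by force
  qed
  then show ?thesis by blast
qed

text \<open>
  After translating one point into the unit cube, a second point at distance at most \<open>1\<close> lies in
  the cube \<open>[-1,2]\<^sup>n\<close>, which is compact.
\<close>

lemma periodic_uniformly_continuous:
  fixes f :: "real^'n \<Rightarrow> 'b::real_normed_vector"
  assumes per: "periodic f" and cont: "continuous_on UNIV f"
  shows "uniformly_continuous_on UNIV f"
proof -
  have uc: "uniformly_continuous_on (cbox (- 1) 2) f"
    by (rule compact_uniformly_continuous[OF continuous_on_subset[OF cont]]) auto
  show ?thesis
    unfolding uniformly_continuous_on_def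
  proof (intro allI impI)
    fix e :: real assume "e > 0"
    then obtain d where d: "d > 0" "\<forall>x\<in>cbox (- 1) 2. \<forall>y\<in>cbox (- 1) 2. dist y x < d \<longrightarrow> dist (f y) (f x) < e"
      using uc unfolding uniformly_continuous_on_def by blast
    have "dist (f y) (f x) < e" if xy: "dist y x < min d 1" for x y
    proof -
      obtain k where k: "k \<in> int_lattice" "x - k \<in> cbox 0 1" by (rule lattice_translate_to_cube)
      have "\<bar>y $ i - x $ i\<bar> \<le> 1" for i
        using component_le_norm_cart[of "y - x" i] xy by (simp add: dist_norm)
      then have b: "y $ i - x $ i \<le> 1" "x $ i - y $ i \<le> 1" for i by (simp_all add: abs_le_iff)
      have x: "x - k \<in> cbox (- 1) 2"
        using k(2) unfolding mem_box_cart by (auto intro: order_trans[of "- 1" "0::real"] order_trans[of _ "1::real" 2])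
      moreover have "y - k \<in> cbox (- 1) 2"
        unfolding mem_box_cart
      proof
        fix i show "(- 1) $ i \<le> (y - k) $ i \<and> (y - k) $ i \<le> 2 $ i"
          using k(2)[unfolded mem_box_cart, rule_format, of i] b[of i] by simp
      qed
      moreover have "dist (y - k) (x - k) < d" using xy by (simp add: dist_norm)
      ultimately have "dist (f (y - k)) (f (x - k)) < e" using d(2) by blast
      then show ?thesis by (simp add: periodic_diff[OF per k(1)])
    qed
    then show "\<exists>d>0. \<forall>x\<in>UNIV. \<forall>y\<in>UNIV. dist y x < d \<longrightarrow> dist (f y) (f x) < e"
      using d(1) by (intro exI[of _ "min d 1"]) auto
  qed
qed

lemma periodic_derivative:
  fixes f :: "real^'n \<Rightarrow> 'b::real_normed_vector"
  assumes per: "periodic f" and f: "\<And>x. (f has_derivative Df x) (at x)"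
  shows "periodic Df"
  unfolding periodic_def
proof (intro allI ballI)
  fix x k :: "real^'n" assume k: "k \<in> int_lattice"
  have "((\<lambda>x. f (x + k)) has_derivative Df (x + k)) (at x)"
    by (rule has_derivative_compose[OF _ f, where f'="\<lambda>h. h"]) (auto intro!: derivative_eq_intros)
  moreover have "(\<lambda>x. f (x + k)) = f" using per k by (auto simp: periodic_def)
  ultimately show "Df (x + k) = Df x" using has_derivative_unique f by metis
qed

section \<open>Functions of class C1\<close>

definition blinfun_deriv :: "('a::euclidean_space \<Rightarrow> 'b::real_normed_vector) \<Rightarrow> 'a \<Rightarrow> 'a \<Rightarrow>\<^sub>L 'b" where
  "blinfun_deriv f x = Blinfun (frechet_derivative f (at x))"

lemma
  assumes "C_k_on (Suc k) f UNIV"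
  shows C_k_has_derivative: "(f has_derivative blinfun_deriv f x) (at x)"
    and C_k_blinfun_deriv_apply: "blinfun_deriv f x v = frechet_derivative f (at x) v"
    and C_k_directional: "C_k_on k (\<lambda>x. blinfun_deriv f x v) UNIV"
proof -
  have d: "(f has_derivative frechet_derivative f (at x)) (at x)" for x
    using assms by (simp add: frechet_derivative_works[symmetric])
  then have bl: "blinfun_deriv f x v = frechet_derivative f (at x) v" for x v
    unfolding blinfun_deriv_def by (simp add: bounded_linear_Blinfun_apply[OF has_derivative_bounded_linear[OF d]])
  then have "blinfun_apply (blinfun_deriv f x) = frechet_derivative f (at x)" by auto
  then show "(f has_derivative blinfun_deriv f x) (at x)" using d by simp
  show "blinfun_deriv f x v = frechet_derivative f (at x) v" by (rule bl)
  show "C_k_on k (\<lambda>x. blinfun_deriv f x v) UNIV" using assms by (simp add: bl)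
qed

lemma C_k_continuous: "C_k_on k f UNIV \<Longrightarrow> continuous_on UNIV f"
proof (cases k)
  case (Suc j)
  then show "C_k_on k f UNIV \<Longrightarrow> continuous_on UNIV f"
    by (auto intro!: continuous_at_imp_continuous_on differentiable_imp_continuous_within)
qed simp

lemma C_k_blinfun_deriv_continuous:
  assumes "C_k_on (Suc k) f UNIV"
  shows "continuous_on UNIV (blinfun_deriv f)"
  using C_k_directional[OF assms] by (intro continuous_on_blinfun_componentwise) (rule C_k_continuous)

section \<open>The Jacobian of the flow and Liouville's formula\<close>

locale vec_flow = C1_flow b Db K X
  for b :: "real^'n \<Rightarrow> real^'n" and Db K X
begin

definition jac :: "real \<Rightarrow> real^'n \<Rightarrow> real" where
  "jac t x = det (matrix (DX t x))"

definition divergence :: "real^'n \<Rightarrow> real" where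
  "divergence x = trace (matrix (Db x))"

lemma jac_0 [simp]: "jac 0 x = 1"
proof -
  have "matrix (blinfun_apply (DX 0 x)) = mat 1"
    by (simp add: matrix_def mat_def axis_def vec_eq_iff)
  then show ?thesis by (simp add: jac_def)
qed

lemma jac_add: "jac (s + t) x = jac s (X t x) * jac t x"
proof -
  have "blinfun_apply (DX (s + t) x) = DX s (X t x) \<circ> DX t x" by (auto simp: DX_add)
  moreover have "linear (blinfun_apply A)" for A :: "(real^'n) \<Rightarrow>\<^sub>L (real^'n)"
    by (simp add: blinfun.bounded_linear_right bounded_linear.linear)
  ultimately show ?thesis by (simp add: jac_def matrix_compose det_mul)
qed

text \<open>
  By the cocycle identity it suffices to differentiate at time \<open>0\<close>, where the derivative of the flow
  is the identity matrix.
\<close>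

lemma jac_deriv: "((\<lambda>t. jac t x) has_real_derivative divergence (X t x) * jac t x) (at t)"
proof -
  have "((\<lambda>h. jac h (X t x)) has_real_derivative divergence (X t x)) (at 0)"
    unfolding jac_def divergence_def
  proof (rule det_has_derivative_at_identity)
    show "matrix (blinfun_apply (DX 0 (X t x))) = mat 1"
      by (simp add: matrix_def mat_def axis_def vec_eq_iff)
    fix i j
    have "((\<lambda>h. DX h (X t x) (axis j 1) $ i) has_vector_derivative Db (X 0 (X t x)) (DX 0 (X t x) (axis j 1)) $ i) (at 0)"
      by (rule bounded_linear.has_vector_derivative[OF bounded_linear_vec_nth DX_deriv])
    then show "((\<lambda>h. matrix (DX h (X t x)) $ i $ j) has_real_derivative matrix (Db (X t x)) $ i $ j) (at 0)"
      by (simp add: matrix_def has_real_derivative_iff_has_vector_derivative)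
  qed
  then have "((\<lambda>s. jac (s - t) (X t x)) has_real_derivative divergence (X t x) * (1 - 0)) (at t)"
    by (intro DERIV_chain2[where f="\<lambda>h. jac h (X t x)"] DERIV_diff DERIV_ident DERIV_const) simp
  then have "((\<lambda>s. jac (s - t) (X t x) * jac t x) has_real_derivative divergence (X t x) * (1 - 0) * jac t x) (at t)"
    by (rule DERIV_cmult_right)
  then show ?thesis by (simp add: jac_add[symmetric])
qed

lemma divergence_cont: "continuous_on UNIV divergence"
  unfolding divergence_def[abs_def] trace_def matrix_def
  by (simp, intro continuous_intros continuous_on_sum blinfun.continuous_on Db_cont)

text \<open>
  This form shows that \<open>jac\<close> is positive and of class C1 in the space variable, which the
  determinant of \<open>DX\<close> does not show directly.
\<close>

lemma jac_eq_exp: "jac t x = exp (primitive (\<lambda>s. divergence (X s x)) t)"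
proof -
  have c: "continuous_on UNIV (\<lambda>s. divergence (X s x))"
    by (rule continuous_on_compose2[OF divergence_cont X_cont_time]) auto
  define k where "k t = jac t x * exp (- primitive (\<lambda>s. divergence (X s x)) t)" for t
  have "(primitive (\<lambda>s. divergence (X s x)) has_real_derivative divergence (X t x)) (at t)" for t
    using primitive_has_derivative[OF c] by (simp add: has_real_derivative_iff_has_vector_derivative)
  then have "(k has_real_derivative 0) (at t)" for t
    unfolding k_def by (auto intro!: derivative_eq_intros jac_deriv simp: algebra_simps)
  then have "k t = k 0" by (intro DERIV_isconst_all) auto
  then show ?thesis by (simp add: k_def exp_minus field_simps)
qed

lemma jac_pos: "jac t x > 0"
  by (simp add: jac_eq_exp)

lemma flow_jacobian_eq: "flow_jacobian X t x = jac t x"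
proof -
  have "frechet_derivative (X t) (at x) = blinfun_apply (DX t x)"
    using frechet_derivative_at[OF X_has_derivative] by simp
  then show ?thesis using jac_pos[of t x] by (simp add: flow_jacobian_def jac_def)
qed

end

section \<open>The gradient field of a potential on the torus\<close>

locale torus_potential =
  fixes V :: "real^'n \<Rightarrow> real"
  assumes smooth: "torus_smooth V"
begin

lemma C_k: "C_k_on k V UNIV" and per: "periodic V"
  using smooth by (auto simp: torus_smooth_def)

definition dirder :: "real^'n \<Rightarrow> real^'n \<Rightarrow> real" where
  "dirder v x = blinfun_deriv V x v"

lemma dirder_C1: "C_k_on (Suc 0) (dirder v) UNIV"
  using C_k_directional[OF C_k[of "Suc (Suc 0)"]] by (simp add: dirder_def[abs_def])

lemma partial_eq: "partial_deriv i V = dirder (axis i 1)"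
  by (simp add: fun_eq_iff partial_deriv_def dirder_def C_k_blinfun_deriv_apply[OF C_k])

lemma partial2_eq: "partial_deriv i (partial_deriv j V) x = blinfun_deriv (dirder (axis j 1)) x (axis i 1)"
  by (simp add: partial_eq) (simp add: partial_deriv_def C_k_blinfun_deriv_apply[OF dirder_C1])

lemma grad_inner: "grad V x \<bullet> v = blinfun_deriv V x v"
proof -
  have "blinfun_deriv V x v = blinfun_deriv V x (\<Sum>i\<in>UNIV. v $ i *\<^sub>R axis i 1)"
    by (simp add: scalar_mult_eq_scaleR[symmetric] basis_expansion)
  also have "\<dots> = (\<Sum>i\<in>UNIV. v $ i * grad V x $ i)"
    by (simp add: blinfun.sum_right blinfun.scaleR_right grad_def partial_eq dirder_def)
  finally show ?thesis by (simp add: inner_vec_def mult.commute)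
qed

lemma V_deriv: "(V has_derivative (\<lambda>v. grad V x \<bullet> v)) (at x)"
  using C_k_has_derivative[OF C_k[of "Suc 0"]] by (simp add: grad_inner)

definition D2 :: "real^'n \<Rightarrow> (real^'n) \<Rightarrow>\<^sub>L (real^'n)" where
  "D2 x = Blinfun (\<lambda>v. \<chi> i. blinfun_deriv (dirder (axis i 1)) x v)"

lemma D2_apply: "D2 x v = (\<chi> i. blinfun_deriv (dirder (axis i 1)) x v)"
proof -
  have "bounded_linear (\<lambda>v. \<chi> i. blinfun_deriv (dirder (axis i 1)) x v)"
    unfolding linear_conv_bounded_linear[symmetric]
    by (auto simp: linear_iff vec_eq_iff blinfun.add_right blinfun.scaleR_right)
  then show ?thesis by (simp add: D2_def bounded_linear_Blinfun_apply)
qed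

lemma grad_deriv: "(grad V has_derivative D2 x) (at x)"
proof -
  have "((\<lambda>x. \<chi> i. dirder (axis i 1) x) has_derivative (\<lambda>v. \<chi> i. blinfun_deriv (dirder (axis i 1)) x v)) (at x)"
    by (subst has_derivative_componentwise_within)
      (auto simp: Basis_vec_def inner_axis intro!: C_k_has_derivative[OF dirder_C1])
  then show ?thesis by (simp add: grad_def[abs_def] partial_eq D2_apply[abs_def])
qed

lemma D2_cont: "continuous_on UNIV D2"
  by (intro continuous_on_blinfun_componentwise, unfold D2_apply)
    (intro continuous_on_vec_lambda blinfun.continuous_on C_k_blinfun_deriv_continuous[OF dirder_C1] continuous_on_const)

lemma D2_inner: "D2 x u \<bullet> v = blinfun_deriv (dirder v) x u"
proof -
  have "((\<lambda>x. grad V x \<bullet> v) has_derivative (\<lambda>u. D2 x u \<bullet> v)) (at x)"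
    using grad_deriv by (rule has_derivative_inner_left)
  then have "(dirder v has_derivative (\<lambda>u. D2 x u \<bullet> v)) (at x)"
    by (simp add: grad_inner dirder_def[abs_def])
  from has_derivative_unique[OF this C_k_has_derivative[OF dirder_C1]] show ?thesis by metis
qed

lemma D2_sym: "D2 x u \<bullet> v = u \<bullet> D2 x v"
proof -
  have "blinfun_deriv (dirder v) x u = blinfun_deriv (dirder u) x v"
  proof (rule second_derivative_symmetric[where f=V and Df="blinfun_deriv V"])
    show "((\<lambda>x. blinfun_deriv V x v) has_derivative blinfun_deriv (dirder v) x) (at x)" for v x
      using C_k_has_derivative[OF dirder_C1[of v]] by (simp add: dirder_def[abs_def])
  qed (use C_k_has_derivative[OF C_k] C_k_blinfun_deriv_continuous[OF dirder_C1] in auto)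
  then show ?thesis by (simp add: D2_inner inner_commute[of u])
qed

lemma periodic_grad: "periodic (grad V)"
proof -
  have "periodic (\<lambda>x. blinfun_apply (blinfun_deriv V x))"
    by (rule periodic_derivative[OF per C_k_has_derivative[OF C_k]])
  then show ?thesis
    by (simp add: periodic_def grad_def partial_eq dirder_def)
qed

lemma periodic_D2: "periodic D2"
proof -
  have "periodic (\<lambda>x. blinfun_apply (D2 x))"
    by (rule periodic_derivative[OF periodic_grad grad_deriv])
  then show ?thesis by (simp add: periodic_def blinfun_apply_inject)
qed

lemma laplacian_eq: "laplacian V x = trace (matrix (D2 x))"
  by (simp add: laplacian_def trace_def matrix_def D2_apply partial2_eq)

text \<open>
  The transpose appears because the Hessian is indexed with the outer derivative first.
\<close>

lemma D2_eq_hessian: "D2 x v = transpose (hessian V x) *v v"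
proof -
  have "D2 x v $ j = (\<Sum>i\<in>UNIV. hessian V x $ i $ j * v $ i)" for j
  proof -
    have "D2 x v = D2 x (\<Sum>i\<in>UNIV. v $ i *\<^sub>R axis i 1)"
      by (simp add: scalar_mult_eq_scaleR[symmetric] basis_expansion)
    also have "\<dots> $ j = (\<Sum>i\<in>UNIV. hessian V x $ i $ j * v $ i)"
      by (simp add: blinfun.sum_right blinfun.scaleR_right hessian_def partial2_eq D2_apply mult.commute)
    finally show ?thesis .
  qed
  then show ?thesis by (simp add: vec_eq_iff matrix_vector_mult_def transpose_def)
qed

lemma D2_injective:
  assumes "det (hessian V x) \<noteq> 0" "D2 x v = 0"
  shows "v = 0"
proof -
  have "invertible (transpose (hessian V x))" using assms(1) by (simp add: invertible_det_nz det_transpose)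
  then have "\<exists>B. B ** transpose (hessian V x) = mat 1" by (auto simp: invertible_def)
  then show ?thesis
    using assms(2) by (auto simp: D2_eq_hessian matrix_left_invertible_ker)
qed

lemma V_bounded: "\<exists>B. \<forall>x. \<bar>V x\<bar> \<le> B"
  using periodic_bounded[OF per C_k_continuous[OF C_k]] by simp

lemma D2_bounded: "\<exists>B. \<forall>x. norm (D2 x) \<le> B"
  by (rule periodic_bounded[OF periodic_D2 D2_cont])

lemma D2_ucont: "uniformly_continuous_on UNIV D2"
  by (rule periodic_uniformly_continuous[OF periodic_D2 D2_cont])

end

section \<open>The dynamics of the gradient flow of a Morse function\<close>

locale gradient_flow = torus_potential V + vec_flow "grad V" D2 K X
  for V :: "real^'n \<Rightarrow> real" and K X +
  assumes nondegenerate: "\<And>x. grad V x = 0 \<Longrightarrow> det (hessian V x) \<noteq> 0"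
begin

definition crit :: "(real^'n) set" where
  "crit = {p. grad V p = 0}"

lemma grad_translate: "k \<in> int_lattice \<Longrightarrow> grad V (x + k) = grad V x"
  and D2_translate: "k \<in> int_lattice \<Longrightarrow> D2 (x + k) = D2 x"
  using periodic_grad periodic_D2 by (auto simp: periodic_def)

lemma crit_translate: "k \<in> int_lattice \<Longrightarrow> p + k \<in> crit \<longleftrightarrow> p \<in> crit"
  by (simp add: crit_def grad_translate)

lemma closed_crit: "closed crit"
  using continuous_closed_vimage[of "{0}" "grad V"] b_cont
  by (simp add: crit_def vimage_def continuous_on_eq_continuous_at)

lemma near_crit:
  assumes "e > 0"
  shows "\<exists>c>0. \<forall>y. norm (grad V y) < c \<longrightarrow> (\<exists>p\<in>crit. dist y p < e)"
proof -
  define C where "C = cbox 0 1 - (\<Union>p\<in>crit. ball p e)"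
  have C: "compact C" unfolding C_def by (intro compact_diff open_UN) auto
  have "\<exists>c>0. \<forall>y\<in>C. c \<le> norm (grad V y)"
  proof (cases "C = {}")
    case False
    obtain y0 where y0: "y0 \<in> C" "\<forall>y\<in>C. norm (grad V y0) \<le> norm (grad V y)"
      using continuous_attains_inf[OF C False] continuous_on_norm[OF continuous_on_subset[OF b_cont]] by blast
    have "y0 \<notin> crit" using y0(1) assms by (auto simp: C_def)
    then show ?thesis using y0 by (intro exI[of _ "norm (grad V y0)"]) (auto simp: crit_def)
  qed (auto intro: exI[of _ 1])
  then obtain c where c: "c > 0" "\<forall>y\<in>C. c \<le> norm (grad V y)" by blast
  have "\<exists>p\<in>crit. dist y p < e" if y: "norm (grad V y) < c" for y
  proof -
    obtain k where k: "k \<in> int_lattice" "y - k \<in> cbox 0 1" by (rule lattice_translate_to_cube)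
    have "grad V (y - k) = grad V y" using grad_translate[OF k(1), of "y - k"] by simp
    then have "y - k \<notin> C" using c(2) y by force
    then obtain p where p: "p \<in> crit" "dist p (y - k) < e" using k(2) by (auto simp: C_def)
    then show ?thesis
      using crit_translate[OF k(1), of p] by (intro bexI[of _ "p + k"]) (auto simp: dist_norm norm_minus_commute algebra_simps)
  qed
  then show ?thesis using c(1) by blast
qed

lemma D2_expands_at_crit: "\<exists>m>0. \<forall>p\<in>crit. \<forall>z. m * norm z \<le> norm (D2 p z)"
proof -
  define C where "C = (crit \<inter> cbox 0 1) \<times> sphere (0::real^'n) 1"
  have C: "compact C" unfolding C_def by (intro compact_Times closed_Int_compact closed_crit) auto
  have cont: "continuous_on C (\<lambda>q. norm (D2 (fst q) (snd q)))"
    by (intro continuous_intros continuous_on_compose2[OF D2_cont]) auto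
  have "\<exists>m>0. \<forall>q\<in>C. m \<le> norm (D2 (fst q) (snd q))"
  proof (cases "C = {}")
    case False
    obtain q0 where q0: "q0 \<in> C" "\<forall>q\<in>C. norm (D2 (fst q0) (snd q0)) \<le> norm (D2 (fst q) (snd q))"
      using continuous_attains_inf[OF C False cont] by blast
    have "D2 (fst q0) (snd q0) \<noteq> 0"
      using q0(1) D2_injective[OF nondegenerate, of "fst q0" "snd q0"] by (auto simp: C_def crit_def)
    then show ?thesis using q0 by (intro exI[of _ "norm (D2 (fst q0) (snd q0))"]) auto
  qed (auto intro: exI[of _ 1])
  then obtain m where m: "m > 0" "\<forall>q\<in>C. m \<le> norm (D2 (fst q) (snd q))" by blast
  have "m * norm z \<le> norm (D2 p z)" if p: "p \<in> crit" for p z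
  proof (cases "z = 0")
    case False
    obtain k where k: "k \<in> int_lattice" "p - k \<in> cbox 0 1" by (rule lattice_translate_to_cube)
    have "p - k \<in> crit" using crit_translate[OF k(1), of "p - k"] p by simp
    then have "(p - k, z /\<^sub>R norm z) \<in> C" using k False by (simp add: C_def)
    then have "m \<le> norm (D2 (p - k) (z /\<^sub>R norm z))" using m(2) by force
    also have "D2 (p - k) = D2 p" using D2_translate[OF k(1), of "p - k"] by simp
    finally show ?thesis using False by (simp add: blinfun.scaleR_right field_simps)
  qed simp
  then show ?thesis using m(1) by blast
qed

text \<open>
  One lower bound for the Hessians at all critical points, which exists because they form a compact
  set modulo the lattice.
\<close>

definition \<mu> :: real where
  "\<mu> = (SOME m. m > 0 \<and> (\<forall>p\<in>crit. \<forall>z. m * norm z \<le> norm (D2 p z)))"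

lemma \<mu>_pos: "\<mu> > 0" and \<mu>: "p \<in> crit \<Longrightarrow> \<mu> * norm z \<le> norm (D2 p z)"
  using someI_ex[OF D2_expands_at_crit] unfolding \<mu>_def by auto

text \<open>
  The coercivity constant of the Hessian at minima that \<open>\<mu>\<close> entails.
\<close>

definition \<nu> :: real where
  "\<nu> = \<mu>^2 / (K + 1)"

lemma \<nu>_pos: "\<nu> > 0"
  using \<mu>_pos K_nonneg by (simp add: \<nu>_def)

text \<open>
  So small that, in the ball around any critical point, the linearization error is dominated both by
  the growth in unstable directions (\<open>\<mu>\<close>) and by the contraction at minima (\<open>\<nu>\<close>).
\<close>

definition rad :: real where
  "rad = (SOME r. r > 0 \<and> (\<forall>x y. norm (x - y) \<le> r \<longrightarrow> norm (D2 x - D2 y) \<le> min \<mu> \<nu> / 4))"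

lemma rad_pos: "rad > 0"
  and D2_osc: "norm (x - y) \<le> rad \<Longrightarrow> norm (D2 x - D2 y) \<le> min \<mu> \<nu> / 4"
proof -
  have "min \<mu> \<nu> / 4 > 0" using \<mu>_pos \<nu>_pos by simp
  then obtain d where d: "d > 0" "\<forall>x y. norm (x - y) < d \<longrightarrow> norm (D2 x - D2 y) < min \<mu> \<nu> / 4"
    using Db_close by blast
  have "d / 2 > 0 \<and> (\<forall>x y. norm (x - y) \<le> d / 2 \<longrightarrow> norm (D2 x - D2 y) \<le> min \<mu> \<nu> / 4)"
    using d by (auto intro!: less_imp_le)
  then have "\<exists>r. r > 0 \<and> (\<forall>x y. norm (x - y) \<le> r \<longrightarrow> norm (D2 x - D2 y) \<le> min \<mu> \<nu> / 4)" by blast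
  then have R: "rad > 0 \<and> (\<forall>x y. norm (x - y) \<le> rad \<longrightarrow> norm (D2 x - D2 y) \<le> min \<mu> \<nu> / 4)"
    unfolding rad_def by (rule someI_ex)
  show "rad > 0" using R by (rule conjunct1)
  show "norm (x - y) \<le> rad \<Longrightarrow> norm (D2 x - D2 y) \<le> min \<mu> \<nu> / 4" using conjunct2[OF R] by blast
qed

lemma grad_linearized:
  assumes "x \<in> cball p rad" "y \<in> cball p rad"
  shows "norm (grad V y - grad V x - D2 p (y - x)) \<le> min \<mu> \<nu> / 4 * norm (y - x)"
proof -
  have "norm ((\<lambda>z. grad V z - D2 p z) y - (\<lambda>z. grad V z - D2 p z) x) \<le> min \<mu> \<nu> / 4 * norm (y - x)"
  proof (rule differentiable_bound[of "cball p rad" _ "\<lambda>z. blinfun_apply (D2 z - D2 p)"])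
    fix z assume "z \<in> cball p rad"
    then show "onorm (blinfun_apply (D2 z - D2 p)) \<le> min \<mu> \<nu> / 4"
      using D2_osc[of z p] by (simp add: norm_blinfun.rep_eq[symmetric] dist_norm norm_minus_commute)
    show "((\<lambda>z. grad V z - D2 p z) has_derivative blinfun_apply (D2 z - D2 p)) (at z within cball p rad)"
      using has_derivative_diff[OF has_derivative_at_withinI[OF grad_deriv]
          bounded_linear_imp_has_derivative[OF blinfun.bounded_linear_right]]
      by (simp add: minus_blinfun.rep_eq)
  qed (use assms in auto)
  then show ?thesis by (simp add: blinfun.diff_right algebra_simps)
qed

lemma crit_separated:
  assumes "p \<in> crit" "q \<in> crit" "dist p q \<le> rad"
  shows "p = q"
proof -
  have "norm (D2 p (q - p)) \<le> min \<mu> \<nu> / 4 * norm (q - p)"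
    using grad_linearized[of p p q] assms rad_pos by (auto simp: crit_def)
  also have "\<dots> \<le> \<mu> / 4 * norm (q - p)" by (intro mult_right_mono) auto
  finally have "\<mu> * norm (q - p) \<le> \<mu> / 4 * norm (q - p)" using \<mu>[OF assms(1), of "q - p"] by simp
  then have "(3 / 4 * \<mu>) * norm (q - p) \<le> 0" by (simp add: algebra_simps)
  then show ?thesis using \<mu>_pos by (simp add: mult_le_0_iff)
qed

lemma crit_balls_disjoint:
  assumes "p \<in> crit" "q \<in> crit" "y \<in> ball p (rad / 3)" "y \<in> ball q (rad / 3)"
  shows "p = q"
proof -
  have "dist p q \<le> rad" using assms(3,4) dist_triangle2[of p q y] rad_pos by simp
  then show ?thesis using crit_separated assms by blast
qed

lemma countable_crit: "countable crit"
proof -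
  have inj: "inj_on (\<lambda>p. ball p (rad / 3)) crit"
    by (rule inj_onI) (use rad_pos in \<open>auto simp: ball_eq_ball_iff\<close>)
  have "countable ((\<lambda>p. ball p (rad / 3)) ` crit)"
  proof (rule countable_disjoint_open_subsets)
    show "pairwise disjnt ((\<lambda>p. ball p (rad / 3)) ` crit)"
      unfolding pairwise_def disjnt_def using crit_balls_disjoint by fastforce
  qed auto
  then show ?thesis using inj countable_image_inj_on by blast
qed

lemma grad_bounded: "\<exists>M. \<forall>x. norm (grad V x) \<le> M"
  by (rule periodic_bounded[OF periodic_grad b_cont])

lemma V_along_flow: "((\<lambda>t. V (X t x)) has_real_derivative (norm (grad V (X t x)))^2) (at t)"
  using vector_derivative_diff_chain_within[OF X_deriv has_derivative_at_withinI[OF V_deriv]]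
  by (simp add: o_def has_real_derivative_iff_has_vector_derivative power2_norm_eq_inner)

lemma V_increasing: "s \<le> t \<Longrightarrow> V (X s x) \<le> V (X t x)"
  by (rule DERIV_nonneg_imp_nondecreasing[of s t "\<lambda>t. V (X t x)"]) (use V_along_flow in \<open>auto intro!: exI\<close>)

text \<open>
  The potential is bounded and grows along orbits at the rate \<open>|grad V|\<^sup>2\<close>. The gradient changes at
  bounded speed along an orbit, so each time at which it is at least \<open>c\<close> is preceded by an interval
  of fixed length \<open>h\<close> on which it is at least \<open>c / 2\<close>, which costs a fixed amount of potential.
\<close>

lemma grad_vanishes_backwards:
  assumes "c > 0"
  shows "\<exists>T. \<forall>t\<le>T. norm (grad V (X t x)) < c"
proof -
  obtain M where M: "\<forall>x. norm (grad V x) \<le> M" using grad_bounded ..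
  have M0: "M \<ge> 0" using M norm_ge_zero order_trans by blast
  obtain B where B: "\<forall>x. \<bar>V x\<bar> \<le> B" using V_bounded ..
  \<comment> \<open>The gradient changes by at most \<open>K M h \<le> c / 2\<close> within time \<open>h\<close>.\<close>
  define h where "h = c / (2 * (K * M + 1))"
  have KM: "K * M + 1 > 0" using K_nonneg M0 by (simp add: add_nonneg_pos)
  then have h: "h > 0" using assms by (simp add: h_def)
  define m where "m = Inf (range (\<lambda>t. V (X t x)))"
  have bdd: "bdd_below (range (\<lambda>t. V (X t x)))"
    using B by (intro bdd_belowI[of _ "- B"]) (auto simp: abs_le_iff minus_le_iff)
  have "h * (c / 2)^2 > 0" using h assms by simp
  then obtain T where T: "V (X T x) < m + h * (c / 2)^2"
    using cInf_lessD[of "range (\<lambda>t. V (X t x))" "m + h * (c / 2)^2"] by (auto simp: m_def)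
  have "norm (grad V (X t x)) < c" if t: "t \<le> T" for t
  proof (rule ccontr)
    assume "\<not> ?thesis"
    then have ge: "c \<le> norm (grad V (X t x))" by simp
    have low: "c / 2 \<le> norm (grad V (X s x))" if s: "t - h \<le> s" "s \<le> t" for s
    proof -
      have "norm (X t x - X s x) \<le> M * norm (t - s)"
      proof (rule differentiable_bound[of UNIV "\<lambda>s. X s x" "\<lambda>s v. v *\<^sub>R grad V (X s x)"])
        show "onorm (\<lambda>v. v *\<^sub>R grad V (X s x)) \<le> M" for s
          by (rule onorm_le) (use M in \<open>simp add: mult.commute[of M] mult_left_mono\<close>)
      qed (use X_deriv in \<open>auto simp: has_vector_derivative_def\<close>)
      then have "norm (grad V (X t x) - grad V (X s x)) \<le> K * (M * norm (t - s))"
        using b_lipschitz[of "X t x" "X s x"] K_nonneg by (meson mult_left_mono order_trans)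
      also have "\<dots> \<le> (K * M + 1) * h"
        using s K_nonneg M0 KM by (subst mult.assoc[symmetric]) (intro mult_mono, auto)
      also have "\<dots> = c / 2" using KM by (simp add: h_def field_simps)
      finally show ?thesis using ge norm_triangle_ineq2[of "grad V (X t x)" "grad V (X s x)"] by simp
    qed
    have "\<exists>s. s > t - h \<and> s < t \<and> V (X t x) - V (X (t - h) x) = (t - (t - h)) * (norm (grad V (X s x)))^2"
      using h by (intro MVT2 V_along_flow) auto
    then obtain s where s: "s > t - h" "s < t" "V (X t x) - V (X (t - h) x) = h * (norm (grad V (X s x)))^2" by auto
    have "h * (c / 2)^2 \<le> h * (norm (grad V (X s x)))^2"
      using low[of s] s h assms by (intro mult_left_mono power_mono) auto
    moreover have "m \<le> V (X (t - h) x)" unfolding m_def using bdd by (rule cInf_lower[rotated]) auto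
    ultimately show False using s(3) T V_increasing[OF t, of x] by linarith
  qed
  then show ?thesis by blast
qed

text \<open>
  Once the gradient is small, the orbit is confined to a union of disjoint balls around critical
  points; being connected, it stays in one of them.
\<close>

lemma backward_limit:
  "\<exists>p\<in>crit. \<exists>T. \<forall>t\<le>T. X t x \<in> ball p (rad / 3)"
proof -
  obtain c where c: "c > 0" "\<forall>y. norm (grad V y) < c \<longrightarrow> (\<exists>p\<in>crit. dist y p < rad / 3)"
    using near_crit[of "rad / 3"] rad_pos by auto
  obtain T where T: "\<forall>t\<le>T. norm (grad V (X t x)) < c" using grad_vanishes_backwards[OF c(1)] by blast
  define S where "S = (\<lambda>t. X t x) ` {..T}"
  have "connected S"
    unfolding S_def by (intro connected_continuous_image continuous_on_subset[OF X_cont_time]) auto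
  have near: "\<exists>p\<in>crit. y \<in> ball p (rad / 3)" if y: "y \<in> S" for y
  proof -
    obtain t where "t \<le> T" "y = X t x" using y by (auto simp: S_def)
    then obtain p where "p \<in> crit" "dist y p < rad / 3" using T c(2) by blast
    then show ?thesis by (auto simp: dist_commute)
  qed
  obtain p where p: "p \<in> crit" "X T x \<in> ball p (rad / 3)" using near[of "X T x"] by (auto simp: S_def)
  define W where "W = (\<Union>q\<in>crit - {p}. ball q (rad / 3))"
  have disj: "ball p (rad / 3) \<inter> W = {}"
    using crit_balls_disjoint[OF p(1)] unfolding W_def by blast
  have "S \<subseteq> ball p (rad / 3) \<union> W" using near unfolding W_def by blast
  moreover have "open W" unfolding W_def by auto
  moreover have "ball p (rad / 3) \<inter> S \<noteq> {}" using p(2) by (auto simp: S_def)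
  ultimately have "W \<inter> S = {}" using connectedD[OF \<open>connected S\<close> open_ball[of p "rad / 3"], of W] disj by blast
  then have "S \<subseteq> ball p (rad / 3)" using \<open>S \<subseteq> _\<close> by blast
  then show ?thesis using p(1) by (intro bexI[of _ p] exI[of _ T]) (auto simp: S_def)
qed

text \<open>
  The local unstable manifold of \<open>p\<close>.
\<close>

definition unstable_set :: "real^'n \<Rightarrow> (real^'n) set" where
  "unstable_set p = {x. \<forall>t\<le>0. X t x \<in> cball p rad}"

text \<open>
  Let \<open>z\<close> be the difference of two orbits that stay near \<open>p\<close> for all negative times. The quadratic form
  \<open>q = - (D2 p z \<bullet> z)\<close> satisfies \<open>q' \<le> - a q\<close> there, since \<open>|D2 p z| \<ge> \<mu> |z|\<close> dominates the linearization
  error. If \<open>z\<close> starts in a direction in which the Hessian is negative, then \<open>q\<close> is positive and grows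
  exponentially backwards in time, although \<open>z\<close> is bounded.
\<close>

lemma unstable_set_line:
  assumes p: "p \<in> crit" and e: "D2 p e \<bullet> e < 0"
    and x: "x \<in> unstable_set p" and y: "x + s *\<^sub>R e \<in> unstable_set p"
  shows "s = 0"
proof (rule ccontr)
  assume s: "s \<noteq> 0"
  define z where "z t = X t (x + s *\<^sub>R e) - X t x" for t
  define q where "q t = - (D2 p (z t) \<bullet> z t)" for t
  \<comment> \<open>The linearization error is at most \<open>|D2 p z| / 4\<close>, which leaves \<open>3/4\<close> of the main term; and \<open>q \<le> (K + 1) |z|\<^sup>2\<close>.\<close>
  define a where "a = 3 / 2 * \<mu>^2 / (K + 1)"
  have a: "a > 0" using \<mu>_pos K_nonneg by (simp add: a_def)
  have q_le: "q t \<le> (K + 1) * (norm (z t))^2" for t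
  proof -
    have "q t \<le> norm (D2 p (z t)) * norm (z t)"
      unfolding q_def using norm_cauchy_schwarz[of "- D2 p (z t)" "z t"] by simp
    also have "\<dots> \<le> (norm (D2 p) * norm (z t)) * norm (z t)"
      by (intro mult_right_mono norm_blinfun) auto
    also have "\<dots> \<le> ((K + 1) * norm (z t)) * norm (z t)"
      using Db_bound[of p] by (intro mult_right_mono) auto
    finally show ?thesis by (simp add: power2_eq_square mult.assoc)
  qed
  define w where "w t = grad V (X t (x + s *\<^sub>R e)) - grad V (X t x)" for t
  have dz: "(z has_vector_derivative w t) (at t)" for t
    unfolding z_def w_def by (intro has_vector_derivative_diff X_deriv)
  have dq: "(q has_real_derivative - 2 * (D2 p (z t) \<bullet> w t)) (at t)" for t
  proof -
    have "((\<lambda>t. D2 p (z t)) has_vector_derivative D2 p (w t)) (at t)"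
      by (rule bounded_linear.has_vector_derivative[OF blinfun.bounded_linear_right dz])
    from bounded_bilinear.has_vector_derivative[OF bounded_bilinear_inner this dz]
    have "((\<lambda>t. D2 p (z t) \<bullet> z t) has_real_derivative D2 p (z t) \<bullet> w t + D2 p (w t) \<bullet> z t) (at t)"
      by (simp add: has_real_derivative_iff_has_vector_derivative)
    moreover have "D2 p (w t) \<bullet> z t = D2 p (z t) \<bullet> w t" using D2_sym[of p "w t" "z t"] by (simp add: inner_commute)
    ultimately show ?thesis unfolding q_def by (auto intro!: derivative_eq_intros)
  qed
  have growth: "- 2 * (D2 p (z t) \<bullet> w t) \<le> - a * q t" if t: "t \<le> 0" for t
  proof -
    let ?H = "D2 p (z t)"
    have "norm (w t - ?H) \<le> min \<mu> \<nu> / 4 * norm (z t)"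
      unfolding w_def z_def using x y t by (intro grad_linearized) (auto simp: unstable_set_def)
    also have "\<dots> \<le> \<mu> * norm (z t) / 4" by (simp add: mult_right_mono)
    also have "\<dots> \<le> norm ?H / 4" using \<mu>[OF p, of "z t"] by simp
    finally have "norm ?H * norm (w t - ?H) \<le> norm ?H * (norm ?H / 4)" by (rule mult_left_mono) simp
    then have "- (?H \<bullet> (w t - ?H)) \<le> (norm ?H)^2 / 4"
      using norm_cauchy_schwarz[of "- ?H" "w t - ?H"] by (simp add: power2_eq_square)
    then have "3 / 4 * (norm ?H)^2 \<le> ?H \<bullet> w t"
      by (simp add: inner_diff_right power2_norm_eq_inner)
    moreover have "(\<mu> * norm (z t))^2 \<le> (norm ?H)^2"
      using \<mu>[OF p, of "z t"] \<mu>_pos by (intro power_mono) auto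
    moreover have "a * q t \<le> a * ((K + 1) * (norm (z t))^2)" using a q_le by (intro mult_left_mono) auto
    moreover have "a * ((K + 1) * (norm (z t))^2) = 3 / 2 * (\<mu> * norm (z t))^2"
      using K_nonneg by (simp add: a_def power_mult_distrib field_simps)
    ultimately show ?thesis by linarith
  qed
  have lower: "q 0 \<le> q t * exp (a * t)" if t: "t \<le> 0" for t
  proof -
    have "\<exists>y. ((\<lambda>t. q t * exp (a * t)) has_real_derivative y) (at u) \<and> y \<le> 0" if "t \<le> u" "u \<le> 0" for u
    proof -
      have "((\<lambda>t. q t * exp (a * t)) has_real_derivative (- 2 * (D2 p (z u) \<bullet> w u) + a * q u) * exp (a * u)) (at u)"
        by (auto intro!: derivative_eq_intros dq simp: algebra_simps)
      moreover have "(- 2 * (D2 p (z u) \<bullet> w u) + a * q u) * exp (a * u) \<le> 0"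
        using growth[OF that(2)] by (intro mult_nonpos_nonneg) auto
      ultimately show ?thesis by blast
    qed
    from DERIV_nonpos_imp_nonincreasing[OF t this] show ?thesis by simp
  qed
  have q0: "q 0 > 0"
  proof -
    have "q 0 = s^2 * - (D2 p e \<bullet> e)"
      by (simp add: q_def z_def blinfun.scaleR_right power2_eq_square)
    then show ?thesis using e s by (simp add: mult_pos_neg)
  qed
  define B where "B = (K + 1) * (2 * rad)^2"
  have B: "B > 0" using K_nonneg rad_pos by (simp add: B_def)
  have upper: "q t \<le> B" if t: "t \<le> 0" for t
  proof -
    have "norm (z t) \<le> dist p (X t (x + s *\<^sub>R e)) + dist p (X t x)"
      unfolding z_def using dist_triangle[of "X t (x + s *\<^sub>R e)" "X t x" p] by (simp add: dist_norm norm_minus_commute)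
    also have "\<dots> \<le> 2 * rad" using x y t by (auto simp: unstable_set_def intro: add_mono[of _ rad _ rad, simplified])
    finally have "(norm (z t))^2 \<le> (2 * rad)^2" by (intro power_mono) auto
    then have "(K + 1) * (norm (z t))^2 \<le> B" unfolding B_def using K_nonneg by (intro mult_left_mono) auto
    then show ?thesis using q_le[of t] by linarith
  qed
  \<comment> \<open>At this time the lower bound \<open>q 0 exp (- a t) = q 0 exp (B / q 0)\<close> exceeds the upper bound \<open>B\<close>.\<close>
  define t where "t = - (B / q 0 / a)"
  have t: "t \<le> 0" using B q0 a by (simp add: t_def)
  have "q 0 \<le> B * exp (a * t)"
    using lower[OF t] upper[OF t] by (meson exp_ge_zero mult_right_mono order_trans)
  then have "q 0 * exp (B / q 0) \<le> B" using a by (simp add: t_def exp_minus field_simps)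
  moreover have "B / q 0 < exp (B / q 0)" using exp_ge_add_one_self[of "B / q 0"] by linarith
  ultimately show False using q0 by (simp add: field_simps)
qed

lemma compact_unstable_set: "compact (unstable_set p)"
proof -
  have "unstable_set p = cball p rad \<inter> (\<Inter>t\<in>{..0}. X t -` cball p rad)"
    by (auto simp: unstable_set_def)
  moreover have "closed (X t -` cball p rad)" for t
    by (intro continuous_closed_vimage closed_cball has_derivative_continuous[OF X_has_derivative])
  ultimately show ?thesis by (auto intro!: compact_Int_closed)
qed

text \<open>
  The translates of the set along \<open>e\<close> are pairwise disjoint by \<open>unstable_set_line\<close>. Infinitely many of
  them fit into one ball and have equal measure.
\<close>

lemma negligible_unstable_set:
  assumes p: "p \<in> crit" and e: "D2 p e \<bullet> e < 0"
  shows "negligible (unstable_set p)"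
proof -
  define A where "A n = (\<lambda>x. (1 / real (Suc n)) *\<^sub>R e + x) ` unstable_set p" for n
  have comp: "compact (A n)" for n
    unfolding A_def by (rule compact_translation[OF compact_unstable_set])
  then have sets: "range A \<subseteq> sets lebesgue"
    using lmeasurable_compact fmeasurableD by blast
  have disj: "disjoint_family A"
    unfolding disjoint_family_on_def
  proof (intro ballI impI, rule ccontr)
    fix m n :: nat assume mn: "m \<noteq> n" "A m \<inter> A n \<noteq> {}"
    then obtain x y where xy: "x \<in> unstable_set p" "y \<in> unstable_set p"
      "(1 / real (Suc m)) *\<^sub>R e + x = (1 / real (Suc n)) *\<^sub>R e + y" by (auto simp: A_def)
    then have "y = x + (1 / real (Suc m) - 1 / real (Suc n)) *\<^sub>R e" by (simp add: algebra_simps)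
    then have "1 / real (Suc m) - 1 / real (Suc n) = 0" using unstable_set_line[OF p e xy(1)] xy(2) by metis
    then have "real (Suc m) = real (Suc n)" by (metis eq_iff_diff_eq_0 inverse_eq_divide inverse_inverse_eq)
    then show False using mn(1) by simp
  qed
  have "A n \<subseteq> cball p (rad + norm e)" for n
  proof
    fix y assume "y \<in> A n"
    then obtain x where x: "x \<in> unstable_set p" "y = (1 / real (Suc n)) *\<^sub>R e + x" by (auto simp: A_def)
    have "dist p x \<le> rad" using x(1) by (auto simp: unstable_set_def dest: spec[of _ "0::real"])
    moreover have "dist x y \<le> norm e" by (simp add: x(2) dist_norm mult_left_le_one_le field_simps)
    ultimately show "y \<in> cball p (rad + norm e)" using dist_triangle[of p y x] by simp
  qed
  then have sub: "(\<Union>n. A n) \<subseteq> cball p (rad + norm e)" by blast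
  have "emeasure lebesgue (\<Union>n. A n) \<le> emeasure lebesgue (cball p (rad + norm e))"
    by (rule emeasure_mono[OF sub]) (auto intro: fmeasurableD)
  also have "\<dots> < \<infinity>" using lmeasurable_cball[of p "rad + norm e"] by (simp add: fmeasurable_def)
  finally have "emeasure lebesgue (\<Union>n. A n) \<noteq> \<infinity>" by simp
  from measure_UNION[OF sets disj this]
  have "summable (\<lambda>n. measure lebesgue (A n))" by (rule sums_summable)
  moreover have "measure lebesgue (A n) = measure lebesgue (unstable_set p)" for n
    unfolding A_def by (rule measure_translation)
  ultimately have "measure lebesgue (unstable_set p) = 0" by (simp add: summable_const_iff)
  then show ?thesis
    using lmeasurable_compact[OF compact_unstable_set] by (simp add: negligible_iff_measure0)
qed

definition minima :: "(real^'n) set" where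
  "minima = {p \<in> crit. \<forall>v. 0 \<le> D2 p v \<bullet> v}"

text \<open>
  The basin of attraction of the minima for the flow in backward time, because each of these balls
  traps backward orbits (\<open>minimum_traps_backwards\<close>).
\<close>

definition basin :: "(real^'n) set" where
  "basin = {x. \<exists>p\<in>minima. \<exists>t. X t x \<in> ball p rad}"

lemma basin_flow: "x \<in> basin \<Longrightarrow> X s x \<in> basin"
proof -
  assume "x \<in> basin"
  then obtain p t where "p \<in> minima" "X ((t - s) + s) x \<in> ball p rad" by (auto simp: basin_def)
  then show ?thesis unfolding X_add basin_def by blast
qed

lemma open_basin: "open basin"
proof -
  have "basin = (\<Union>p\<in>minima. \<Union>t. X t -` ball p rad)" unfolding basin_def by blast
  moreover have "open (X t -` ball p rad)" for t p
    by (intro continuous_open_vimage open_ball has_derivative_continuous[OF X_has_derivative])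
  ultimately show ?thesis by (auto intro!: open_UN simp del: vimage_UN)
qed

lemma X_translate:
  assumes k: "k \<in> int_lattice"
  shows "X t (x + k) = X t x + k"
proof -
  have "((\<lambda>t. X t x + k) has_vector_derivative grad V (X t x + k)) (at t)" for t
    using has_vector_derivative_add[OF X_deriv has_vector_derivative_const] by (simp add: grad_translate[OF k])
  from solution_eq_flow[OF this] show ?thesis by simp
qed

lemma minima_translate: "k \<in> int_lattice \<Longrightarrow> p + k \<in> minima \<longleftrightarrow> p \<in> minima"
  by (simp add: minima_def crit_translate D2_translate)

lemma basin_translate:
  assumes k: "k \<in> int_lattice"
  shows "x + k \<in> basin \<longleftrightarrow> x \<in> basin"
proof -
  have imp: "x \<in> basin \<Longrightarrow> x + k \<in> basin" if k: "k \<in> int_lattice" for x k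
  proof -
    assume "x \<in> basin"
    then obtain p t where p: "p \<in> minima" "X t x \<in> ball p rad" by (auto simp: basin_def)
    then have "p + k \<in> minima" "X t (x + k) \<in> ball (p + k) rad"
      using minima_translate[OF k] by (auto simp: X_translate[OF k])
    then show "x + k \<in> basin" unfolding basin_def by blast
  qed
  show ?thesis using imp[OF k, of x] imp[OF int_lattice_uminus[OF k], of "x + k"] by auto
qed

text \<open>
  Outside the basin, some \<open>X (- n) x\<close> lies in the local unstable manifold of a critical point at
  which the Hessian has a negative direction. Critical points are isolated, hence countably many,
  and the diffeomorphisms \<open>X n\<close> preserve null sets.
\<close>

lemma negligible_Compl_basin: "negligible (- basin)"
proof (rule negligible_subset)
  let ?N = "\<Union>p\<in>crit - minima. \<Union>n. X (real n) ` unstable_set p"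
  show "- basin \<subseteq> ?N"
  proof
    fix x assume x: "x \<in> - basin"
    obtain p T where p: "p \<in> crit" "\<forall>t\<le>T. X t x \<in> ball p (rad / 3)" using backward_limit by blast
    have sub: "ball p (rad / 3) \<subseteq> ball p rad" using rad_pos by (intro subset_ball) simp
    have "X T x \<in> ball p rad" by (rule subsetD[OF sub]) (use p(2) in simp)
    then have "p \<notin> minima" using x by (auto simp: basin_def)
    moreover obtain n :: nat where n: "- T \<le> real n" using real_arch_simple by blast
    have "X (- real n) x \<in> unstable_set p"
      unfolding unstable_set_def
    proof (intro CollectI allI impI)
      fix t :: real assume "t \<le> 0"
      then have "X (t - real n) x \<in> ball p rad" by (intro subsetD[OF sub]) (use p(2) n in simp)
      then show "X t (X (- real n) x) \<in> cball p rad" using X_add[of t "- real n" x] by auto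
    qed
    then have "x \<in> X (real n) ` unstable_set p" by (rule rev_image_eqI) simp
    ultimately show "x \<in> ?N" using p(1) by blast
  qed
  have "negligible (\<Union>((\<lambda>(p, n). X (real n) ` unstable_set p) ` ((crit - minima) \<times> UNIV)))"
  proof (rule negligible_countable_Union)
    show "countable ((\<lambda>(p, n::nat). X (real n) ` unstable_set p) ` ((crit - minima) \<times> UNIV))"
      using countable_crit by (intro countable_image countable_SIGMA) auto
    fix N assume "N \<in> (\<lambda>(p, n::nat). X (real n) ` unstable_set p) ` ((crit - minima) \<times> UNIV)"
    then obtain p n where p: "p \<in> crit" "p \<notin> minima" "N = X (real n) ` unstable_set p" by auto
    then obtain e where "D2 p e \<bullet> e < 0" by (auto simp: minima_def not_le)
    then have "negligible (unstable_set p)" using p(1) by (rule negligible_unstable_set[rotated])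
    then show "negligible N"
      unfolding p(3) by (rule negligible_differentiable_image_negligible[OF order_refl])
        (auto simp: differentiable_on_def differentiable_def intro: has_derivative_at_withinI[OF X_has_derivative])
  qed
  then show "negligible ?N" by (simp add: UN_extend_simps case_prod_beta flip: UN_simps) (rule negligible_subset, assumption, force)
qed

text \<open>
  Evaluate the nonnegative form \<open>D2 p\<close> at \<open>v - s D2 p v\<close> with \<open>s = 1 / (K + 1)\<close>.
\<close>

lemma D2_coercive_at_minimum:
  assumes p: "p \<in> minima"
  shows "\<nu> * (norm v)^2 \<le> D2 p v \<bullet> v"
proof -
  define s where "s = 1 / (K + 1)"
  have s: "s > 0" "s * K \<le> 1" using K_nonneg by (auto simp: s_def field_simps)
  let ?h = "D2 p v"
  have "0 \<le> D2 p (v - s *\<^sub>R ?h) \<bullet> (v - s *\<^sub>R ?h)" using p by (simp add: minima_def)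
  also have "\<dots> = ?h \<bullet> v - 2 * s * (?h \<bullet> ?h) + s * (s * (D2 p ?h \<bullet> ?h))"
    using D2_sym[of p ?h v] by (simp add: blinfun.diff_right blinfun.scaleR_right inner_diff_left inner_diff_right inner_commute algebra_simps)
  also have "s * (s * (D2 p ?h \<bullet> ?h)) \<le> s * (?h \<bullet> ?h)"
  proof (intro mult_left_mono)
    have "D2 p ?h \<bullet> ?h \<le> norm (D2 p ?h) * norm ?h" by (rule norm_cauchy_schwarz)
    also have "\<dots> \<le> (K * norm ?h) * norm ?h"
      by (intro mult_right_mono order_trans[OF norm_blinfun mult_right_mono[OF Db_bound]]) auto
    finally have "s * (D2 p ?h \<bullet> ?h) \<le> s * ((K * norm ?h) * norm ?h)" using s by (intro mult_left_mono) auto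
    also have "\<dots> = (s * K) * (?h \<bullet> ?h)" by (simp add: power2_norm_eq_inner[symmetric] power2_eq_square)
    also have "\<dots> \<le> 1 * (?h \<bullet> ?h)" using s by (intro mult_right_mono) auto
    finally show "s * (D2 p ?h \<bullet> ?h) \<le> ?h \<bullet> ?h" by simp
  qed (use s in simp)
  finally have "s * (norm ?h)^2 \<le> ?h \<bullet> v" by (simp add: power2_norm_eq_inner)
  moreover have "s * (\<mu> * norm v)^2 \<le> s * (norm ?h)^2"
    using \<mu>[of p v] \<mu>_pos s p by (intro mult_left_mono power_mono) (auto simp: minima_def)
  ultimately show ?thesis by (simp add: \<nu>_def s_def power_mult_distrib)
qed

text \<open>
  Inside the ball the distance to the minimum does not decrease with time, by coercivity. An orbit that is
  outside at time \<open>s\<close> and inside at time \<open>t\<close> would contradict this after its last time \<open>u\<close> outside.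
\<close>

lemma minimum_traps_backwards:
  assumes p: "p \<in> minima" and t: "X t x \<in> ball p rad" and s: "s \<le> t"
  shows "X s x \<in> ball p rad"
proof (rule ccontr)
  assume out: "X s x \<notin> ball p rad"
  define w where "w u = (dist p (X u x))^2" for u
  have w_in: "X u x \<in> ball p rad \<longleftrightarrow> w u < rad^2" for u
    using rad_pos by (simp add: w_def not_le[symmetric] abs_le_square_iff[symmetric])
  have dw: "(w has_real_derivative 2 * ((X u x - p) \<bullet> grad V (X u x))) (at u)" for u
  proof -
    have d: "((\<lambda>u. X u x - p) has_vector_derivative grad V (X u x)) (at u)"
      using has_vector_derivative_diff[OF X_deriv has_vector_derivative_const] by simp
    have "w = (\<lambda>u. (X u x - p) \<bullet> (X u x - p))"
      by (simp add: fun_eq_iff w_def dist_norm norm_minus_commute[of p] power2_norm_eq_inner)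
    then show ?thesis
      using bounded_bilinear.has_vector_derivative[OF bounded_bilinear_inner d d]
      by (simp add: has_real_derivative_iff_has_vector_derivative inner_commute)
  qed
  have w_cont: "continuous_on A w" for A
    by (auto intro!: continuous_at_imp_continuous_on DERIV_isCont[OF dw])
  define A where "A = {u \<in> {s..t}. rad^2 \<le> w u}"
  have A: "compact A" "A \<noteq> {}"
  proof -
    have "A = {s..t} \<inter> w -` {rad^2..}" by (auto simp: A_def)
    moreover have "closed (w -` {rad^2..})"
      by (intro continuous_closed_vimage closed_atLeast DERIV_isCont[OF dw])
    ultimately show "compact A" by (auto intro: compact_Int_closed)
    show "A \<noteq> {}" using out s w_in[of s] by (auto simp: A_def)
  qed
  obtain u where u: "u \<in> A" "\<forall>v\<in>A. v \<le> u" using compact_attains_sup[OF A] by blast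
  have ut: "s \<le> u" "u \<le> t" using u(1) by (auto simp: A_def)
  have "w u \<le> w t"
  proof (rule DERIV_nonneg_imp_increasing_open[OF ut(2)])
    fix v assume v: "u < v" "v < t"
    then have "v \<notin> A" using u(2) by auto
    then have "X v x \<in> ball p rad" using v ut w_in[of v] by (auto simp: A_def)
    then have "norm (grad V (X v x) - grad V p - D2 p (X v x - p)) \<le> min \<mu> \<nu> / 4 * norm (X v x - p)"
      using rad_pos by (intro grad_linearized) auto
    also have "\<dots> \<le> \<nu> * norm (X v x - p)" using \<nu>_pos by (intro mult_right_mono) auto
    finally have "norm (X v x - p) * norm (grad V (X v x) - D2 p (X v x - p)) \<le> norm (X v x - p) * (\<nu> * norm (X v x - p))"
      using p by (intro mult_left_mono) (auto simp: minima_def crit_def)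
    moreover have "- (h \<bullet> g) \<le> norm h * norm g" for h g :: "real^'n"
      using norm_cauchy_schwarz[of "- h" g] by simp
    ultimately have "- ((X v x - p) \<bullet> (grad V (X v x) - D2 p (X v x - p))) \<le> norm (X v x - p) * (\<nu> * norm (X v x - p))"
      by (rule order_trans[rotated])
    then have "- ((X v x - p) \<bullet> (grad V (X v x) - D2 p (X v x - p))) \<le> \<nu> * (norm (X v x - p))^2"
      by (simp only: power2_eq_square mult_ac)
    then have "0 \<le> (X v x - p) \<bullet> grad V (X v x)"
      using D2_coercive_at_minimum[OF p, of "X v x - p"] by (simp add: inner_diff_right inner_commute)
    then show "\<exists>y. (w has_real_derivative y) (at v) \<and> 0 \<le> y" using dw[of v] by (intro exI) auto
  qed (rule w_cont)
  then show False using t w_in[of t] u(1) by (simp add: A_def)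
qed

lemma divergence_near_minimum:
  assumes p: "p \<in> minima" and y: "y \<in> ball p rad"
  shows "3 / 4 * \<nu> \<le> divergence y"
proof -
  have "3 / 4 * \<nu> \<le> D2 y (axis i 1) $ i" for i
  proof -
    have "norm ((D2 p - D2 y) (axis i 1)) \<le> min \<mu> \<nu> / 4 * norm (axis i 1 :: real^'n)"
      using y by (intro order_trans[OF norm_blinfun mult_right_mono] D2_osc) (auto simp: dist_norm)
    also have "\<dots> \<le> \<nu> / 4" by (simp add: norm_axis_1)
    finally have 1: "\<bar>(D2 p (axis i 1) - D2 y (axis i 1)) $ i\<bar> \<le> \<nu> / 4"
      using component_le_norm_cart order_trans by (metis blinfun.diff_left)
    have 2: "\<nu> \<le> D2 p (axis i 1) $ i"
      using D2_coercive_at_minimum[OF p, of "axis i 1"] by (simp add: inner_axis norm_axis_1)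
    show ?thesis using abs_le_D1[OF 1] 2 unfolding vector_minus_component by linarith
  qed
  then have "(\<Sum>i\<in>(UNIV :: 'n set). 3 / 4 * \<nu>) \<le> divergence y"
    unfolding divergence_def trace_def matrix_def by (simp del: sum_constant) (rule sum_mono, simp)
  moreover have "3 / 4 * \<nu> \<le> real CARD('n) * (3 / 4 * \<nu>)"
  proof -
    have "1 \<le> real CARD('n)" using zero_less_card_finite[where 'a='n] by (simp add: Suc_le_eq)
    from mult_right_mono[OF this, of "3 / 4 * \<nu>"] show ?thesis using \<nu>_pos by simp
  qed
  ultimately show ?thesis by simp
qed

text \<open>
  Near a minimum the divergence, which is the trace of the Hessian, is bounded below by a positive
  constant, and the backward orbit remains there.
\<close>

lemma jac_decays_backwards:
  assumes "x \<in> basin"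
  shows "\<exists>T C c. c > 0 \<and> (\<forall>t\<le>T. jac t x \<le> C * exp (c * t))"
proof -
  obtain p T where p: "p \<in> minima" "X T x \<in> ball p rad" using assms by (auto simp: basin_def)
  define c where "c = 3 / 4 * \<nu>"
  have c: "c > 0" using \<nu>_pos by (simp add: c_def)
  have "jac t x \<le> (jac T x * exp (- c * T)) * exp (c * t)" if t: "t \<le> T" for t
  proof -
    have "jac t x * exp (- c * t) \<le> jac T x * exp (- c * T)"
    proof (rule DERIV_nonneg_imp_nondecreasing[OF t])
      fix u assume u: "t \<le> u" "u \<le> T"
      have "((\<lambda>t. jac t x * exp (- c * t)) has_real_derivative (divergence (X u x) - c) * (jac u x * exp (- c * u))) (at u)"
        by (auto intro!: derivative_eq_intros jac_deriv simp: algebra_simps)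
      moreover have "c \<le> divergence (X u x)"
        unfolding c_def using divergence_near_minimum[OF p(1) minimum_traps_backwards[OF p u(2)]] .
      then have "0 \<le> (divergence (X u x) - c) * (jac u x * exp (- c * u))"
        using jac_pos[of u x] by simp
      ultimately show "\<exists>y. ((\<lambda>t. jac t x * exp (- c * t)) has_real_derivative y) (at u) \<and> 0 \<le> y"
        by blast
    qed
    then have "jac t x * exp (- c * t) * exp (c * t) \<le> (jac T x * exp (- c * T)) * exp (c * t)"
      by (rule mult_right_mono) simp
    then show ?thesis by (simp add: mult.assoc flip: exp_add)
  qed
  then show ?thesis using c by blast
qed

end

section \<open>The transport time\<close>

text \<open>
  The first factor vanishes at \<open>x\<close>, so the second one enters the derivative only through its value.
\<close>

lemma has_derivative_mult_vanishing:
  fixes q n :: "'a::real_normed_vector \<Rightarrow> real"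
  assumes q: "(q has_derivative q') (at x)" and q0: "q x = 0" and n: "isCont n x"
  shows "((\<lambda>y. q y * n y) has_derivative (\<lambda>v. q' v * n x)) (at x)"
  unfolding has_derivative_within_alt2[where s=UNIV]
proof (intro conjI allI impI)
  have bl: "bounded_linear q'" using q by (rule has_derivative_bounded_linear)
  show "bounded_linear (\<lambda>v. q' v * n x)" using bl by (rule bounded_linear_mult_const)
  obtain C where C: "C > 0" "\<And>v. norm (q' v) \<le> norm v * C" using bounded_linear.pos_bounded[OF bl] by blast
  fix e :: real assume e: "e > 0"
  \<comment> \<open>The two error terms below each get half of \<open>e\<close>.\<close>
  define e1 where "e1 = e / (2 * (\<bar>n x\<bar> + 1))"
  have e1: "e1 > 0" using e by (simp add: e1_def add_nonneg_pos)
  have "\<forall>\<^sub>F y in at x. norm (q y - q x - q' (y - x)) \<le> e1 * norm (y - x)"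
    using q e1 unfolding has_derivative_within_alt2[where s=UNIV] by blast
  moreover have lim: "(n \<longlongrightarrow> n x) (at x)" using n by (simp add: isCont_def)
  have "\<forall>\<^sub>F y in at x. dist (n y) (n x) < 1" by (rule tendstoD[OF lim]) simp
  moreover have "\<forall>\<^sub>F y in at x. dist (n y) (n x) < e / (2 * C)" by (rule tendstoD[OF lim]) (use e C in simp)
  ultimately show "\<forall>\<^sub>F y in at x. norm (q y * n y - q x * n x - q' (y - x) * n x) \<le> e * norm (y - x)"
  proof eventually_elim
    case (elim y)
    have "q y * n y - q x * n x - q' (y - x) * n x = n y * (q y - q x - q' (y - x)) + (n y - n x) * q' (y - x)"
      by (simp add: q0 algebra_simps)
    also have "norm \<dots> \<le> \<bar>n y\<bar> * norm (q y - q x - q' (y - x)) + \<bar>n y - n x\<bar> * norm (q' (y - x))"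
      by (rule order_trans[OF norm_triangle_ineq]) (simp add: abs_mult)
    also have "\<dots> \<le> (\<bar>n x\<bar> + 1) * (e1 * norm (y - x)) + e / (2 * C) * (norm (y - x) * C)"
      using elim C by (intro add_mono mult_mono) (auto simp: dist_real_def)
    also have "\<dots> = e * norm (y - x)" using C by (simp add: e1_def field_simps add_nonneg_pos)
    finally show ?case .
  qed
qed

lemma exp_set_integrable_atMost:
  fixes c :: real
  assumes c: "c > 0"
  shows "set_integrable lborel {..a} (\<lambda>t. exp (c * t))"
proof -
  have "set_integrable lborel (einterval (- \<infinity>) (ereal (a + 1))) (\<lambda>t. exp (c * t))"
  proof (rule interval_integral_FTC_nonneg(1)[where F="\<lambda>t. exp (c * t) / c" and A=0 and B="exp (c * (a + 1)) / c"])
    have "LIM t at_bot. c * t :> at_bot"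
      by (rule filterlim_tendsto_pos_mult_at_bot[OF tendsto_const c filterlim_ident])
    then have "((\<lambda>t. exp (c * t)) \<longlongrightarrow> 0) at_bot" by (rule filterlim_compose[OF exp_at_bot])
    from tendsto_divide[OF this tendsto_const, of c]
    show "(((\<lambda>t. exp (c * t) / c) \<circ> real_of_ereal) \<longlongrightarrow> 0) (at_right (- \<infinity>))"
      using c by (simp add: ereal_tendsto_simps)
    show "(((\<lambda>t. exp (c * t) / c) \<circ> real_of_ereal) \<longlongrightarrow> exp (c * (a + 1)) / c) (at_left (ereal (a + 1)))"
      unfolding ereal_tendsto_simps by (rule tendsto_within_subset[OF _ subset_UNIV]) (use c in \<open>auto intro!: tendsto_eq_intros\<close>)
  qed (use c in \<open>auto intro!: derivative_eq_intros continuous_intros\<close>)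
  then show ?thesis by (rule set_integrable_subset) (auto simp: einterval_def)
qed

lemma set_integrable_exp_decay:
  fixes f :: "real \<Rightarrow> real"
  assumes f: "continuous_on UNIV f" and c: "c > 0" and bd: "\<And>t. t \<le> T \<Longrightarrow> \<bar>f t\<bar> \<le> C * exp (c * t)"
  shows "set_integrable lborel {..a} f"
proof -
  have "bounded (f ` {T..a})"
    by (intro compact_imp_bounded compact_continuous_image continuous_on_subset[OF f]) auto
  then obtain B where B: "\<forall>y\<in>f ` {T..a}. norm y \<le> B" unfolding bounded_iff ..
  define M where "M = max C (max B 0 / exp (c * T))"
  have bound: "\<bar>f t\<bar> \<le> M * exp (c * t)" if "t \<le> a" for t
  proof (cases "t \<le> T")
    case True
    show ?thesis
      by (rule order_trans[OF bd[OF True]]) (auto intro!: mult_right_mono simp: M_def)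
  next
    case False
    then have "f t \<in> f ` {T..a}" using that by auto
    then have "\<bar>f t\<bar> \<le> max B 0" using B by (auto simp: le_max_iff_disj)
    also have "\<dots> = max B 0 / exp (c * T) * exp (c * T)" by simp
    also have "\<dots> \<le> M * exp (c * t)" using False c by (intro mult_mono) (auto simp: M_def le_max_iff_disj)
    finally show ?thesis .
  qed
  show ?thesis
  proof (rule set_integrable_bound)
    show "set_integrable lborel {..a} (\<lambda>t. M * exp (c * t))"
      using exp_set_integrable_atMost[OF c] by simp
    show "set_borel_measurable lborel {..a} f"
      unfolding set_borel_measurable_def using borel_measurable_continuous_onI[OF f] by (intro borel_measurable_scaleR) auto
    have "norm (f t) \<le> norm (M * exp (c * t))" if "t \<in> {..a}" for t
      using bound[of t] that by (auto simp: abs_mult intro: order_trans)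
    then show "AE t\<in>{..a} in lborel. norm (f t) \<le> norm (M * exp (c * t))" by simp
  qed
qed

locale transport_flow = gradient_flow V K X
  for V :: "real^'n \<Rightarrow> real" and K X +
  fixes \<rho>0 \<rho>1 :: "real^'n \<Rightarrow> real" and D\<rho>0 D\<rho>1 :: "real^'n \<Rightarrow> (real^'n) \<Rightarrow>\<^sub>L real"
  assumes \<rho>0_pos: "\<And>x. \<rho>0 x > 0" and \<rho>1_pos: "\<And>x. \<rho>1 x > 0"
    and \<rho>0_deriv: "\<And>x. (\<rho>0 has_derivative D\<rho>0 x) (at x)" and \<rho>1_deriv: "\<And>x. (\<rho>1 has_derivative D\<rho>1 x) (at x)"
    and D\<rho>0_cont: "continuous_on UNIV D\<rho>0" and D\<rho>1_cont: "continuous_on UNIV D\<rho>1"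
    and \<rho>0_periodic: "periodic \<rho>0" and \<rho>1_periodic: "periodic \<rho>1"
    and laplacian: "\<And>x. laplacian V x = \<rho>1 x - \<rho>0 x"
    and mass0: "(\<integral>\<^sup>+x. ennreal (\<rho>0 x) \<partial>torus_measure) = 1"
    and mass1: "(\<integral>\<^sup>+x. ennreal (\<rho>1 x) \<partial>torus_measure) = 1"
begin

lemma divergence_eq: "divergence x = \<rho>1 x - \<rho>0 x"
  by (simp add: divergence_def laplacian_eq[symmetric] laplacian)

lemma \<rho>0_cont: "continuous_on UNIV \<rho>0" and \<rho>1_cont: "continuous_on UNIV \<rho>1"
  by (auto intro!: continuous_at_imp_continuous_on has_derivative_continuous[OF \<rho>0_deriv] has_derivative_continuous[OF \<rho>1_deriv])

lemma divergence_translate: "k \<in> int_lattice \<Longrightarrow> divergence (x + k) = divergence x"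
  using \<rho>0_periodic \<rho>1_periodic by (simp add: divergence_eq periodic_def)

text \<open>
  The integrands in the equation for \<open>\<kappa>\<close>. Liouville's formula makes \<open>F1 - F0\<close> the time derivative of
  the Jacobian.
\<close>

definition F0 :: "real \<Rightarrow> real^'n \<Rightarrow> real" where "F0 t x = \<rho>0 (X t x) * jac t x"
definition F1 :: "real \<Rightarrow> real^'n \<Rightarrow> real" where "F1 t x = \<rho>1 (X t x) * jac t x"

lemma F0_pos: "F0 t x > 0" and F1_pos: "F1 t x > 0"
  by (simp_all add: F0_def F1_def \<rho>0_pos \<rho>1_pos jac_pos)

lemma jac_deriv_F: "((\<lambda>t. jac t x) has_real_derivative F1 t x - F0 t x) (at t)"
  using jac_deriv by (simp add: divergence_eq F0_def F1_def algebra_simps)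

lemma ex_C1_family_F1: "\<exists>F'. C1_family F1 F'"
proof -
  have "C1_family (\<lambda>t x. divergence (X t x)) (\<lambda>t x. (D\<rho>1 (X t x) - D\<rho>0 (X t x)) o\<^sub>L DX t x)"
  proof (rule C1_family_compose[OF C1_family_X])
    show "(divergence has_derivative blinfun_apply (D\<rho>1 y - D\<rho>0 y)) (at y)" for y
      using has_derivative_diff[OF \<rho>1_deriv \<rho>0_deriv] by (simp add: divergence_eq[abs_def] minus_blinfun.rep_eq)
  qed (intro continuous_intros D\<rho>0_cont D\<rho>1_cont)
  from C1_family_exp[OF C1_family_primitive[OF this]]
  obtain j where "C1_family jac j" by (auto simp: jac_eq_exp[abs_def])
  from C1_family_mult[OF C1_family_compose[OF C1_family_X \<rho>1_deriv D\<rho>1_cont] this]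
  show ?thesis by (auto simp: F1_def[abs_def])
qed

lemma F1_cont: "continuous_on UNIV (\<lambda>(t, x). F1 t x)"
  using ex_C1_family_F1 by (auto simp: C1_family_def)

lemma F1_cont_time: "continuous_on UNIV (\<lambda>t. F1 t x)"
  using continuous_swap[OF F1_cont continuous_on_id continuous_on_const] .

lemma jac_cont_time: "continuous_on UNIV (\<lambda>t. jac t x)"
  by (auto intro!: continuous_at_imp_continuous_on DERIV_isCont[OF jac_deriv])

lemma F0_cont_time: "continuous_on UNIV (\<lambda>t. F0 t x)"
  unfolding F0_def by (intro continuous_intros jac_cont_time continuous_on_compose2[OF \<rho>0_cont X_cont_time]) auto

definition A :: "real \<Rightarrow> real^'n \<Rightarrow> real" where "A t x = primitive (\<lambda>s. F1 s x) t"

lemma A_0 [simp]: "A 0 x = 0"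
  by (simp add: A_def)

lemma A_deriv: "((\<lambda>t. A t x) has_real_derivative F1 t x) (at t)"
  using primitive_has_derivative[OF F1_cont_time] by (simp add: A_def has_real_derivative_iff_has_vector_derivative)

lemma A_strict_mono: "s < t \<Longrightarrow> A s x < A t x"
  by (rule DERIV_pos_imp_increasing[of s t "\<lambda>t. A t x"]) (use A_deriv F1_pos in \<open>blast+\<close>)

lemma A_inj: "A s x = A t x \<Longrightarrow> s = t"
  using A_strict_mono[of s t x] A_strict_mono[of t s x] by (cases s t rule: linorder_cases) auto

lemma A_cont: "continuous_on S (\<lambda>t. A t x)"
  by (auto intro!: continuous_at_imp_continuous_on DERIV_isCont[OF A_deriv])

definition DA :: "real \<Rightarrow> real^'n \<Rightarrow> (real^'n) \<Rightarrow>\<^sub>L real" where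
  "DA = (SOME A'. C1_family A A')"

lemma C1_family_A: "C1_family A DA"
proof -
  have "\<exists>A'. C1_family A A'" using ex_C1_family_F1 C1_family_primitive by (auto simp: A_def[abs_def])
  then show ?thesis unfolding DA_def by (rule someI_ex)
qed

lemma jac_tendsto_0:
  assumes "x \<in> basin" "e > 0"
  shows "\<exists>T. \<forall>t\<le>T. jac t x < e"
proof -
  obtain T C c where c: "c > 0" "\<forall>t\<le>T. jac t x \<le> C * exp (c * t)" using jac_decays_backwards[OF assms(1)] by blast
  have "0 < C * exp (c * T)" using c(2) jac_pos[of T x] by (meson order_refl order_less_le_trans)
  then have C: "C > 0" by (simp add: zero_less_mult_iff)
  have "jac t x < e" if t: "t \<le> min T (ln (e / (2 * C)) / c)" for t
  proof -
    have "c * t \<le> ln (e / (2 * C))" using t c by (simp add: field_simps)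
    then have "exp (c * t) \<le> e / (2 * C)" using C assms(2) by (metis divide_pos_pos exp_le_cancel_iff exp_ln mult_pos_pos zero_less_numeral)
    then have "C * exp (c * t) \<le> e / 2" using C by (simp add: field_simps)
    moreover have "jac t x \<le> C * exp (c * t)" using c(2) t by simp
    ultimately show ?thesis using assms(2) by linarith
  qed
  then show ?thesis by blast
qed

text \<open>
  The function \<open>A t x - jac t x + 1\<close> is the primitive of \<open>F0 > 0\<close> that vanishes at \<open>t = 0\<close>, so it stays below
  a negative constant before time \<open>- 1\<close>. Since \<open>jac\<close> tends to \<open>0\<close>, the function \<open>A\<close> itself falls below \<open>- 1\<close>.
\<close>

lemma ex_level:
  assumes "x \<in> basin"
  shows "\<exists>t. A t x = - 1"
proof -
  define B where "B t = A t x - jac t x + 1" for t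
  have "(B has_real_derivative F0 t x) (at t)" for t
    unfolding B_def by (auto intro!: derivative_eq_intros A_deriv jac_deriv_F)
  then have B_mono: "s < t \<Longrightarrow> B s < B t" for s t
    using DERIV_pos_imp_increasing[of s t B] F0_pos by blast
  have "B (- 1) < 0" using B_mono[of "- 1" 0] by (simp add: B_def)
  then obtain T where T: "\<forall>t\<le>T. jac t x < - B (- 1)" using jac_tendsto_0[OF assms, of "- B (- 1)"] by auto
  define t where "t = min T (- 1)"
  have "t \<le> - 1" by (simp add: t_def)
  then have "B t \<le> B (- 1)" using B_mono[of t "- 1"] by (cases "t = - 1") auto
  moreover have "jac t x < - B (- 1)" using T by (simp add: t_def)
  ultimately have "A t x \<le> - 1" by (simp add: B_def)
  moreover have "t \<le> 0" by (simp add: t_def)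
  ultimately show ?thesis
    using IVT'[of "\<lambda>t. A t x" t "- 1" 0] A_cont by auto
qed

text \<open>
  The level \<open>- 1\<close> states that the integral of \<open>F1\<close> from \<open>\<kappa> x\<close> to \<open>0\<close> is \<open>1\<close>, which is the defining equation of \<open>\<kappa>\<close>
  without improper integrals; see \<open>integral_equation\<close>.
\<close>

definition \<kappa> :: "real^'n \<Rightarrow> real" where
  "\<kappa> x = (SOME t. A t x = - 1)"

lemma A_\<kappa>: "x \<in> basin \<Longrightarrow> A (\<kappa> x) x = - 1"
  unfolding \<kappa>_def by (rule someI_ex[OF ex_level])

lemma \<kappa>_neg: "x \<in> basin \<Longrightarrow> \<kappa> x < 0"
  using A_\<kappa>[of x] A_strict_mono[of 0 "\<kappa> x" x] by (cases "\<kappa> x" "0::real" rule: linorder_cases) auto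

lemma jac_translate: "k \<in> int_lattice \<Longrightarrow> jac t (x + k) = jac t x"
  by (simp add: jac_eq_exp X_translate divergence_translate)

lemma F1_translate: "k \<in> int_lattice \<Longrightarrow> F1 t (x + k) = F1 t x"
  using \<rho>1_periodic by (simp add: F1_def X_translate jac_translate periodic_def)

lemma \<kappa>_translate: "k \<in> int_lattice \<Longrightarrow> \<kappa> (x + k) = \<kappa> x"
  by (simp add: \<kappa>_def A_def F1_translate)

lemma A_cont_space: "isCont (A t) x"
  using C1_family_A by (auto simp: C1_family_def intro: has_derivative_continuous)

lemma \<kappa>_isCont:
  assumes x: "x \<in> basin"
  shows "isCont \<kappa> x"
  unfolding isCont_def
proof (rule order_tendstoI)
  have ev: "\<forall>\<^sub>F y in at x. y \<in> basin" using open_basin x by (rule eventually_at_in_open')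
  fix t
  { assume t: "t < \<kappa> x"
    then have "A t x < - 1" using A_strict_mono[OF t, of x] A_\<kappa>[OF x] by simp
    then have "\<forall>\<^sub>F y in at x. A t y < - 1" using A_cont_space[of x t] by (simp add: isCont_def order_tendstoD(2))
    with ev show "\<forall>\<^sub>F y in at x. t < \<kappa> y"
    proof eventually_elim
      case (elim y)
      then show ?case using A_\<kappa>[of y] A_strict_mono[of "\<kappa> y" t y] by (cases t "\<kappa> y" rule: linorder_cases) auto
    qed }
  { assume t: "\<kappa> x < t"
    then have "- 1 < A t x" using A_strict_mono[OF t, of x] A_\<kappa>[OF x] by simp
    then have "\<forall>\<^sub>F y in at x. - 1 < A t y" using A_cont_space[of x t] by (simp add: isCont_def order_tendstoD(1))
    with ev show "\<forall>\<^sub>F y in at x. \<kappa> y < t"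
    proof eventually_elim
      case (elim y)
      then show ?case using A_\<kappa>[of y] A_strict_mono[of t "\<kappa> y" y] by (cases t "\<kappa> y" rule: linorder_cases) auto
    qed }
qed

text \<open>
  Implicit differentiation of \<open>A (\<kappa> x) x = - 1\<close>.
\<close>

definition D\<kappa> :: "real^'n \<Rightarrow> real^'n \<Rightarrow> real" where
  "D\<kappa> x v = - (DA (\<kappa> x) x v / F1 (\<kappa> x) x)"

lemma A_mean_value: "\<exists>u. \<bar>u - t\<bar> \<le> \<bar>s - t\<bar> \<and> A s y - A t y = (s - t) * F1 u y"
proof (cases s t rule: linorder_cases)
  case less
  then obtain u where "s < u" "u < t" "A t y - A s y = (t - s) * F1 u y"
    using MVT2[OF less, of "\<lambda>t. A t y" "\<lambda>t. F1 t y"] A_deriv by auto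
  then show ?thesis by (intro exI[of _ u]) (auto simp: algebra_simps)
next
  case greater
  then obtain u where "t < u" "u < s" "A s y - A t y = (s - t) * F1 u y"
    using MVT2[OF greater, of "\<lambda>t. A t y" "\<lambda>t. F1 t y"] A_deriv by auto
  then show ?thesis by (intro exI[of _ u]) auto
qed auto

text \<open>
  By the mean value theorem in time, \<open>\<kappa> y - \<kappa> x = - (A (\<kappa> x) y + 1) / F1 (u y) y\<close> with \<open>u y\<close> between \<open>\<kappa> x\<close> and
  \<open>\<kappa> y\<close>. The numerator is differentiable and vanishes at \<open>x\<close>, and the denominator is continuous there.
\<close>

lemma \<kappa>_has_derivative:
  assumes x: "x \<in> basin"
  shows "(\<kappa> has_derivative D\<kappa> x) (at x)"
proof -
  obtain u where u: "\<And>y. \<bar>u y - \<kappa> x\<bar> \<le> \<bar>\<kappa> y - \<kappa> x\<bar>"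
    "\<And>y. A (\<kappa> y) y - A (\<kappa> x) y = (\<kappa> y - \<kappa> x) * F1 (u y) y"
    using A_mean_value[of "\<kappa> x" "\<kappa> y" y for y] by metis
  have ux: "u x = \<kappa> x" using u(1)[of x] by simp
  have "isCont u x"
    unfolding isCont_def ux
  proof (rule tendstoI)
    fix e :: real assume "e > 0"
    then have "\<forall>\<^sub>F y in at x. dist (\<kappa> y) (\<kappa> x) < e" using \<kappa>_isCont[OF x] by (simp add: isCont_def tendstoD)
    then show "\<forall>\<^sub>F y in at x. dist (u y) (\<kappa> x) < e"
      by eventually_elim (use u(1) in \<open>auto simp: dist_real_def intro: order_le_less_trans\<close>)
  qed
  then have "isCont (\<lambda>y. F1 (u y) y) x"
    using F1_cont continuous_at_compose[of x "\<lambda>y. (u y, y)" "\<lambda>(t, x). F1 t x"]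
    by (auto simp: continuous_on_eq_continuous_at o_def intro!: continuous_intros)
  then have m: "isCont (\<lambda>y. - 1 / F1 (u y) y) x"
    using F1_pos[of "u x" x] by (intro continuous_intros) auto
  have q: "((\<lambda>y. A (\<kappa> x) y + 1) has_derivative DA (\<kappa> x) x) (at x)"
    using has_derivative_add[OF _ has_derivative_const, of "A (\<kappa> x)" "DA (\<kappa> x) x" "at x" 1] C1_family_A
    by (simp add: C1_family_def)
  have "((\<lambda>y. (A (\<kappa> x) y + 1) * (- 1 / F1 (u y) y)) has_derivative (\<lambda>v. DA (\<kappa> x) x v * (- 1 / F1 (u x) x))) (at x)"
    by (rule has_derivative_mult_vanishing[OF q _ m]) (simp add: A_\<kappa>[OF x])
  then have "((\<lambda>y. \<kappa> x + (A (\<kappa> x) y + 1) * (- 1 / F1 (u y) y)) has_derivative D\<kappa> x) (at x)"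
    using has_derivative_add[OF has_derivative_const] by (fastforce simp: D\<kappa>_def[abs_def] ux)
  then show ?thesis
  proof (rule has_derivative_transform_within_open[OF _ open_basin x])
    fix y assume "y \<in> basin"
    then have "- 1 - A (\<kappa> x) y = (\<kappa> y - \<kappa> x) * F1 (u y) y" using u(2)[of y] A_\<kappa>[of y] by simp
    then show "\<kappa> x + (A (\<kappa> x) y + 1) * (- 1 / F1 (u y) y) = \<kappa> y"
      using F1_pos[of "u y" y] by (simp add: field_simps)
  qed
qed

lemma \<kappa>_cont: "continuous_on basin \<kappa>"
  by (auto intro!: continuous_at_imp_continuous_on \<kappa>_isCont)

lemma \<kappa>_C1: "C_k_on 1 \<kappa> basin"
proof -
  have "frechet_derivative \<kappa> (at x) = D\<kappa> x" if "x \<in> basin" for x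
    using frechet_derivative_at[OF \<kappa>_has_derivative[OF that]] by simp
  moreover have "continuous_on basin (\<lambda>x. D\<kappa> x v)" for v
  proof -
    have "continuous_on basin (\<lambda>x. (\<kappa> x, x))" by (intro continuous_intros \<kappa>_cont)
    then have "continuous_on basin (\<lambda>x. DA (\<kappa> x) x)" "continuous_on basin (\<lambda>x. F1 (\<kappa> x) x)"
      using continuous_on_compose2[of UNIV "\<lambda>(t, x). DA t x" basin "\<lambda>x. (\<kappa> x, x)"]
        continuous_on_compose2[OF F1_cont, of basin "\<lambda>x. (\<kappa> x, x)"] C1_family_A
      by (auto simp: C1_family_def)
    then show ?thesis
      unfolding D\<kappa>_def using F1_pos by (intro continuous_intros) (auto simp: less_imp_neq[THEN not_sym])
  qed
  ultimately show ?thesis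
    using \<kappa>_has_derivative by (auto simp: differentiable_def cong: continuous_on_cong)
qed

lemma F0_integrable: "x \<in> basin \<Longrightarrow> set_integrable lborel {..a} (\<lambda>s. F0 s x)"
  and F1_integrable: "x \<in> basin \<Longrightarrow> set_integrable lborel {..a} (\<lambda>s. F1 s x)"
proof -
  assume x: "x \<in> basin"
  obtain T C c where c: "c > 0" "\<forall>t\<le>T. jac t x \<le> C * exp (c * t)" using jac_decays_backwards[OF x] by blast
  have bd: "\<bar>\<rho> (X t x) * jac t x\<bar> \<le> (B * C) * exp (c * t)" if "t \<le> T" "\<forall>y. norm (\<rho> y) \<le> B" for \<rho> :: "real^'n \<Rightarrow> real" and B t
  proof -
    have "B \<ge> 0" using that(2) norm_ge_zero order_trans by blast
    then have "norm (\<rho> (X t x)) * jac t x \<le> B * (C * exp (c * t))"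
      using that c jac_pos[of t x] by (intro mult_mono) auto
    then show ?thesis using jac_pos[of t x] by (simp add: abs_mult)
  qed
  obtain B0 where B0: "\<forall>y. norm (\<rho>0 y) \<le> B0" using periodic_bounded[OF \<rho>0_periodic \<rho>0_cont] ..
  obtain B1 where B1: "\<forall>y. norm (\<rho>1 y) \<le> B1" using periodic_bounded[OF \<rho>1_periodic \<rho>1_cont] ..
  show "set_integrable lborel {..a} (\<lambda>s. F0 s x)"
    by (rule set_integrable_exp_decay[OF F0_cont_time c(1)]) (use bd[OF _ B0] in \<open>simp add: F0_def\<close>)
  show "set_integrable lborel {..a} (\<lambda>s. F1 s x)"
    by (rule set_integrable_exp_decay[OF F1_cont_time c(1)]) (use bd[OF _ B1] in \<open>simp add: F1_def\<close>)
qed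

text \<open>
  The Jacobian is a primitive of the integrand, equal to \<open>1\<close> at time \<open>0\<close> and tending to \<open>0\<close> at \<open>-\<infinity>\<close>.
\<close>

lemma integral_F1_minus_F0:
  assumes x: "x \<in> basin"
  shows "(LINT s:{..0}|lborel. F1 s x - F0 s x) = 1"
proof -
  have int: "set_integrable lborel {..0} (\<lambda>s. F1 s x - F0 s x)"
    by (rule set_integral_diff(1)[OF F1_integrable[OF x] F0_integrable[OF x]])
  have eint: "einterval (- \<infinity>) (ereal 0) = {..<0}" by (auto simp: einterval_def)
  have "(LBINT s=-\<infinity>..ereal 0. F1 s x - F0 s x) = 1 - 0"
  proof (rule interval_integral_FTC_integrable[where F="\<lambda>t. jac t x"])
    show "((\<lambda>t. jac t x) has_vector_derivative F1 s x - F0 s x) (at s)" for s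
      using jac_deriv_F by (simp add: has_real_derivative_iff_has_vector_derivative)
    show "isCont (\<lambda>s. F1 s x - F0 s x) s" for s
      using F0_cont_time F1_cont_time by (auto simp: continuous_on_eq_continuous_at intro!: continuous_intros)
    show "set_integrable lborel (einterval (- \<infinity>) (ereal 0)) (\<lambda>s. F1 s x - F0 s x)"
      by (rule set_integrable_subset[OF int]) (auto simp: eint)
    have "((\<lambda>t. jac t x) \<longlongrightarrow> 0) at_bot"
    proof (rule order_tendstoI)
      show "a < 0 \<Longrightarrow> \<forall>\<^sub>F t in at_bot. a < jac t x" for a
        using jac_pos by (intro always_eventually allI) (metis order_less_trans)
      show "0 < a \<Longrightarrow> \<forall>\<^sub>F t in at_bot. jac t x < a" for a
        using jac_tendsto_0[OF x, of a] by (simp add: eventually_at_bot_linorder)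
    qed
    then show "(((\<lambda>t. jac t x) \<circ> real_of_ereal) \<longlongrightarrow> 0) (at_right (- \<infinity>))"
      by (simp add: ereal_tendsto_simps)
    have "((\<lambda>t. jac t x) \<longlongrightarrow> jac 0 x) (at_left 0)"
      using DERIV_isCont[OF jac_deriv, of 0 x] unfolding isCont_def by (rule tendsto_within_subset) simp
    then show "(((\<lambda>t. jac t x) \<circ> real_of_ereal) \<longlongrightarrow> 1) (at_left (ereal 0))"
      unfolding ereal_tendsto_simps by simp
  qed simp
  then have "(LINT s:{..<0}|lborel. F1 s x - F0 s x) = 1"
    by (simp add: interval_lebesgue_integral_def eint zero_ereal_def)
  moreover have "(LINT s:{..<0}|lborel. F1 s x - F0 s x) = (LINT s:{..0}|lborel. F1 s x - F0 s x)"
  proof (rule set_integral_cong_set)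
    have "AE s in lborel. s \<noteq> (0::real)" by (rule AE_lborel_singleton)
    then show "AE s in lborel. (s \<in> {..0}) = (s \<in> {..<0::real})" by eventually_elim auto
    have "set_integrable lborel {..<0} (\<lambda>s. F1 s x - F0 s x)"
      by (rule set_integrable_subset[OF int]) auto
    then show "set_borel_measurable lborel {..<0} (\<lambda>s. F1 s x - F0 s x)"
      unfolding set_borel_measurable_def set_integrable_def by (rule borel_measurable_integrable)
    show "set_borel_measurable lborel {..0} (\<lambda>s. F1 s x - F0 s x)"
      using int unfolding set_borel_measurable_def set_integrable_def by (rule borel_measurable_integrable)
  qed
  ultimately show ?thesis by simp
qed

lemma integral_equation:
  assumes x: "x \<in> basin"
  shows "(LINT s:{..0}|lborel. F0 s x) = (LINT s:{..\<kappa> x}|lborel. F1 s x)"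
proof -
  have "(LINT s:{..0}|lborel. F1 s x) - (LINT s:{..0}|lborel. F0 s x) = 1"
    using integral_F1_minus_F0[OF x] set_integral_diff(2)[OF F1_integrable[OF x] F0_integrable[OF x]] by simp
  moreover have "(LINT s:{..0}|lborel. F1 s x) = (LINT s:{..\<kappa> x}|lborel. F1 s x) + (LINT s:{\<kappa> x<..0}|lborel. F1 s x)"
  proof -
    have split: "{..0} = {..\<kappa> x} \<union> {\<kappa> x<..0}" using \<kappa>_neg[OF x] by auto
    have "set_integrable lborel {\<kappa> x<..0} (\<lambda>s. F1 s x)"
      by (rule set_integrable_subset[OF F1_integrable[OF x, of 0]]) auto
    then show ?thesis
      unfolding split by (intro set_integral_Un F1_integrable[OF x]) auto
  qed
  moreover have "(LINT s:{\<kappa> x<..0}|lborel. F1 s x) = 1"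
  proof -
    have "(LBINT s=ereal (\<kappa> x)..ereal 0. F1 s x) = A 0 x - A (\<kappa> x) x"
    proof (rule interval_integral_FTC_finite)
      show "((\<lambda>t. A t x) has_vector_derivative F1 s x) (at s within {min (\<kappa> x) 0..max (\<kappa> x) 0})" for s
        using A_deriv by (auto simp: has_real_derivative_iff_has_vector_derivative intro: has_vector_derivative_at_within)
    qed (rule continuous_on_subset[OF F1_cont_time subset_UNIV])
    moreover have "(LBINT s=ereal (\<kappa> x)..ereal 0. F1 s x) = (LINT s:{\<kappa> x<..0}|lborel. F1 s x)"
      by (rule interval_integral_Ioc) (use \<kappa>_neg[OF x] in simp)
    ultimately show ?thesis using A_\<kappa>[OF x] by simp
  qed
  ultimately show ?thesis by simp
qed

end

section \<open>The transport map\<close>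

context transport_flow
begin

definition T :: "real^'n \<Rightarrow> real^'n" where
  "T x = X (\<kappa> x) x"

text \<open>
  Both sides are primitives of \<open>F1 (s + t) x\<close>, because \<open>F1\<close> inherits the cocycle identity of the Jacobian.
\<close>

lemma A_shift: "A s (X t x) * jac t x = A (s + t) x - A t x"
proof -
  have "F1 s (X t x) * jac t x = F1 (s + t) x" for s
    by (simp add: F1_def X_add jac_add)
  moreover have "((\<lambda>s. A (s + t) x) has_vector_derivative F1 (s + t) x) (at s)" for s
    unfolding has_real_derivative_iff_has_vector_derivative[symmetric]
    using DERIV_shift[of "\<lambda>s. A s x" "F1 (s + t) x" s t] A_deriv by simp
  moreover have "((\<lambda>s. A s (X t x) * jac t x) has_vector_derivative F1 s (X t x) * jac t x) (at s)" for s
    unfolding has_real_derivative_iff_has_vector_derivative[symmetric]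
    by (rule DERIV_cmult_right[OF A_deriv])
  ultimately have "primitive (\<lambda>s. F1 (s + t) x) s = A (s + t) x - A (0 + t) x"
    "primitive (\<lambda>s. F1 (s + t) x) s = A s (X t x) * jac t x - A 0 (X t x) * jac t x"
    using primitive_eq[of "\<lambda>s. A (s + t) x" "\<lambda>s. F1 (s + t) x" s]
      primitive_eq[of "\<lambda>s. A s (X t x) * jac t x" "\<lambda>s. F1 (s + t) x" s] by simp_all
  then show ?thesis by simp
qed

text \<open>
  The comparison of \<open>\<kappa>\<close> at the points of one orbit, which governs both injectivity and the Jacobian of
  the transport map: the right-hand side is a primitive of \<open>F0\<close>.
\<close>

lemma A_\<kappa>_along_flow:
  assumes "x \<in> basin"
  shows "A (t + \<kappa> (X t x)) x = A t x - jac t x"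
  using A_shift[of "\<kappa> (X t x)" t x] A_\<kappa>[OF basin_flow[OF assms]] by (simp add: add.commute)

lemma A_minus_jac_deriv: "((\<lambda>t. A t x - jac t x) has_real_derivative F0 t x) (at t)"
  using DERIV_diff[OF A_deriv[of x t] jac_deriv_F[of x t]] by simp

text \<open>
  If \<open>T x = T y\<close> then \<open>y = X s x\<close> with \<open>s = \<kappa> x - \<kappa> y\<close>, so the strictly increasing function
  \<open>t \<mapsto> A t x - jac t x\<close> takes the same value at \<open>s\<close> and \<open>0\<close>.
\<close>

lemma T_inj: "inj_on T basin"
proof (rule inj_onI)
  fix x y assume x: "x \<in> basin" and y: "y \<in> basin" and eq: "T x = T y"
  define s where "s = \<kappa> x - \<kappa> y"
  have "y = X (- \<kappa> y) (T y)" by (simp add: T_def)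
  also have "\<dots> = X (- \<kappa> y) (T x)" using eq by simp
  also have "\<dots> = X s x" using X_add[of "- \<kappa> y" "\<kappa> x" x] by (simp add: T_def s_def)
  finally have ys: "y = X s x" .
  have "A s x - jac s x = A (s + \<kappa> y) x" using A_\<kappa>_along_flow[OF x, of s] ys by simp
  also have "\<dots> = A 0 x - jac 0 x" using A_\<kappa>[OF x] by (simp add: s_def)
  finally have eq0: "A s x - jac s x = A 0 x - jac 0 x" .
  have mono: "a < b \<Longrightarrow> A a x - jac a x < A b x - jac b x" for a b
    by (rule DERIV_pos_imp_increasing[of a b "\<lambda>t. A t x - jac t x"]) (use A_minus_jac_deriv F0_pos in \<open>blast+\<close>)
  have "s = 0" using mono[of s 0] mono[of 0 s] eq0 by (cases s "0::real" rule: linorder_cases) auto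
  then show "x = y" by (simp add: ys)
qed

lemma D\<kappa>_along_field:
  assumes x: "x \<in> basin"
  shows "F1 (\<kappa> x) x * (1 + D\<kappa> x (grad V x)) = \<rho>0 x"
proof -
  have "(\<kappa> has_derivative D\<kappa> x) (at (X 0 x) within range (\<lambda>t. X t x))"
    by (simp add: has_derivative_at_withinI[OF \<kappa>_has_derivative[OF x]])
  then have "((\<lambda>t. \<kappa> (X t x)) has_vector_derivative D\<kappa> x (grad V x)) (at 0)"
    using vector_derivative_diff_chain_within[OF X_deriv[of x 0]] by (fastforce simp: o_def)
  then have "((\<lambda>t. t + \<kappa> (X t x)) has_real_derivative 1 + D\<kappa> x (grad V x)) (at 0)"
    by (intro DERIV_add DERIV_ident) (simp add: has_real_derivative_iff_has_vector_derivative)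
  then have "((\<lambda>t. A (t + \<kappa> (X t x)) x) has_real_derivative F1 (\<kappa> x) x * (1 + D\<kappa> x (grad V x))) (at 0)"
    using A_deriv[of x "\<kappa> x"] by (intro DERIV_chain2[where f="\<lambda>t. A t x"]) simp_all
  then have "((\<lambda>t. A t x - jac t x) has_real_derivative F1 (\<kappa> x) x * (1 + D\<kappa> x (grad V x))) (at 0)"
    by (simp add: A_\<kappa>_along_flow[OF x])
  from DERIV_unique[OF this A_minus_jac_deriv] show ?thesis by (simp add: F0_def)
qed

definition DT :: "real^'n \<Rightarrow> real^'n \<Rightarrow> real^'n" where
  "DT x v = DX (\<kappa> x) x (v + D\<kappa> x v *\<^sub>R grad V x)"

lemma T_has_derivative:
  assumes x: "x \<in> basin"
  shows "(T has_derivative DT x) (at x)"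
proof -
  have "((\<lambda>(t, y). X t y) has_derivative (\<lambda>(s, v). s *\<^sub>R grad V (X (\<kappa> x) x) + DX (\<kappa> x) x v)) (at (\<kappa> x, x) within UNIV \<times> UNIV)"
  proof (rule has_derivative_partialsI)
    show "((\<lambda>t. X t x) has_derivative (\<lambda>s. s *\<^sub>R grad V (X (\<kappa> x) x))) (at (\<kappa> x))"
      using X_deriv by (simp add: has_vector_derivative_def)
    show "continuous (at (\<kappa> x, x) within UNIV \<times> UNIV) (\<lambda>(t, y). DX t y)"
      using DX_cont by (simp add: continuous_on_eq_continuous_at)
  qed (use X_has_derivative in auto)
  then have X2: "((\<lambda>q. X (fst q) (snd q)) has_derivative (\<lambda>q. fst q *\<^sub>R grad V (X (\<kappa> x) x) + DX (\<kappa> x) x (snd q))) (at (\<kappa> x, x))"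
    by (simp add: case_prod_beta')
  have "((\<lambda>y. (\<kappa> y, y)) has_derivative (\<lambda>v. (D\<kappa> x v, v))) (at x)"
    by (intro has_derivative_Pair \<kappa>_has_derivative[OF x] has_derivative_ident)
  from has_derivative_compose[OF this X2]
  have "(T has_derivative (\<lambda>v. D\<kappa> x v *\<^sub>R grad V (X (\<kappa> x) x) + DX (\<kappa> x) x v)) (at x)"
    by (simp add: T_def[abs_def])
  moreover have "D\<kappa> x v *\<^sub>R grad V (X (\<kappa> x) x) + DX (\<kappa> x) x v = DT x v" for v
    by (simp add: DT_def blinfun.add_right blinfun.scaleR_right DX_b add.commute)
  ultimately show ?thesis by simp
qed

text \<open>
  As \<open>DX\<close> maps the field at \<open>x\<close> to the field at \<open>T x\<close>, the derivative of \<open>T\<close> is \<open>DX\<close> after the rank one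
  perturbation \<open>v \<mapsto> v + (D\<kappa> x v) grad V x\<close> of the identity.
\<close>

lemma T_jacobian:
  assumes x: "x \<in> basin"
  shows "\<bar>det (matrix (DT x))\<bar> * \<rho>1 (T x) = \<rho>0 x"
proof -
  define u where "u = grad V x"
  define w where "w = (\<chi> j. D\<kappa> x (axis j 1))"
  have bl: "bounded_linear (D\<kappa> x)" using \<kappa>_has_derivative[OF x] by (rule has_derivative_bounded_linear)
  have wv: "w \<bullet> v = D\<kappa> x v" for v
  proof -
    interpret bounded_linear "D\<kappa> x" by (rule bl)
    have "D\<kappa> x v = D\<kappa> x (\<Sum>i\<in>UNIV. v $ i *\<^sub>R axis i 1)"
      by (simp add: scalar_mult_eq_scaleR[symmetric] basis_expansion)
    then show ?thesis by (simp add: sum scaleR w_def inner_vec_def mult.commute)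
  qed
  have "1 + w \<bullet> u = \<rho>0 x / F1 (\<kappa> x) x"
    using D\<kappa>_along_field[OF x] F1_pos[of "\<kappa> x" x] by (simp add: wv u_def field_simps)
  then have pos: "1 + w \<bullet> u > 0" using \<rho>0_pos F1_pos by simp
  let ?L = "\<lambda>v. v + D\<kappa> x v *\<^sub>R u"
  have mL: "matrix ?L = mat 1 + (\<chi> i j. u $ i * w $ j)"
    by (simp add: matrix_def mat_def vec_eq_iff w_def axis_def mult.commute)
  have linL: "linear ?L"
    by (intro bounded_linear.linear bounded_linear_add bounded_linear_ident bounded_linear_scaleR_const bl)
  have "DT x = DX (\<kappa> x) x \<circ> ?L" by (simp add: fun_eq_iff DT_def u_def)
  moreover have "linear (DX (\<kappa> x) x)" by (simp add: blinfun.bounded_linear_right bounded_linear.linear)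
  ultimately have "det (matrix (DT x)) = jac (\<kappa> x) x * (1 + w \<bullet> u)"
    by (simp only: matrix_compose[OF linL] det_mul mL det_rank_one_update[OF pos] jac_def)
  then have "\<bar>det (matrix (DT x))\<bar> * \<rho>1 (T x) = F1 (\<kappa> x) x * (1 + w \<bullet> u)"
    using pos jac_pos[of "\<kappa> x" x] by (simp add: F1_def T_def abs_mult)
  then show ?thesis using D\<kappa>_along_field[OF x] by (simp add: wv u_def)
qed

lemma T_translate: "k \<in> int_lattice \<Longrightarrow> T (x + k) = T x + k"
  by (simp add: T_def \<kappa>_translate X_translate)

lemma T_cont: "continuous_on basin T"
  by (auto intro!: continuous_at_imp_continuous_on has_derivative_continuous[OF T_has_derivative])

end

lemma countable_int_lattice: "countable (int_lattice :: (real^'n) set)"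
proof -
  have "int_lattice \<subseteq> range (\<lambda>g::'n \<Rightarrow> int. \<chi> i. real_of_int (g i))"
  proof
    fix k :: "real^'n" assume "k \<in> int_lattice"
    then have "k = (\<chi> i. real_of_int (\<lfloor>k $ i\<rfloor>))" by (simp add: int_lattice_def vec_eq_iff)
    then show "k \<in> range (\<lambda>g::'n \<Rightarrow> int. \<chi> i. real_of_int (g i))"
      by (rule image_eqI[where x="\<lambda>i. \<lfloor>k $ i\<rfloor>"]) simp
  qed
  then show ?thesis by (rule countable_subset) simp
qed

lemma unit_cell_borel: "unit_cell \<in> sets (borel :: (real^'n) measure)"
proof -
  have "(unit_cell :: (real^'n) set) = (\<Inter>i\<in>UNIV. {x. 0 \<le> x $ i} \<inter> {x. x $ i < 1})" by (auto simp: unit_cell_def)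
  also have "\<dots> \<in> sets borel"
    by (intro sets.finite_INT sets.Int borel_closed borel_open closed_Collect_le open_Collect_less)
      (auto intro!: continuous_intros)
  finally show ?thesis .
qed

lemma torus_proj_borel: "torus_proj \<in> borel_measurable borel"
proof -
  have "(\<lambda>x. torus_proj x \<bullet> b) \<in> borel_measurable borel" if b: "b \<in> Basis" for b :: "real^'n"
  proof -
    obtain i where i: "b = axis i 1" using b by (auto simp: Basis_vec_def)
    have "(\<lambda>x::real^'n. x $ i - real_of_int \<lfloor>x $ i\<rfloor>) \<in> borel_measurable borel"
      by (intro borel_measurable_diff measurable_compose[OF _ borel_measurable_real_floor]
          borel_measurable_continuous_onI continuous_intros)
    then show ?thesis by (simp add: i inner_axis torus_proj_def frac_def)
  qed
  then show ?thesis using borel_measurable_euclidean_space by blast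
qed

lemma torus_proj_in_cell: "torus_proj x \<in> unit_cell"
  by (simp add: torus_proj_def unit_cell_def frac_lt_1)

lemma torus_proj_diff: "x - torus_proj x \<in> int_lattice"
  by (simp add: torus_proj_def int_lattice_def frac_def)

lemma unit_cell_unique:
  assumes "x \<in> unit_cell" "y \<in> unit_cell" "x - y \<in> int_lattice"
  shows "x = y"
proof -
  have "x $ i = y $ i" for i
  proof -
    obtain m where m: "x $ i - y $ i = of_int m" using assms(3) by (auto simp: int_lattice_def Ints_def)
    have "\<bar>x $ i - y $ i\<bar> < 1" using assms(1,2) by (auto simp: unit_cell_def abs_less_iff) (smt (verit))+
    then have "m = 0" unfolding m by (simp flip: of_int_abs)
    then show ?thesis using m by simp
  qed
  then show ?thesis by (simp add: vec_eq_iff)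
qed

lemma space_torus: "space torus_measure = unit_cell"
  by (simp add: torus_measure_def space_restrict_space)

lemma sets_torus: "sets torus_measure = {A. A \<in> sets borel \<and> A \<subseteq> unit_cell}"
  using unit_cell_borel by (auto simp: torus_measure_def sets_restrict_space_iff sets_restrict_space image_iff) 

context transport_flow
begin

definition cell_basin :: "(real^'n) set" where
  "cell_basin = unit_cell \<inter> basin"

lemma cell_basin_borel: "cell_basin \<in> sets borel"
  using unit_cell_borel open_basin by (auto simp: cell_basin_def)

lemma restrict_torus: "restrict_space torus_measure basin = restrict_space lborel cell_basin"
  unfolding torus_measure_def cell_basin_def
  by (rule restrict_restrict_space) (use unit_cell_borel open_basin in auto)

lemma T_measurable: "T \<in> borel_measurable (restrict_space lborel cell_basin)"
proof -
  have "T \<in> borel_measurable (restrict_space borel cell_basin)"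
    by (intro borel_measurable_continuous_on_restrict continuous_on_subset[OF T_cont]) (auto simp: cell_basin_def)
  then show ?thesis by (simp cong: measurable_cong_sets add: sets_restrict_space)
qed

lemma T_vimage_borel:
  assumes "B \<in> sets borel"
  shows "cell_basin \<inter> T -` B \<in> sets borel"
proof -
  have "T -` B \<inter> space (restrict_space lborel cell_basin) \<in> sets (restrict_space lborel cell_basin)"
    using T_measurable assms by (rule measurable_sets)
  then show ?thesis
    using cell_basin_borel by (simp add: space_restrict_space sets_restrict_space_iff Int_commute)
qed

lemma emeasure_density_lebesgue:
  assumes "\<rho> \<in> borel_measurable borel" "S \<in> sets borel"
  shows "emeasure (density lebesgue (\<lambda>x. ennreal (\<rho> x))) S = (\<integral>\<^sup>+x. ennreal (\<rho> x) * indicator S x \<partial>lborel)"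
  using assms by (subst emeasure_density) (auto simp: nn_integral_completion intro!: measurable_completion)

text \<open>
  The unit cell is cut according to the lattice vector \<open>k\<close> by which the projection to the torus moves
  \<open>T x\<close>. On each piece \<open>x \<mapsto> T x - k\<close> is smooth and injective with the right Jacobian, and the images of
  the pieces are disjoint subsets of \<open>B\<close> because \<open>T\<close> is injective and commutes with lattice translations.
\<close>

lemma pushforward_le:
  assumes B: "B \<in> sets borel" "B \<subseteq> unit_cell"
  shows "(\<integral>\<^sup>+x. ennreal (\<rho>0 x) * indicator (cell_basin \<inter> (torus_proj \<circ> T) -` B) x \<partial>lborel)
    \<le> (\<integral>\<^sup>+x. ennreal (\<rho>1 x) * indicator B x \<partial>lborel)"
proof -
  define S where "S k = cell_basin \<inter> T -` ((\<lambda>x. x - k) -` B)" for k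
  let ?M0 = "density lebesgue (\<lambda>x. ennreal (\<rho>0 x))" and ?M1 = "density lebesgue (\<lambda>x. ennreal (\<rho>1 x))"
  have meas: "\<rho>0 \<in> borel_measurable borel" "\<rho>1 \<in> borel_measurable borel"
    using \<rho>0_cont \<rho>1_cont by (auto intro: borel_measurable_continuous_onI)
  have S_borel: "S k \<in> sets borel" for k
  proof -
    have "(\<lambda>x. x - k) -` B \<inter> space borel \<in> sets borel" for k :: "real^'n"
      using B(1) by (intro measurable_sets) (auto intro!: borel_measurable_continuous_onI continuous_intros)
    then show ?thesis unfolding S_def by (intro T_vimage_borel) simp
  qed
  have S_union: "cell_basin \<inter> (torus_proj \<circ> T) -` B = (\<Union>k\<in>int_lattice. S k)"
  proof (intro equalityI subsetI)
    fix x assume x: "x \<in> cell_basin \<inter> (torus_proj \<circ> T) -` B"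
    then have "x \<in> S (T x - torus_proj (T x))" by (simp add: S_def)
    then show "x \<in> (\<Union>k\<in>int_lattice. S k)" using torus_proj_diff by blast
  next
    fix x assume "x \<in> (\<Union>k\<in>int_lattice. S k)"
    then obtain k where k: "k \<in> int_lattice" "x \<in> cell_basin" "T x - k \<in> B" by (auto simp: S_def)
    have "torus_proj (T x) - (T x - k) = k - (T x - torus_proj (T x))" by simp
    also have "\<dots> \<in> int_lattice" by (intro int_lattice_diff k torus_proj_diff)
    finally have "torus_proj (T x) = T x - k"
      using unit_cell_unique[OF torus_proj_in_cell] k(3) B(2) by blast
    then show "x \<in> cell_basin \<inter> (torus_proj \<circ> T) -` B" using k by simp
  qed
  have T_disj: "x = y \<and> k = l" if "x \<in> cell_basin" "y \<in> cell_basin" "T x - k = T y - l" "k \<in> int_lattice" "l \<in> int_lattice" for x y k l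
  proof -
    have kl: "k - l \<in> int_lattice" using that int_lattice_diff by blast
    have "T x = T (y + (k - l))" using that(3) unfolding T_translate[OF kl] by (simp add: algebra_simps)
    moreover have "x \<in> basin" "y + (k - l) \<in> basin"
      using that(1,2) basin_translate[OF kl] by (auto simp: cell_basin_def)
    ultimately have eq: "x = y + (k - l)" by (rule inj_onD[OF T_inj])
    have "x = y"
    proof (rule unit_cell_unique)
      show "x - y \<in> int_lattice" using kl by (simp add: eq)
    qed (use that(1,2) in \<open>auto simp: cell_basin_def\<close>)
    with eq show ?thesis by simp
  qed
  define Tk where "Tk k x = T x - k" for k x
  have piece: "Tk k ` S k \<in> sets lebesgue \<and> emeasure ?M1 (Tk k ` S k) = emeasure ?M0 (S k)" if k: "k \<in> int_lattice" for k
  proof -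
    have der: "(Tk k has_derivative DT x) (at x within S k)" if "x \<in> S k" for x
      unfolding Tk_def using that has_derivative_diff[OF T_has_derivative has_derivative_const, of x k]
      by (auto simp: S_def cell_basin_def intro: has_derivative_at_withinI)
    have inj: "inj_on (Tk k) (S k)"
      using T_inj by (auto simp: inj_on_def Tk_def S_def cell_basin_def)
    have jac: "\<bar>det (matrix (DT x))\<bar> * \<rho>1 (Tk k x) = \<rho>0 x" if "x \<in> S k" for x
      using that T_jacobian[of x] periodic_diff[OF \<rho>1_periodic k, of "T x"]
      by (auto simp: S_def cell_basin_def Tk_def)
    have "\<rho>0 absolutely_integrable_on cbox 0 1"
      by (intro absolutely_integrable_continuous continuous_on_subset[OF \<rho>0_cont]) auto
    moreover have "S k \<subseteq> cbox 0 1" by (auto simp: S_def cell_basin_def unit_cell_def mem_box_cart less_imp_le)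
    ultimately have int: "\<rho>0 absolutely_integrable_on S k"
      using S_borel by (auto intro: set_integrable_subset)
    show ?thesis
      using emeasure_density_image[OF _ der inj jac int \<rho>1_pos \<rho>0_pos] S_borel meas by (auto simp: measurable_completion)
  qed
  have "(\<integral>\<^sup>+x. ennreal (\<rho>0 x) * indicator (cell_basin \<inter> (torus_proj \<circ> T) -` B) x \<partial>lborel) = emeasure ?M0 (\<Union>k\<in>int_lattice. S k)"
    unfolding S_union using S_borel meas countable_int_lattice
    by (intro emeasure_density_lebesgue[symmetric] sets.countable_UN') auto
  also have "\<dots> = (\<integral>\<^sup>+k. emeasure ?M0 (S k) \<partial>count_space int_lattice)"
  proof (rule emeasure_UN_countable)
    show "disjoint_family_on S int_lattice"
      unfolding disjoint_family_on_def
    proof (intro ballI impI, rule ccontr)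
      fix k l assume kl: "k \<in> int_lattice" "l \<in> int_lattice" "k \<noteq> l" "S k \<inter> S l \<noteq> {}"
      then obtain x where "T x - k \<in> unit_cell" "T x - l \<in> unit_cell" using B(2) by (auto simp: S_def)
      then have "T x - k = T x - l" using int_lattice_diff[OF kl(2,1)] by (intro unit_cell_unique) auto
      then show False using kl(3) by simp
    qed
  qed (use S_borel countable_int_lattice in auto)
  also have "\<dots> = (\<integral>\<^sup>+k. emeasure ?M1 (Tk k ` S k) \<partial>count_space int_lattice)"
    by (intro nn_integral_cong) (simp add: piece)
  also have "\<dots> = emeasure ?M1 (\<Union>k\<in>int_lattice. Tk k ` S k)"
  proof (rule emeasure_UN_countable[symmetric])
    show "disjoint_family_on (\<lambda>k. Tk k ` S k) int_lattice"
      unfolding disjoint_family_on_def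
    proof (intro ballI impI, rule ccontr)
      fix k l assume kl: "k \<in> int_lattice" "l \<in> int_lattice" "k \<noteq> l" "Tk k ` S k \<inter> Tk l ` S l \<noteq> {}"
      then obtain x y where "x \<in> S k" "y \<in> S l" "T x - k = T y - l" by (auto simp: Tk_def)
      then show False using T_disj[of x y k l] kl by (auto simp: S_def)
    qed
  qed (use piece countable_int_lattice in auto)
  also have "\<dots> \<le> emeasure ?M1 B"
    by (rule emeasure_mono) (use B in \<open>auto simp: Tk_def S_def\<close>)
  also have "\<dots> = (\<integral>\<^sup>+x. ennreal (\<rho>1 x) * indicator B x \<partial>lborel)"
    by (rule emeasure_density_lebesgue[OF meas(2) B(1)])
  finally show ?thesis .
qed

lemma AE_basin: "AE x in torus_measure. x \<in> basin"
proof -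
  have "- basin \<in> null_sets lborel"
    using negligible_Compl_basin open_basin
    by (simp add: negligible_iff_null_sets null_sets_completion_iff borel_closed closed_Compl)
  then have "AE x in lborel. x \<in> basin" using AE_not_in by fastforce
  then show ?thesis
    unfolding torus_measure_def using unit_cell_borel by (subst AE_restrict_space_iff) auto
qed

lemma proj_T_measurable: "torus_proj \<circ> T \<in> measurable (restrict_space torus_measure basin) torus_measure"
proof -
  have "torus_proj \<circ> T \<in> borel_measurable (restrict_space lborel cell_basin)"
    using measurable_compose[OF T_measurable torus_proj_borel] by (simp add: o_def)
  then show ?thesis
    unfolding restrict_torus unfolding torus_measure_def
    by (intro measurable_restrict_space2) (auto simp: torus_proj_in_cell)
qed

text \<open>
  Both measures have total mass \<open>1\<close> and one dominates the other, so they agree. In particular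
  the image of the basin under \<open>T\<close> has full measure.
\<close>

lemma pushforward:
  "distr (density (restrict_space torus_measure basin) (\<lambda>x. ennreal (\<rho>0 x))) torus_measure (torus_proj \<circ> T)
     = density torus_measure (\<lambda>x. ennreal (\<rho>1 x))" (is "?M = ?N")
proof -
  have meas: "\<rho>0 \<in> borel_measurable borel" "\<rho>1 \<in> borel_measurable borel"
    using \<rho>0_cont \<rho>1_cont by (auto intro: borel_measurable_continuous_onI)
  have m0: "\<rho>0 \<in> borel_measurable (restrict_space torus_measure basin)"
    and m1: "\<rho>1 \<in> borel_measurable torus_measure"
    unfolding restrict_torus unfolding torus_measure_def using meas by (auto intro: measurable_restrict_space1)
  have pm: "torus_proj \<circ> T \<in> measurable (density (restrict_space torus_measure basin) (\<lambda>x. ennreal (\<rho>0 x))) torus_measure"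
    using proj_T_measurable by simp
  have M: "emeasure ?M B = (\<integral>\<^sup>+x. ennreal (\<rho>0 x) * indicator (cell_basin \<inter> (torus_proj \<circ> T) -` B) x \<partial>lborel)"
    if B: "B \<in> sets torus_measure" for B
  proof -
    have pre: "(torus_proj \<circ> T) -` B \<inter> space (restrict_space torus_measure basin) \<in> sets (restrict_space torus_measure basin)"
      using proj_T_measurable B by (rule measurable_sets)
    have "emeasure ?M B = (\<integral>\<^sup>+x. ennreal (\<rho>0 x) * indicator ((torus_proj \<circ> T) -` B \<inter> space (restrict_space torus_measure basin)) x \<partial>restrict_space torus_measure basin)"
      using pm B pre m0 by (simp add: emeasure_distr emeasure_density)
    also have "\<dots> = (\<integral>\<^sup>+x. ennreal (\<rho>0 x) * indicator ((torus_proj \<circ> T) -` B \<inter> cell_basin) x * indicator cell_basin x \<partial>lborel)"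
      unfolding restrict_torus using cell_basin_borel
      by (subst nn_integral_restrict_space) (auto simp: space_restrict_space)
    also have "\<dots> = (\<integral>\<^sup>+x. ennreal (\<rho>0 x) * indicator (cell_basin \<inter> (torus_proj \<circ> T) -` B) x \<partial>lborel)"
      by (intro nn_integral_cong) (auto simp: indicator_def)
    finally show ?thesis .
  qed
  have N: "emeasure ?N B = (\<integral>\<^sup>+x. ennreal (\<rho>1 x) * indicator B x \<partial>lborel)" if B: "B \<in> sets torus_measure" for B
  proof -
    have "emeasure ?N B = (\<integral>\<^sup>+x. ennreal (\<rho>1 x) * indicator B x \<partial>torus_measure)"
      using B m1 by (simp add: emeasure_density)
    also have "\<dots> = (\<integral>\<^sup>+x. ennreal (\<rho>1 x) * indicator B x * indicator unit_cell x \<partial>lborel)"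
      unfolding torus_measure_def using unit_cell_borel by (subst nn_integral_restrict_space) auto
    also have "\<dots> = (\<integral>\<^sup>+x. ennreal (\<rho>1 x) * indicator B x \<partial>lborel)"
      using B by (intro nn_integral_cong) (auto simp: indicator_def sets_torus)
    finally show ?thesis .
  qed
  have le: "emeasure ?M B \<le> emeasure ?N B" if B: "B \<in> sets torus_measure" for B
    using pushforward_le[of B] B by (simp add: M[OF B] N[OF B] sets_torus)
  have cell: "unit_cell \<in> sets torus_measure" using unit_cell_borel by (simp add: sets_torus)
  have totN: "emeasure ?N unit_cell = 1"
    using m1 mass1 cell by (simp add: emeasure_density space_torus[symmetric] cong: nn_integral_cong)
  have totM: "emeasure ?M unit_cell = 1"
  proof -
    have "cell_basin \<inter> (torus_proj \<circ> T) -` unit_cell = cell_basin" by (auto simp: torus_proj_in_cell)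
    then have "emeasure ?M unit_cell = (\<integral>\<^sup>+x. ennreal (\<rho>0 x) * indicator cell_basin x \<partial>lborel)"
      by (simp add: M[OF cell])
    also have "\<dots> = (\<integral>\<^sup>+x. ennreal (\<rho>0 x) * indicator basin x * indicator unit_cell x \<partial>lborel)"
      by (intro nn_integral_cong) (auto simp: indicator_def cell_basin_def)
    also have "\<dots> = (\<integral>\<^sup>+x. ennreal (\<rho>0 x) * indicator basin x \<partial>torus_measure)"
      unfolding torus_measure_def using unit_cell_borel by (subst nn_integral_restrict_space) auto
    also have "\<dots> = (\<integral>\<^sup>+x. ennreal (\<rho>0 x) \<partial>torus_measure)"
      using AE_basin by (intro nn_integral_cong_AE) (auto elim!: eventually_mono simp: indicator_def)
    finally show ?thesis using mass0 by simp
  qed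
  show ?thesis
  proof (rule measure_eqI)
    show "sets ?M = sets ?N" by simp
    fix B assume "B \<in> sets ?M"
    then have B: "B \<in> sets torus_measure" by simp
    then have C: "unit_cell - B \<in> sets torus_measure" using cell by auto
    have sub: "B \<subseteq> unit_cell" using B by (simp add: sets_torus)
    then have split: "B \<union> unit_cell = unit_cell" by auto
    have sM: "emeasure ?M B + emeasure ?M (unit_cell - B) = 1"
      using plus_emeasure[of B ?M "unit_cell - B"] B C totM by (simp add: split)
    have sN: "emeasure ?N B + emeasure ?N (unit_cell - B) = 1"
      using plus_emeasure[of B ?N "unit_cell - B"] B C totN by (simp add: split)
    show "emeasure ?M B = emeasure ?N B"
    proof (rule antisym[OF le[OF B]], rule ccontr)
      assume "\<not> emeasure ?N B \<le> emeasure ?M B"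
      moreover have "emeasure ?M (unit_cell - B) \<noteq> \<infinity>" using sM by auto
      ultimately have "emeasure ?M B + emeasure ?M (unit_cell - B) < emeasure ?N B + emeasure ?M (unit_cell - B)"
        by (simp add: add.commute ennreal_add_left_cancel_less not_le)
      also have "\<dots> \<le> emeasure ?N B + emeasure ?N (unit_cell - B)" using le[OF C] by (intro add_left_mono)
      finally show False using sM sN by simp
    qed
  qed
qed

lemma transport: "is_transport_map basin T \<rho>0 \<rho>1"
  unfolding is_transport_map_def using proj_T_measurable pushforward by blast

end


section \<open>Existence of the transport map\<close>

lemma torus_integrable:
  fixes f :: "real^'n \<Rightarrow> real"
  assumes "continuous_on UNIV f"
  shows "integrable torus_measure f"
proof -
  have "set_integrable lborel (cbox 0 1) f"
    unfolding set_integrable_def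
    by (rule borel_integrable_compact[OF compact_cbox continuous_on_subset[OF assms subset_UNIV]])
  then have "set_integrable lborel unit_cell f"
    by (rule set_integrable_subset)
      (use unit_cell_borel in \<open>auto simp: unit_cell_def mem_box_cart less_imp_le\<close>)
  then show ?thesis
    unfolding torus_measure_def using unit_cell_borel
    by (subst integrable_restrict_space) (auto simp: set_integrable_def)
qed

lemma smooth_exp_deriv:
  assumes "torus_smooth U"
  shows "((\<lambda>x. c * exp (- U x)) has_derivative (- (c * exp (- U x))) *\<^sub>R blinfun_deriv U x) (at x)"
    and "continuous_on UNIV (\<lambda>x. (- (c * exp (- U x))) *\<^sub>R blinfun_deriv U x)"
    and "periodic (\<lambda>x. c * exp (- U x))"
    and "continuous_on UNIV (\<lambda>x. c * exp (- U x))"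
proof -
  have C1: "C_k_on (Suc 0) U UNIV" and per: "periodic U" using assms by (auto simp: torus_smooth_def simp del: C_k_on.simps)
  have cont: "continuous_on UNIV U" by (rule C_k_continuous[OF C1])
  show "((\<lambda>x. c * exp (- U x)) has_derivative (- (c * exp (- U x))) *\<^sub>R blinfun_deriv U x) (at x)"
    using C_k_has_derivative[OF C1, of x]
    by (auto intro!: derivative_eq_intros simp: scaleR_blinfun.rep_eq uminus_blinfun.rep_eq fun_eq_iff)
  show "continuous_on UNIV (\<lambda>x. (- (c * exp (- U x))) *\<^sub>R blinfun_deriv U x)"
    by (intro continuous_intros cont C_k_blinfun_deriv_continuous[OF C1])
  show "continuous_on UNIV (\<lambda>x. c * exp (- U x))" by (intro continuous_intros cont)
  show "periodic (\<lambda>x. c * exp (- U x))" using per by (simp add: periodic_def)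
qed

theorem proposition3p2:
  fixes U0 U1 V \<rho>0 \<rho>1 :: "real ^ 'n \<Rightarrow> real"
    and b :: "real ^ 'n \<Rightarrow> real ^ 'n"
    and X :: "real \<Rightarrow> real ^ 'n \<Rightarrow> real ^ 'n"
    and J :: "real \<Rightarrow> real ^ 'n \<Rightarrow> real"
  assumes "torus_smooth U0" and "torus_smooth U1"
    and "integral\<^sup>L torus_measure (\<lambda>x. exp (- U0 x)) = 1"
    and "\<rho>0 = (\<lambda>x. exp (- U0 x))"
    and "\<rho>1 = (\<lambda>x. exp (- U1 x) / integral\<^sup>L torus_measure (\<lambda>y. exp (- U1 y)))"
    and "torus_morse V"
    and "\<forall>x. laplacian V x = \<rho>1 x - \<rho>0 x"
    and "integral\<^sup>L torus_measure V = 0"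
    and "b = grad V"
    and "is_flow b X"
    and "J = flow_jacobian X"
  shows "\<exists>(D :: (real ^ 'n) set) (\<kappa> :: real ^ 'n \<Rightarrow> real).
      open D \<and> periodic (\<lambda>x. x \<in> D) \<and> (AE x in torus_measure. x \<in> D) \<and>
      (\<forall>x\<in>D. \<forall>k\<in>int_lattice. \<kappa> (x + k) = \<kappa> x) \<and>
      C_k_on 1 \<kappa> D \<and>
      (\<forall>x\<in>D.
         set_integrable lborel {..0} (\<lambda>s. \<rho>0 (X s x) * J s x) \<and>
         set_integrable lborel {..\<kappa> x} (\<lambda>s. \<rho>1 (X s x) * J s x) \<and>
         (LINT s:{..0}|lborel. \<rho>0 (X s x) * J s x)
           = (LINT s:{..\<kappa> x}|lborel. \<rho>1 (X s x) * J s x)) \<and>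
      is_transport_map D (\<lambda>x. X (\<kappa> x) x) \<rho>0 \<rho>1"
proof -
  define Z where "Z = integral\<^sup>L torus_measure (\<lambda>y. exp (- U1 y))"
  have e0: "\<rho>0 = (\<lambda>x. 1 * exp (- U0 x))" using assms(4) by simp
  have e1: "\<rho>1 = (\<lambda>x. (1 / Z) * exp (- U1 x))" using assms(5) by (simp add: Z_def)
  have int0: "integrable torus_measure (\<lambda>x. exp (- U0 x))"
    using torus_integrable[OF smooth_exp_deriv(4)[OF assms(1), of 1]] by simp
  have int1: "integrable torus_measure (\<lambda>x. exp (- U1 x))"
    using torus_integrable[OF smooth_exp_deriv(4)[OF assms(2), of 1]] by simp
  \<comment> \<open>The torus is not a null set because \<open>\<rho>0\<close> has integral \<open>1\<close>, so a positive function has positive integral.\<close>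
  have "Z \<noteq> 0"
  proof
    assume "Z = 0"
    then have "AE x in torus_measure. exp (- U1 x) = 0"
      unfolding Z_def using int1 by (subst (asm) integral_nonneg_eq_0_iff_AE) auto
    then have "AE x in torus_measure. exp (- U0 x) = 0" by eventually_elim simp
    then have "integral\<^sup>L torus_measure (\<lambda>x. exp (- U0 x)) = 0" by (rule integral_eq_zero_AE)
    then show False using assms(3) by simp
  qed
  then have Z: "Z > 0" unfolding Z_def using integral_nonneg_AE[of "\<lambda>x. exp (- U1 x)" torus_measure] by (simp add: order_less_le)
  have smoothV: "torus_smooth V" and nondeg: "\<And>x. grad V x = 0 \<Longrightarrow> det (hessian V x) \<noteq> 0"
    using assms(6) by (auto simp: torus_morse_def)
  interpret pot: torus_potential V by unfold_locales (rule smoothV)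
  obtain K where K: "\<forall>x. norm (pot.D2 x) \<le> K" using pot.D2_bounded ..
  interpret transport_flow V K X \<rho>0 \<rho>1 "\<lambda>x. (- (1 * exp (- U0 x))) *\<^sub>R blinfun_deriv U0 x"
    "\<lambda>x. (- (1 / Z * exp (- U1 x))) *\<^sub>R blinfun_deriv U1 x"
  proof unfold_locales
    show "(\<integral>\<^sup>+x. ennreal (\<rho>0 x) \<partial>torus_measure) = 1"
      using nn_integral_eq_integral[OF int0] assms(3,4) by simp
    have "(\<integral>\<^sup>+x. ennreal (\<rho>1 x) \<partial>torus_measure) = ennreal (integral\<^sup>L torus_measure \<rho>1)"
      unfolding e1 using int1 Z by (intro nn_integral_eq_integral) auto
    also have "integral\<^sup>L torus_measure \<rho>1 = 1" unfolding e1 using Z by (simp add: Z_def[symmetric])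
    finally show "(\<integral>\<^sup>+x. ennreal (\<rho>1 x) \<partial>torus_measure) = 1" by simp
  qed (use assms(7,9,10) K Z nondeg pot.grad_deriv pot.D2_ucont smooth_exp_deriv[OF assms(1), of 1]
      smooth_exp_deriv[OF assms(2), of "1 / Z"] in \<open>auto simp: is_flow_def e0 e1\<close>)
  have F: "\<rho>0 (X s x) * J s x = F0 s x" "\<rho>1 (X s x) * J s x = F1 s x" for s x
    by (simp_all add: F0_def F1_def assms(11) flow_jacobian_eq)
  show ?thesis
    unfolding F
    by (intro exI[of _ basin] exI[of _ \<kappa>] conjI ballI open_basin AE_basin \<kappa>_translate \<kappa>_C1
        F0_integrable F1_integrable integral_equation transport[unfolded T_def[abs_def]])
      (auto simp: periodic_def basin_translate)
qed

end
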